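(* There is a polynomial time algorithm that decides whether a given digraph $D$ whose unique strong component with more than one vertex is a subdivision of a vault has a dicycle $B$ in $D$ and a cycle $C$ in $\mathrm{UG}(D)$ with $V(B)\cap V(C)=\emptyset$, and finds such $B,C$ if they exist.
   Context: Digraphs are finite, loops and multiple arcs allowed; a dicycle is a directed cycle, a cycle is a cycle of the underlying undirected multigraph $\mathrm{UG}(D)$. Vault: let $\ell\ge5$ be odd, $P_0,\dots,P_{\ell-1}$ disjoint nonempty dipaths, $a_i$ the initial and $d_i$ the terminal vertex of $P_i$, and $b_i,c_i\in V(P_i)$ with either $b_ic_i$ an arc of $P_i$ or $b_i=c_i\in\{a_i,d_i\}$. A vault is obtained from the disjoint union of the $P_i$ by adding, for every $i$ (indices mod $\ell$), at least one arc from some vertex of $P_i[c_i,d_i]$ to some vertex of $P_{i+1}[a_{i+1},b_{i+1}]$ (multiple arcs allowed) and a single arc from $d_i$ to $a_{i+2}$, and no further arcs. A subdivision of a digraph is obtained by replacing arcs by dipaths with new internal vertices. *)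

theory Defs
  imports "Graph_Theory.Graph_Theory"
begin

section \<open>Cycles of a digraph and of its underlying multigraph\<close>

text \<open>
  Digraphs are the finite multidigraphs \<open>fin_digraph\<close> (loops and parallel arcs allowed), and
  dicycles are given by \<open>pre_digraph.cycle\<close> as lists of arcs; a loop is a dicycle.
  The underlying undirected multigraph has one edge per arc, joining the two ends of the arc.
  So a loop is a cycle of length 1, and two distinct arcs with the same two ends (parallel or
  opposite) form a cycle of length 2. Below, edge \<open>es ! i\<close> joins the vertices
  \<open>xs ! i\<close> and \<open>xs ! (i + 1)\<close>, cyclically.
\<close>

definition ug_cycle :: "('a, 'b) pre_digraph \<Rightarrow> 'b list \<Rightarrow> bool" where
  "ug_cycle G es \<longleftrightarrow>
     es \<noteq> [] \<and> distinct es \<and> set es \<subseteq> arcs G \<and>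
     (\<exists>xs. length xs = length es \<and> distinct xs \<and>
        (\<forall>i < length es.
           {tail G (es ! i), head G (es ! i)} = {xs ! i, xs ! (Suc i mod length es)}))"

definition ends_of :: "('a, 'b) pre_digraph \<Rightarrow> 'b list \<Rightarrow> 'a set" where
  "ends_of G es = tail G ` set es \<union> head G ` set es"

definition disjoint_cycles :: "('a, 'b) pre_digraph \<Rightarrow> 'b list \<Rightarrow> 'b list \<Rightarrow> bool" where
  "disjoint_cycles G B C \<longleftrightarrow>
     pre_digraph.cycle G B \<and> ug_cycle G C \<and> ends_of G B \<inter> ends_of G C = {}"


section \<open>Vaults and subdivisions\<close>

definition arcs_between :: "('a, 'b) pre_digraph \<Rightarrow> 'a \<Rightarrow> 'a \<Rightarrow> 'b set" where
  "arcs_between G u v = {e \<in> arcs G. tail G e = u \<and> head G e = v}"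

text \<open>
  \<open>p i\<close> is the vertex sequence of the dipath \<open>P\<^sub>i\<close>, so that \<open>a\<^sub>i = hd (p i)\<close> and
  \<open>d\<^sub>i = last (p i)\<close>; the vertices \<open>b\<^sub>i\<close> and \<open>c\<^sub>i\<close> are given by their positions on it.
  A dipath may consist of a single vertex.
  The three kinds of arcs cannot be confused, as they have different pairs of
  end paths when \<open>l \<ge> 5\<close>.
\<close>

definition vault :: "('a, 'b) pre_digraph \<Rightarrow> bool" where
  "vault G \<longleftrightarrow> fin_digraph G \<and>
    (\<exists>(l::nat) (p :: nat \<Rightarrow> 'a list) (b :: nat \<Rightarrow> nat) (c :: nat \<Rightarrow> nat).
       let path_arc = (\<lambda>e. \<exists>i<l. \<exists>j. Suc j < length (p i) \<and>
                            e \<in> arcs_between G (p i ! j) (p i ! Suc j));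
           step_arc = (\<lambda>i e. e \<in> arcs G \<and> tail G e \<in> set (drop (c i) (p i)) \<and>
                            head G e \<in> set (take (Suc (b (Suc i mod l))) (p (Suc i mod l))));
           jump_arcs = (\<lambda>i. arcs_between G (last (p i)) (hd (p ((i + 2) mod l))))
       in l \<ge> 5 \<and> odd l \<and>
          (\<forall>i<l. p i \<noteq> [] \<and> distinct (p i)) \<and>
          (\<forall>i<l. \<forall>j<l. i \<noteq> j \<longrightarrow> set (p i) \<inter> set (p j) = {}) \<and>
          (\<forall>i<l. b i < length (p i) \<and> c i < length (p i) \<and>
             (c i = Suc (b i) \<or> b i = c i \<and> (b i = 0 \<or> b i = length (p i) - 1))) \<and>
          verts G = (\<Union>i<l. set (p i)) \<and>
          (\<forall>i<l. \<forall>j. Suc j < length (p i) \<longrightarrow>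
             card (arcs_between G (p i ! j) (p i ! Suc j)) = 1) \<and>
          (\<forall>i<l. \<exists>e. step_arc i e) \<and>
          (\<forall>i<l. card (jump_arcs i) = 1) \<and>
          (\<forall>e \<in> arcs G. path_arc e \<or> (\<exists>i<l. step_arc i e) \<or> (\<exists>i<l. e \<in> jump_arcs i)))"

definition inner_verts :: "('a, 'b) pre_digraph \<Rightarrow> 'b list \<Rightarrow> 'a list" where
  "inner_verts G es = butlast (map (head G) es)"

text \<open>
  \<open>H\<close> is (up to isomorphism) a subdivision of \<open>G\<close>: \<open>\<phi>\<close> embeds the vertices of \<open>G\<close>,
  and \<open>\<pi> e\<close> is the dipath replacing the arc \<open>e\<close> (closed if \<open>e\<close> is a loop).
\<close>

definition subdivision_of :: "('a, 'b) pre_digraph \<Rightarrow> ('c, 'd) pre_digraph \<Rightarrow> bool" where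
  "subdivision_of H G \<longleftrightarrow> wf_digraph H \<and> wf_digraph G \<and>
    (\<exists>(\<phi> :: 'c \<Rightarrow> 'a) (\<pi> :: 'd \<Rightarrow> 'b list).
       inj_on \<phi> (verts G) \<and>
       (\<forall>e \<in> arcs G.
          pre_digraph.awalk H (\<phi> (tail G e)) (\<pi> e) (\<phi> (head G e)) \<and> \<pi> e \<noteq> [] \<and>
          distinct (inner_verts H (\<pi> e)) \<and>
          set (inner_verts H (\<pi> e)) \<inter> \<phi> ` verts G = {}) \<and>
       (\<forall>e \<in> arcs G. \<forall>f \<in> arcs G. e \<noteq> f \<longrightarrow>
          set (\<pi> e) \<inter> set (\<pi> f) = {} \<and>
          set (inner_verts H (\<pi> e)) \<inter> set (inner_verts H (\<pi> f)) = {}) \<and>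
       verts H = \<phi> ` verts G \<union> (\<Union>e \<in> arcs G. set (inner_verts H (\<pi> e))) \<and>
       arcs H = (\<Union>e \<in> arcs G. set (\<pi> e)))"

definition nontrivial_sccs :: "('a, 'b) pre_digraph \<Rightarrow> ('a, 'b) pre_digraph set" where
  "nontrivial_sccs G = {S \<in> pre_digraph.sccs G. card (verts S) > 1}"

definition unique_scc_subdivides_vault :: "('a, 'b) pre_digraph \<Rightarrow> bool" where
  "unique_scc_subdivides_vault G \<longleftrightarrow>
     (\<exists>S. nontrivial_sccs G = {S} \<and>
        (\<exists>V :: (nat, nat) pre_digraph. vault V \<and> subdivision_of S V))"


section \<open>Algorithms and their running time\<close>

text \<open>
  The model of computation is pure first-order Lisp. Data are S-expressions over
  numbered atoms; the primitives are constants, constructing and taking apart a cell, the test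
  for being an atom, and equality of two atoms; control is by conditionals (atom 0 is false)
  and by calls of recursive functions. There is no arithmetic on atoms. A program is a finite
  list of function bodies, referred to by their position, with the arguments of the current
  call as the only variables.
  The time \<open>t\<close> in \<open>eval P \<rho> e v t\<close> counts one unit for every evaluation of a subexpression,
  i.e. the number of rule applications in the evaluation of \<open>e\<close>. As cells are shared when
  represented by pointers, a computation of time \<open>t\<close> only ever creates \<open>O(t)\<close> cells, and this
  measure is polynomially related to the time of a Turing machine.
  Ill-formed operations, such as the first component of an atom, have no value.
\<close>

datatype sexp = Atom nat | Cell sexp sexp

datatype lexp =
    Var nat
  | Quote sexp
  | MkCell lexp lexp
  | Fst lexp
  | Snd lexp
  | IsAtom lexp
  | EqAtom lexp lexp
  | Cond lexp lexp lexp
  | Call nat "lexp list"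

type_synonym program = "lexp list"

definition truth :: "bool \<Rightarrow> sexp" where
  "truth b = Atom (if b then 1 else 0)"

inductive
  eval :: "program \<Rightarrow> sexp list \<Rightarrow> lexp \<Rightarrow> sexp \<Rightarrow> nat \<Rightarrow> bool" and
  evals :: "program \<Rightarrow> sexp list \<Rightarrow> lexp list \<Rightarrow> sexp list \<Rightarrow> nat \<Rightarrow> bool"
  for P :: program
where
  eval_Var: "n < length \<rho> \<Longrightarrow> eval P \<rho> (Var n) (\<rho> ! n) 1"
| eval_Quote: "eval P \<rho> (Quote v) v 1"
| eval_MkCell: "eval P \<rho> e v s \<Longrightarrow> eval P \<rho> f w t \<Longrightarrow>
    eval P \<rho> (MkCell e f) (Cell v w) (s + t + 1)"
| eval_Fst: "eval P \<rho> e (Cell v w) t \<Longrightarrow> eval P \<rho> (Fst e) v (t + 1)"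
| eval_Snd: "eval P \<rho> e (Cell v w) t \<Longrightarrow> eval P \<rho> (Snd e) w (t + 1)"
| eval_IsAtom: "eval P \<rho> e v t \<Longrightarrow> eval P \<rho> (IsAtom e) (truth (\<exists>m. v = Atom m)) (t + 1)"
| eval_EqAtom: "eval P \<rho> e (Atom m) s \<Longrightarrow> eval P \<rho> f (Atom n) t \<Longrightarrow>
    eval P \<rho> (EqAtom e f) (truth (m = n)) (s + t + 1)"
| eval_Cond_true: "eval P \<rho> e u s \<Longrightarrow> u \<noteq> Atom 0 \<Longrightarrow> eval P \<rho> f v t \<Longrightarrow>
    eval P \<rho> (Cond e f g) v (s + t + 1)"
| eval_Cond_false: "eval P \<rho> e (Atom 0) s \<Longrightarrow> eval P \<rho> g v t \<Longrightarrow>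
    eval P \<rho> (Cond e f g) v (s + t + 1)"
| eval_Call: "evals P \<rho> es vs s \<Longrightarrow> n < length P \<Longrightarrow> eval P vs (P ! n) v t \<Longrightarrow>
    eval P \<rho> (Call n es) v (s + t + 1)"
| evals_Nil: "evals P \<rho> [] [] 1"
| evals_Cons: "eval P \<rho> e v s \<Longrightarrow> evals P \<rho> es vs t \<Longrightarrow>
    evals P \<rho> (e # es) (v # vs) (s + t + 1)"

text \<open>Result and running time are determined by program and input:\<close>

lemma eval_evals_deterministic:
  "eval P \<rho> e v t \<Longrightarrow> (\<And>v' t'. eval P \<rho> e v' t' \<Longrightarrow> v' = v \<and> t' = t)"
  "evals P \<rho> es vs t \<Longrightarrow> (\<And>vs' t'. evals P \<rho> es vs' t' \<Longrightarrow> vs' = vs \<and> t' = t)"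
proof (induction rule: eval_evals.inducts)
  case eval_Var from eval_Var.prems show ?case by cases auto
next
  case eval_Quote from eval_Quote.prems show ?case by cases auto
next
  case eval_MkCell from eval_MkCell.prems show ?case
    by cases (use eval_MkCell.IH in blast)
next
  case eval_Fst from eval_Fst.prems show ?case by cases (use eval_Fst.IH in blast)
next
  case eval_Snd from eval_Snd.prems show ?case by cases (use eval_Snd.IH in blast)
next
  case eval_IsAtom from eval_IsAtom.prems show ?case by cases (use eval_IsAtom.IH in blast)
next
  case eval_EqAtom from eval_EqAtom.prems show ?case by cases (use eval_EqAtom.IH in blast)
next
  case eval_Cond_true from eval_Cond_true.prems show ?case
    by cases (use eval_Cond_true.IH eval_Cond_true.hyps in blast)+
next
  case eval_Cond_false from eval_Cond_false.prems show ?case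
    by cases (use eval_Cond_false.IH in blast)+
next
  case eval_Call from eval_Call.prems show ?case by cases (use eval_Call.IH in blast)
next
  case evals_Nil from evals_Nil.prems show ?case by cases auto
next
  case evals_Cons from evals_Cons.prems show ?case by cases (use evals_Cons.IH in blast)
qed

text \<open>A program is run by applying its function number 0 to the list of inputs.\<close>

definition runs :: "program \<Rightarrow> sexp list \<Rightarrow> sexp \<Rightarrow> nat \<Rightarrow> bool" where
  "runs P xs v t \<longleftrightarrow> P \<noteq> [] \<and> eval P xs (P ! 0) v t"

fun list_sexp :: "sexp list \<Rightarrow> sexp" where
  "list_sexp [] = Atom 0"
| "list_sexp (x # xs) = Cell x (list_sexp xs)"

text \<open>
  A digraph is input as a list \<open>vs\<close> of its vertices and a list \<open>es\<close> of its arcs, each arc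
  together with its tail and head. Both lists may come in any order.
\<close>

definition listing :: "(nat, nat) pre_digraph \<Rightarrow> nat list \<Rightarrow> nat list \<Rightarrow> bool" where
  "listing G vs es \<longleftrightarrow> distinct vs \<and> set vs = verts G \<and> distinct es \<and> set es = arcs G"

definition digraph_input :: "(nat, nat) pre_digraph \<Rightarrow> nat list \<Rightarrow> nat list \<Rightarrow> sexp list" where
  "digraph_input G vs es =
     [list_sexp (map Atom vs),
      list_sexp (map (\<lambda>e. Cell (Atom e) (Cell (Atom (tail G e)) (Atom (head G e)))) es)]"

text \<open>The answer is atom 0 for ``no'', and the pair of the two lists of arcs otherwise.\<close>

definition correct_answer :: "(nat, nat) pre_digraph \<Rightarrow> sexp \<Rightarrow> bool" where
  "correct_answer G v \<longleftrightarrow>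
     (if \<exists>B C. disjoint_cycles G B C
      then \<exists>B C. disjoint_cycles G B C \<and>
             v = Cell (list_sexp (map Atom B)) (list_sexp (map Atom C))
      else v = Atom 0)"

end

theory Submission
  imports Defs
begin

text \<open>
  As \<open>l\<close> is odd, the dipaths \<open>P\<^sub>0, P\<^sub>2, P\<^sub>4, \<dots>\<close> and the jumps between them form a dicycle \<open>O\<close> through all
  vertices of the vault, and the step arcs are chords of \<open>O\<close>, each passing \<open>(l + 1) / 2\<close> of the \<open>l\<close>
  jumps. A dicycle \<open>B\<close> of the strong component with \<open>r > 0\<close> chords passes every vertex of \<open>O\<close> off \<open>B\<close> by
  the same number of chords, which exceeds \<open>r / 2\<close>; so any two such vertices are passed by a common
  chord \<open>e\<close> of \<open>B\<close>. The cycle consisting of \<open>e\<close> and a part of \<open>O\<close> then avoids enough of a cycle \<open>C\<close>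
  disjoint from \<open>B\<close> to leave a cycle: either all of \<open>C\<close>, or an ear of \<open>O\<close> contained in \<open>C\<close>, closed up
  along the part of \<open>O\<close> that \<open>e\<close> passes.
  Hence only \<open>O\<close> and the cycles formed by a chord and a part of \<open>O\<close> have to be tested as \<open>B\<close>.
  These can be found without knowing the vault. Weight the vertices of \<open>O\<close> where a chord starts
  for the first time in its dipath \<open>P\<^sub>i\<close>: they are the vertices reached from vertices of indegree at
  least two by following unique outgoing arcs. A dipath of minimum weight between two points of \<open>O\<close>
  that are close to each other on \<open>O\<close> follows \<open>O\<close>. So the candidates are among the unions of
  a minimum weight dipath from the head of \<open>e\<close> to the tail of \<open>f\<close> and one from the head of \<open>f\<close> to the
  tail of \<open>e\<close>, for all pairs of arcs \<open>e\<close> and \<open>f\<close>.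
\<close>

section \<open>Walks\<close>

text \<open>Subdivision makes lengths meaningless, and the jumps cannot be read off the digraph, so
  walks are measured by their number of segment changes: one for a jump, one for a chord. On
  \<open>O\<close> there are \<open>l = 2k - 1\<close> jumps and a chord passes \<open>k\<close> of
  them, so two chords go once around and one jump further, which that jump alone does more cheaply.
  Hence between points with fewer than \<open>k\<close> jumps in between, a walk that changes
  segment no more often than \<open>O\<close> uses no chord. The weights make this number
  computable: within a segment no chord ends strictly after the start of another, so a walk that
  enters and leaves a segment meets its first exit exactly once, and weight and segment changes
  differ by a term of the two ends only.

  The bound \<open>k\<close> also explains the pairs of arcs. Closing up a chord leaves
  \<open>k - 1\<close> jumps, so one minimum walk suffices; all of \<open>O\<close> has too many and
  is cut into two parts.

  The cycle \<open>C\<close> may use arcs outside the strong component, whereas a dicycle outside it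
  can only be a loop; loops get a case of their own.\<close>

fun walk :: "('e \<Rightarrow> 'v) \<Rightarrow> ('e \<Rightarrow> 'v) \<Rightarrow> 'e set \<Rightarrow> 'v \<Rightarrow> 'e list \<Rightarrow> 'v \<Rightarrow> bool" where
  "walk t h A u [] v \<longleftrightarrow> u = v"
| "walk t h A u (e # W) v \<longleftrightarrow> e \<in> A \<and> t e = u \<and> walk t h A (h e) W v"

lemma walk_append:
  "walk t h A u (W @ W') v \<longleftrightarrow> (\<exists>x. walk t h A u W x \<and> walk t h A x W' v)"
  by (induction W arbitrary: u) auto

lemma walk_mono: "walk t h A u W v \<Longrightarrow> A \<subseteq> A' \<Longrightarrow> walk t h A' u W v"
  by (induction W arbitrary: u) auto

lemma walk_set: "walk t h A u W v \<Longrightarrow> set W \<subseteq> A"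
  by (induction W arbitrary: u) auto

lemma walk_restrict: "walk t h A u W v \<Longrightarrow> set W \<subseteq> A' \<Longrightarrow> walk t h A' u W v"
  by (induction W arbitrary: u) auto

lemma walk_split: "walk t h A u W v \<Longrightarrow> e \<in> set W \<Longrightarrow>
  \<exists>W1 W2. W = W1 @ e # W2 \<and> walk t h A u W1 (t e) \<and> walk t h A (h e) W2 v"
  using split_list[of e W] by (fastforce simp: walk_append)

lemma walk_heads: "walk t h A u W v \<Longrightarrow> insert u (h ` set W) = insert v (t ` set W)"
  by (induction W arbitrary: u) (simp_all, metis insert_commute)

text \<open>Membership in the cyclic half-open interval from \<open>a\<close> to \<open>b\<close>; it is empty if \<open>a = b\<close>.\<close>

definition civ :: "nat \<Rightarrow> nat \<Rightarrow> nat \<Rightarrow> bool" where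
  "civ a b q \<longleftrightarrow> (if a \<le> b then a \<le> q \<and> q < b else a \<le> q \<or> q < b)"

text \<open>Concatenating intervals from \<open>a\<close> to \<open>b\<close> to \<open>c\<close> gives the interval from \<open>a\<close> to \<open>c\<close>, plus possibly
  a full turn, which is the same at every \<open>q\<close>.\<close>

lemma civ_cocycle:
  "of_bool (civ a b q) + of_bool (civ b c q) + of_bool (civ a c q') =
   of_bool (civ a b q') + of_bool (civ b c q') + (of_bool (civ a c q) :: nat)"
  unfolding civ_def of_bool_def by (cases "a \<le> b"; cases "b \<le> c"; cases "a \<le> c"; auto)

lemma civ_same [simp]: "\<not> civ a a q"
  by (simp add: civ_def)

lemma civ_end [simp]: "\<not> civ a b b"
  by (simp add: civ_def)

text \<open>The equation counts passed marks: \<open>x\<close> chords passing \<open>K\<close> each,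
  \<open>c\<close> marks passed along \<open>O\<close>, \<open>w\<close> full turns over
  \<open>2K - 1\<close> marks and \<open>m\<close> marks between the ends. Doubling it gives
  \<open>(2K - 1)(2w - x) = x + 2c - 2m\<close>; the right side lies in the open interval from
  \<open>-(2K - 1)\<close> to 1, so both sides vanish, and then \<open>c + x \<le> m\<close> forces
  \<open>x = 0\<close>.\<close>

lemma full_turn_arith:
  fixes K x m w c :: int
  assumes e: "c + K * x = (2 * K - 1) * w + m"
    and b: "K \<ge> 2" "c \<ge> 0" "x \<ge> 0" "c + x \<le> m" "m \<le> K - 1" "w \<ge> 0"
  shows "x = 0 \<and> w = 0"
proof -
  have f: "(2 * K - 1) * (2 * w - x) = x + 2 * c - 2 * m"
    using e by (simp add: algebra_simps)
  have "2 * w - x \<le> 0"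
  proof (rule ccontr)
    assume "\<not> ?thesis"
    then have "(2 * K - 1) * (2 * w - x) > 0" using b by simp
    then show False using f b by linarith
  qed
  moreover have "2 * w - x > -1"
  proof (rule ccontr)
    assume "\<not> ?thesis"
    then have "2 * w - x \<le> -1" by simp
    then have "(2 * K - 1) * (2 * w - x) \<le> (2 * K - 1) * (-1)"
      using b by (intro mult_left_mono) auto
    then have "(2 * K - 1) * (2 * w - x) \<le> 1 - 2 * K" by (simp only: mult_minus1_right minus_diff_eq)
    then have "x + 2 * c - 2 * m \<le> 1 - 2 * K" unfolding f .
    then show False using b by linarith
  qed
  ultimately have z: "2 * w - x = 0" by simp
  then have "x + 2 * c - 2 * m = 0" using f by simp
  then have "x = 0" using b by linarith
  then show ?thesis using z by simp
qed

lemma sum_of_bool_card: "finite S \<Longrightarrow> (\<Sum>x\<in>S. of_bool (P x)) = card {x \<in> S. P x}"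
  by (simp add: Int_def)

section \<open>Chorded dicycles\<close>

text \<open>\<open>O\<close> is the dicycle with vertices \<open>os 0\<close>, \<dots>, \<open>os (N - 1)\<close> and arcs \<open>oa q\<close>; the other arcs lie
  on chords of \<open>O\<close>, which may be subdivided. \<open>\<tau> v\<close> is the position of \<open>v\<close> on \<open>O\<close> and, if \<open>v\<close> is inside
  a chord, that of the end of the chord; \<open>rk v\<close> is then the number of arcs from \<open>v\<close> to that end.
  \<open>M\<close> marks the arcs \<open>oa q\<close> that leave a segment, i.e. the arcs coming from the jumps of the vault.\<close>

locale chorded =
  fixes t h :: "'e \<Rightarrow> 'v" and A :: "'e set"
    and N :: nat and os :: "nat \<Rightarrow> 'v" and oa :: "nat \<Rightarrow> 'e" and \<tau> :: "'v \<Rightarrow> nat"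
    and rk :: "'v \<Rightarrow> nat" and M :: "nat set" and k :: nat
  assumes os_inj: "inj_on os {..<N}"
    and oa_arc: "q < N \<Longrightarrow> oa q \<in> A \<and> t (oa q) = os q \<and> h (oa q) = os (Suc q mod N)"
    and tau_os: "q < N \<Longrightarrow> \<tau> (os q) = q"
    and tau_less: "\<tau> v < N"
    and off_tau: "e \<in> A \<Longrightarrow> t e \<notin> os ` {..<N} \<Longrightarrow> \<tau> (h e) = \<tau> (t e)"
    and off_rk: "e \<in> A \<Longrightarrow> t e \<notin> os ` {..<N} \<Longrightarrow> h e \<notin> os ` {..<N} \<Longrightarrow> rk (h e) < rk (t e)"
    and off_out: "e \<in> A \<Longrightarrow> f \<in> A \<Longrightarrow> t e = t f \<Longrightarrow> t e \<notin> os ` {..<N} \<Longrightarrow> e = f"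
    and off_in: "e \<in> A \<Longrightarrow> f \<in> A \<Longrightarrow> h e = h f \<Longrightarrow> h e \<notin> os ` {..<N} \<Longrightarrow> e = f"
    and M_sub: "M \<subseteq> {..<N}" and M_card: "card M = 2 * k - 1" and k_ge: "k \<ge> 2"
    and long_cov: "e \<in> A \<Longrightarrow> t e \<in> os ` {..<N} \<Longrightarrow> e \<notin> oa ` {..<N} \<Longrightarrow>
       card {q \<in> M. civ (\<tau> (t e)) (\<tau> (h e)) q} = k"
    and entry_after_exit: "e \<in> A \<Longrightarrow> f \<in> A \<Longrightarrow> e \<notin> oa ` {..<N} \<Longrightarrow> f \<notin> oa ` {..<N} \<Longrightarrow>
       t e = os x \<Longrightarrow> h f = os y \<Longrightarrow> x < y \<Longrightarrow> y < N \<Longrightarrow> \<exists>m\<in>M. x \<le> m \<and> m < y"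
    and entry_before_exit: "e \<in> A \<Longrightarrow> e \<notin> oa ` {..<N} \<Longrightarrow> t e = os x \<Longrightarrow> x < N \<Longrightarrow>
       \<exists>y\<le>x. (\<exists>f\<in>A. f \<notin> oa ` {..<N} \<and> h f = os y) \<and> \<not> (\<exists>m\<in>M. y \<le> m \<and> m < x)"
    and exit_before_mark: "m \<in> M \<Longrightarrow>
       \<exists>x\<le>m. (\<exists>e\<in>A. e \<notin> oa ` {..<N} \<and> t e = os x) \<and> \<not> (\<exists>m'\<in>M. x \<le> m' \<and> m' < m)"
    and mark_after_entry: "f \<in> A \<Longrightarrow> f \<notin> oa ` {..<N} \<Longrightarrow> h f = os y \<Longrightarrow> y < N \<Longrightarrow> \<exists>m\<in>M. y \<le> m"
    and mark_after_exit: "e \<in> A \<Longrightarrow> e \<notin> oa ` {..<N} \<Longrightarrow> t e = os x \<Longrightarrow> x < N \<Longrightarrow> \<exists>m\<in>M. x \<le> m"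
begin

abbreviation "OV \<equiv> os ` {..<N}"
abbreviation "OA \<equiv> oa ` {..<N}"

definition "long e \<longleftrightarrow> e \<in> A \<and> t e \<in> OV \<and> e \<notin> OA"

lemma N_pos: "0 < N" and finite_M: "finite M" and N_ge: "3 \<le> N"
proof -
  show f: "finite M" using M_sub finite_subset by blast
  show "3 \<le> N" using card_mono[OF _ M_sub] M_card k_ge by auto
  then show "0 < N" by simp
qed

lemma O_tau: "v \<in> OV \<Longrightarrow> os (\<tau> v) = v"
  using tau_os by auto

lemma OA_eq: "oa p = oa q \<Longrightarrow> p < N \<Longrightarrow> q < N \<Longrightarrow> p = q"
  by (metis oa_arc tau_os)

lemma civ_oa: "q < N \<Longrightarrow> q' < N \<Longrightarrow> civ (\<tau> (t (oa q))) (\<tau> (h (oa q))) q' \<longleftrightarrow> q' = q"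
proof -
  assume q: "q < N" "q' < N"
  have m: "Suc q mod N < N" using N_pos by simp
  have "civ q (Suc q mod N) q' \<longleftrightarrow> q' = q"
  proof (cases "Suc q = N")
    case True
    then have "Suc q mod N = 0" by simp
    then show ?thesis using q N_ge True by (auto simp: civ_def)
  next
    case False
    then have "Suc q mod N = Suc q" using q by simp
    then show ?thesis by (auto simp: civ_def)
  qed
  then show ?thesis using q oa_arc tau_os m by simp
qed

lemma arc_cases:
  assumes "e \<in> A"
  obtains "long e" | q where "q < N" "e = oa q" | "t e \<notin> OV" "e \<notin> OA" "\<tau> (h e) = \<tau> (t e)"
  using assms off_tau oa_arc unfolding long_def by (metis (no_types, lifting) image_iff lessThan_iff)

section \<open>Counting how often a walk passes a position of the cycle\<close>

definition cov :: "'e list \<Rightarrow> nat \<Rightarrow> nat" where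
  "cov W q = length (filter (\<lambda>e. civ (\<tau> (t e)) (\<tau> (h e)) q) W)"

lemma cov_simps [simp]: "cov [] q = 0"
  "cov (e # W) q = of_bool (civ (\<tau> (t e)) (\<tau> (h e)) q) + cov W q"
  by (auto simp: cov_def)

text \<open>Each arc contributes the interval between the positions of its ends, and by
  \<open>civ_cocycle\<close> these intervals concatenate to the interval between the ends of the
  walk plus full turns. So \<open>cov\<close> is a winding number: up to that interval it does not
  depend on the position.\<close>

lemma walk_cov:
  "walk t h A u W v \<Longrightarrow>
   cov W q + of_bool (civ (\<tau> u) (\<tau> v) q') = cov W q' + of_bool (civ (\<tau> u) (\<tau> v) q)"
proof (induction W arbitrary: u)
  case (Cons e W)
  then have IH: "cov W q + of_bool (civ (\<tau> (h e)) (\<tau> v) q') = cov W q' + of_bool (civ (\<tau> (h e)) (\<tau> v) q)"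
    and u: "t e = u" by auto
  show ?case using IH civ_cocycle[of "\<tau> u" "\<tau> (h e)" q "\<tau> v" q'] u by simp
qed simp

lemma walk_cov':
  "walk t h A u W v \<Longrightarrow> cov W q = cov W (\<tau> v) + of_bool (civ (\<tau> u) (\<tau> v) q)"
  using walk_cov[of u W v q "\<tau> v"] by simp

definition marks :: "'e \<Rightarrow> nat" where
  "marks e = card {q \<in> M. civ (\<tau> (t e)) (\<tau> (h e)) q}"

lemma sum_cov: "(\<Sum>q\<in>M. cov W q) = sum_list (map marks W)"
proof (induction W)
  case (Cons e W)
  have "(\<Sum>q\<in>M. of_bool (civ (\<tau> (t e)) (\<tau> (h e)) q)) = marks e"
    using finite_M by (simp add: marks_def sum_of_bool_card del: sum_of_bool_eq)
  then show ?case using Cons by (simp add: sum.distrib del: sum_of_bool_eq)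
qed simp

lemma marks_long: "long e \<Longrightarrow> marks e = k"
  unfolding long_def marks_def using long_cov by auto

lemma marks_oa: "q < N \<Longrightarrow> marks (oa q) = of_bool (q \<in> M)"
proof -
  assume q: "q < N"
  have "{q' \<in> M. civ (\<tau> (t (oa q))) (\<tau> (h (oa q))) q'} = (if q \<in> M then {q} else {})"
    using civ_oa[OF q] M_sub by auto
  then show ?thesis unfolding marks_def by auto
qed

lemma marks_off: "e \<in> A \<Longrightarrow> t e \<notin> OV \<Longrightarrow> marks e = 0"
  by (simp add: marks_def off_tau)

definition longs :: "'e list \<Rightarrow> nat" where "longs W = length (filter long W)"

text \<open>The number of segment changes: a chord counts once although it passes \<open>k\<close>
  marks, an arc of \<open>O\<close> counts if it is marked, an arc inside a chord does not
  count.\<close>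

definition leave :: "'e \<Rightarrow> nat" where "leave e = (if long e then 1 else marks e)"

lemma long_oa: "q < N \<Longrightarrow> \<not> long (oa q)"
  by (auto simp: long_def)

lemma sum_marks: "sum_list (map marks W) + longs W = sum_list (map leave W) + k * longs W"
  by (induction W) (auto simp: longs_def leave_def marks_long)

text \<open>A walk with as few segment changes as possible uses no chord and makes no full turn.\<close>

lemma few_leaves:
  assumes W: "walk t h A u W v" and m: "card {q\<in>M. civ (\<tau> u) (\<tau> v) q} = m" "m < k"
    and l: "sum_list (map leave W) \<le> m"
  shows "longs W = 0 \<and> cov W (\<tau> v) = 0"
proof -
  define w where "w = cov W (\<tau> v)"
  \<comment> \<open>Double counting of passed marks: by positions this is \<open>w\<close> full
    turns plus the marks between the ends, by arcs it is \<open>k\<close> for each chord and the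
    marked arcs of \<open>O\<close>.\<close>
  have "(\<Sum>q\<in>M. cov W q) = (\<Sum>q\<in>M. w + of_bool (civ (\<tau> u) (\<tau> v) q))"
    unfolding w_def using walk_cov'[OF W] by (intro sum.cong refl)
  also have "\<dots> = (2 * k - 1) * w + m"
    using m M_card finite_M by (simp add: sum.distrib sum_of_bool_card del: sum_of_bool_eq)
  finally have 1: "sum_list (map leave W) + k * longs W = (2 * k - 1) * w + m + longs W"
    using sum_marks[of W] sum_cov[of W] by linarith
  have ll: "longs V \<le> sum_list (map leave V)" for V
    by (induction V) (auto simp: longs_def leave_def)
  have "int (longs W) = 0 \<and> int w = 0"
  proof (rule full_turn_arith)
    have "int (sum_list (map leave W) + k * longs W) = int ((2 * k - 1) * w + m + longs W)"
      using 1 by (rule arg_cong)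
    moreover have "int (2 * k - 1) = 2 * int k - 1" using k_ge by simp
    ultimately show "int (sum_list (map leave W)) - int (longs W) + int k * int (longs W) =
        (2 * int k - 1) * int w + int m"
      by (simp only: of_nat_add of_nat_mult)
  qed (use ll[of W] l m k_ge in simp_all)
  then show ?thesis by (simp add: w_def)
qed

lemma no_long_on_O:
  assumes "walk t h A u W v" "longs W = 0" "u \<in> OV"
  shows "h ` set W \<subseteq> OV"
  using assms
proof (induction W arbitrary: u)
  case (Cons e W)
  then have e: "e \<in> A" "t e \<in> OV" "\<not> long e" by (auto simp: longs_def split: if_splits)
  then obtain q where "q < N" "e = oa q" by (cases rule: arc_cases[OF e(1)]) auto
  then have "h e \<in> OV" using oa_arc N_pos by auto
  with Cons show ?case by (auto simp: longs_def split: if_splits)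
qed simp

text \<open>Vanishing of \<open>cov\<close> at the end vertex excludes a full turn, so an arc of
  \<open>O\<close> on the walk starts in the interval between its ends.\<close>

lemma no_long_visits:
  assumes W: "walk t h A u W v" "longs W = 0" "cov W (\<tau> v) = 0" and x: "x \<in> set W" "t x \<in> OV"
  shows "civ (\<tau> u) (\<tau> v) (\<tau> (t x))"
proof -
  have xA: "x \<in> A" using W walk_set x by fast
  have "\<not> long x" using W(2) x by (auto simp: longs_def filter_empty_conv)
  then obtain q where q: "q < N" "x = oa q" using x by (cases rule: arc_cases[OF xA]) auto
  have "cov W q \<noteq> 0" unfolding cov_def using x q civ_oa[OF q(1) q(1)] by (auto simp: filter_empty_conv)
  then have "civ (\<tau> u) (\<tau> v) q" using walk_cov'[OF W(1), of q] W(3) by (auto split: if_splits)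
  then show ?thesis using q oa_arc tau_os by simp
qed

end

section \<open>Connectivity in the underlying multigraph, and cyclic intervals\<close>

definition ugr :: "('e \<Rightarrow> 'v) \<Rightarrow> ('e \<Rightarrow> 'v) \<Rightarrow> 'e set \<Rightarrow> ('v \<times> 'v) set" where
  "ugr t h F = {(u, v). \<exists>e\<in>F. {t e, h e} = {u, v}}"

lemma ugr_sym: "(u, v) \<in> (ugr t h F)\<^sup>* \<Longrightarrow> (v, u) \<in> (ugr t h F)\<^sup>*"
proof -
  have "sym (ugr t h F)" by (auto simp: sym_def ugr_def)
  then show "(u, v) \<in> (ugr t h F)\<^sup>* \<Longrightarrow> (v, u) \<in> (ugr t h F)\<^sup>*"
    by (meson symD sym_rtrancl)
qed

lemma walk_ugr: "walk t h A u W v \<Longrightarrow> set W \<subseteq> F \<Longrightarrow> (u, v) \<in> (ugr t h F)\<^sup>*"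
proof (induction W arbitrary: u)
  case (Cons e W)
  then have "(u, h e) \<in> ugr t h F" "(h e, v) \<in> (ugr t h F)\<^sup>*" by (auto simp: ugr_def)
  then show ?case by (rule converse_rtrancl_into_rtrancl)
qed simp

lemma closed_walk_heads:
  assumes "walk t h A u B u" "B \<noteq> []"
  shows "h ` set B = t ` set B"
proof -
  have "u \<in> t ` set B" using assms by (cases B) auto
  moreover have "u \<in> h ` set B"
    using assms by (cases B rule: rev_cases) (auto simp: walk_append)
  ultimately show ?thesis using walk_heads[OF assms(1)] by (simp add: insert_absorb)
qed

lemma civ_open_disjoint: "civ a b q \<Longrightarrow> q \<noteq> a \<Longrightarrow> \<not> civ b a q"
  by (auto simp: civ_def split: if_splits)

text \<open>Two points of the open interval cut the circle into two parts, and only one of these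
  contains \<open>a\<close>; the other one stays inside the interval.\<close>

lemma civ_linear:
  "civ a b p \<Longrightarrow> civ a b q \<Longrightarrow> p \<noteq> a \<Longrightarrow> q \<noteq> a \<Longrightarrow>
   (\<forall>r. civ p q r \<longrightarrow> civ a b r \<and> r \<noteq> a) \<or> (\<forall>r. civ q p r \<longrightarrow> civ a b r \<and> r \<noteq> a)"
  unfolding civ_def by (cases "a \<le> b"; cases "p \<le> q"; cases "a \<le> p"; cases "a \<le> q") auto

lemma civ_Suc: "civ p q r \<Longrightarrow> r < N \<Longrightarrow> q < N \<Longrightarrow> Suc r mod N = q \<or> civ p q (Suc r mod N)"
  by (cases "Suc r = N") (auto simp: civ_def split: if_splits)

context chorded
begin

section \<open>First exits as vertex weights\<close>

definition "exit_at x \<longleftrightarrow> x < N \<and> (\<exists>e\<in>A. e \<notin> OA \<and> t e = os x)"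

text \<open>A potential recording that the segment of \<open>v\<close> already had an exit at or
  before \<open>v\<close>. The linear order of positions suffices here, because no chord starts or
  ends beyond the last mark.\<close>

definition "post v \<longleftrightarrow> v \<in> OV \<and> (\<exists>x\<le>\<tau> v. exit_at x \<and> \<not> (\<exists>m\<in>M. x \<le> m \<and> m < \<tau> v))"

text \<open>The first exits of the segments, which carry the weight.\<close>

definition "Zs = {os x |x. exit_at x \<and> \<not> (\<exists>x0<x. exit_at x0 \<and> \<not> (\<exists>m\<in>M. x0 \<le> m \<and> m < x))}"

lemma post_os: "q < N \<Longrightarrow> post (os q) \<longleftrightarrow> (\<exists>x\<le>q. exit_at x \<and> \<not> (\<exists>m\<in>M. x \<le> m \<and> m < q))"
  by (auto simp: post_def tau_os)

lemma Zs_os: "q < N \<Longrightarrow> os q \<in> Zs \<longleftrightarrow>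
    exit_at q \<and> \<not> (\<exists>x<q. exit_at x \<and> \<not> (\<exists>m\<in>M. x \<le> m \<and> m < q))"
proof -
  assume q: "q < N"
  have inj: "x = q" if "os q = os x" "exit_at x" for x
    using q tau_os that unfolding exit_at_def by metis
  show ?thesis
  proof
    assume "os q \<in> Zs"
    then obtain x where x: "os q = os x" "exit_at x"
      "\<not> (\<exists>x0<x. exit_at x0 \<and> \<not> (\<exists>m\<in>M. x0 \<le> m \<and> m < x))"
      unfolding Zs_def by auto
    then show "exit_at q \<and> \<not> (\<exists>x<q. exit_at x \<and> \<not> (\<exists>m\<in>M. x \<le> m \<and> m < q))"
      using inj[OF x(1,2)] by simp
  qed (auto simp: Zs_def)
qed

text \<open>Where a chord ends on \<open>O\<close>, no exit of the same segment comes strictly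
  earlier, so both sides say that there is an exit at this very vertex. Inside a chord both sides
  are false.\<close>

lemma entry_balance:
  assumes f: "f \<in> A" "f \<notin> OA"
  shows "h f \<in> Zs \<longleftrightarrow> post (h f)"
proof (cases "h f \<in> OV")
  case True
  then obtain y where y: "y < N" "h f = os y" by auto
  have no: "\<exists>m\<in>M. x \<le> m \<and> m < y" if "x < y" "exit_at x" for x
    using that entry_after_exit[OF _ f(1) _ f(2) _ y(2) that(1) y(1)] unfolding exit_at_def by auto
  have "os y \<in> Zs \<longleftrightarrow> exit_at y" using no Zs_os[OF y(1)] by blast
  moreover have "post (os y) \<longleftrightarrow> exit_at y"
    using no post_os[OF y(1)] by (metis leD le_less order_refl)
  ultimately show ?thesis using y by simp
next
  case False
  then have "h f \<notin> Zs" by (auto simp: Zs_def exit_at_def)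
  then show ?thesis using False by (auto simp: post_def)
qed

text \<open>Within a segment \<open>post\<close> becomes true exactly on arrival at the first exit;
  a segment change starts at a vertex where \<open>post\<close> holds and resets it. Summed along a
  walk, this turns the weight into the number of segment changes.\<close>

lemma balance:
  assumes "e \<in> A"
  shows "of_bool (h e \<in> Zs) + of_bool (post (t e)) = of_bool (post (h e)) + leave e"
  using assms
proof (cases rule: arc_cases)
  case 1
  then obtain x where x: "x < N" "t e = os x" "e \<in> A" "e \<notin> OA" unfolding long_def by auto
  then have "exit_at x" unfolding exit_at_def by auto
  then have "post (t e)" unfolding x(2) post_os[OF x(1)] by (intro exI[of _ x]) auto
  then show ?thesis using 1 entry_balance[OF x(3,4)] by (simp add: leave_def)
next
  case (2 q)
  have tq: "t e = os q" and hq: "h e = os (Suc q mod N)" using 2 oa_arc by auto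
  have le: "leave e = of_bool (q \<in> M)" using 2 long_oa marks_oa by (simp add: leave_def)
  have after: "\<exists>m\<in>M. x \<le> m" if "exit_at x" for x
    using that mark_after_exit unfolding exit_at_def by blast
  show ?thesis
  proof (cases "q \<in> M")
    case True
    \<comment> \<open>The segment that the marked arc leaves contains an exit, so
      \<open>post\<close> holds at its tail.\<close>
    obtain x where x: "x \<le> q" "\<exists>e\<in>A. e \<notin> OA \<and> t e = os x" "\<not> (\<exists>m'\<in>M. x \<le> m' \<and> m' < q)"
      using exit_before_mark[OF True] by auto
    then have "exit_at x" using 2(1) unfolding exit_at_def by simp
    then have p: "post (t e)" unfolding tq post_os[OF 2(1)] using x by (intro exI[of _ x]) simp
    have "h e \<in> Zs \<longleftrightarrow> post (h e)"
    proof (cases "Suc q = N")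
      case True
      then have "Suc q mod N = 0" by simp
      then show ?thesis unfolding hq using Zs_os[OF N_pos] post_os[OF N_pos] by simp
    next
      case False
      then have s: "Suc q < N" "Suc q mod N = Suc q" using 2 by auto
      have none: "\<exists>m\<in>M. x \<le> m \<and> m < Suc q" if "x < Suc q" for x
        using that \<open>q \<in> M\<close> by (intro bexI[of _ q]) auto
      have nm: "\<not> (\<exists>m\<in>M. Suc q \<le> m \<and> m < Suc q)" by auto
      have "os (Suc q) \<in> Zs \<longleftrightarrow> exit_at (Suc q)"
        unfolding Zs_os[OF s(1)] using none by blast
      moreover have "post (os (Suc q)) \<longleftrightarrow> exit_at (Suc q)"
        unfolding post_os[OF s(1)] le_eq_less_or_eq[of _ "Suc q"] using none nm by blast
      ultimately have "os (Suc q) \<in> Zs \<longleftrightarrow> post (os (Suc q))" by simp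
      then show ?thesis unfolding hq s(2) .
    qed
    then show ?thesis using p le True by simp
  next
    case False
    show ?thesis
    proof (cases "Suc q = N")
      case True
      then have s: "Suc q mod N = 0" by simp
      \<comment> \<open>The arc back to position 0 is unmarked only if its tail lies beyond the last
        mark, and no exit lies there.\<close>
      have "\<not> post (t e)"
      proof
        assume "post (t e)"
        then obtain x where x: "x \<le> q" "exit_at x" "\<not> (\<exists>m\<in>M. x \<le> m \<and> m < q)"
          unfolding tq post_os[OF 2(1)] by auto
        obtain m where m: "m \<in> M" "x \<le> m" using after[OF x(2)] by auto
        then have "m < Suc q" "m \<noteq> q" using M_sub True False by auto
        then have "m < q" by simp
        then show False using m x(3) by auto
      qed
      then show ?thesis unfolding hq s le using Zs_os[OF N_pos] post_os[OF N_pos] False by simp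
    next
      case F2: False
      then have s: "Suc q < N" "Suc q mod N = Suc q" using 2 by auto
      have eq: "(\<exists>m\<in>M. x \<le> m \<and> m < Suc q) \<longleftrightarrow> (\<exists>m\<in>M. x \<le> m \<and> m < q)" for x
        using False by (auto simp: less_Suc_eq)
      have 3: "os (Suc q) \<in> Zs \<longleftrightarrow> exit_at (Suc q) \<and> \<not> post (os q)"
        unfolding Zs_os[OF s(1)] post_os[OF 2(1)] eq by (simp only: less_Suc_eq_le)
      have nm: "\<not> (\<exists>m\<in>M. Suc q \<le> m \<and> m < q)" by auto
      have 4: "post (os (Suc q)) \<longleftrightarrow> exit_at (Suc q) \<or> post (os q)"
        unfolding post_os[OF s(1)] post_os[OF 2(1)] eq le_Suc_eq using nm by blast
      have "of_bool (exit_at (Suc q) \<and> \<not> post (os q)) + of_bool (post (os q)) =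
          (of_bool (exit_at (Suc q) \<or> post (os q)) :: nat)" by simp
      then show ?thesis unfolding hq s(2) tq le 3 4 using False by simp
    qed
  qed
next
  case 3
  then have "\<not> post (t e)" by (simp add: post_def)
  moreover have "leave e = 0" using 3 marks_off[OF assms] by (simp add: leave_def long_def)
  ultimately show ?thesis using entry_balance[OF assms 3(2)] by simp
qed

definition wt :: "'e list \<Rightarrow> nat" where "wt W = length (filter (\<lambda>e. h e \<in> Zs) W)"

text \<open>\<open>balance\<close> telescopes. As the correction depends on the ends only, walks of
  minimum weight between two given vertices are those with the fewest segment changes.\<close>

lemma wt_leave:
  "walk t h A u W v \<Longrightarrow> wt W + of_bool (post u) = of_bool (post v) + sum_list (map leave W)"
proof (induction W arbitrary: u)
  case (Cons e W)
  have IH: "wt W + of_bool (post (h e)) = of_bool (post v) + sum_list (map leave W)"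
    using Cons by simp
  have "of_bool (h e \<in> Zs) + of_bool (post (t e)) = of_bool (post (h e)) + leave e"
    using balance[of e] Cons.prems by (simp only: walk.simps)
  moreover have "wt (e # W) = of_bool (h e \<in> Zs) + wt W" by (simp add: wt_def)
  ultimately show ?case using IH Cons.prems by simp
qed (simp add: wt_def)

definition "minwalk u W v \<longleftrightarrow> walk t h A u W v \<and> (\<forall>W'. walk t h A u W' v \<longrightarrow> wt W \<le> wt W')"

lemma O_walk:
  assumes "a < N" "b < N"
  shows "\<exists>W. walk t h A (os a) W (os b) \<and> set W \<subseteq> oa ` {q. q < N \<and> civ a b q}"
  using assms
proof (induction "if a \<le> b then b - a else b + N - a" arbitrary: a rule: less_induct)
  case less
  show ?case
  proof (cases "a = b")
    case True then show ?thesis by (intro exI[of _ "[]"]) simp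
  next
    case False
    let ?a = "Suc a mod N"
    have a: "?a < N" using N_pos by simp
    have sub: "civ ?a b q \<Longrightarrow> civ a b q" if "q < N" for q
      using less.prems False that by (cases "Suc a = N") (auto simp: civ_def split: if_splits)
    have "\<exists>W. walk t h A (os ?a) W (os b) \<and> set W \<subseteq> oa ` {q. q < N \<and> civ ?a b q}"
      by (rule less.hyps) (use less.prems False a in \<open>cases "Suc a = N"; auto\<close>)+
    then obtain W where W: "walk t h A (os ?a) W (os b)" "set W \<subseteq> oa ` {q. q < N \<and> civ ?a b q}" by auto
    have "civ a b a" using False less.prems by (auto simp: civ_def)
    then have "oa a \<in> oa ` {q. q < N \<and> civ a b q}" using less.prems by blast
    moreover have "set W \<subseteq> oa ` {q. q < N \<and> civ a b q}" using W(2) sub by blast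
    ultimately show ?thesis using W(1) oa_arc[OF less.prems(1)]
      by (intro exI[of _ "oa a # W"]) simp
  qed
qed

lemma O_walk_leave:
  assumes "a < N" "b < N"
  shows "\<exists>W. walk t h A (os a) W (os b) \<and> sum_list (map leave W) = card {q\<in>M. civ a b q}"
proof -
  obtain W where W: "walk t h A (os a) W (os b)" "set W \<subseteq> oa ` {q. q < N \<and> civ a b q}"
    using O_walk[OF assms] by auto
  have l: "longs W = 0" using W(2) long_oa by (auto simp: longs_def filter_empty_conv)
  have "cov W b = 0"
    unfolding cov_def using W(2) civ_oa assms by (auto simp: filter_empty_conv)
  then have "cov W q = of_bool (civ a b q)" for q
    using walk_cov'[OF W(1), of q] assms tau_os by simp
  then have "(\<Sum>q\<in>M. cov W q) = card {q\<in>M. civ a b q}"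
    using finite_M by (simp add: sum_of_bool_card del: sum_of_bool_eq)
  then have "sum_list (map leave W) = card {q\<in>M. civ a b q}"
    using sum_marks[of W] sum_cov[of W] l by simp
  then show ?thesis using W by auto
qed

text \<open>From inside a chord there is only one way to continue, so any walk to \<open>O\<close>
  starts with the rest of the chord; its arcs change no segment.\<close>

lemma run_to_O:
  "walk t h A u W v \<Longrightarrow> v \<in> OV \<Longrightarrow> \<exists>V. walk t h A u V (os (\<tau> u)) \<and> sum_list (map leave V) = 0"
proof (induction W arbitrary: u)
  case Nil
  then have "walk t h A u [] (os (\<tau> u))" using O_tau by simp
  then show ?case by (metis list.simps(8) sum_list.Nil)
next
  case (Cons e W)
  show ?case
  proof (cases "u \<in> OV")
    case True
    then have "walk t h A u [] (os (\<tau> u))" using O_tau by simp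
    then show ?thesis by (metis list.simps(8) sum_list.Nil)
  next
    case False
    have e: "e \<in> A" "t e = u" "walk t h A (h e) W v" using Cons.prems by auto
    obtain V where V: "walk t h A (h e) V (os (\<tau> (h e)))" "sum_list (map leave V) = 0"
      using Cons.IH[OF e(3) Cons.prems(2)] by auto
    have "\<tau> (h e) = \<tau> u" using off_tau e False by auto
    moreover have "leave e = 0" using e False marks_off[OF e(1)] by (simp add: leave_def long_def)
    ultimately have "walk t h A u (e # V) (os (\<tau> u)) \<and> sum_list (map leave (e # V)) = 0"
      using V e by simp
    then show ?thesis by blast
  qed
qed

text \<open>The competitor runs to the end of the current chord and then along \<open>O\<close>; it
  changes segment as often as there are marks in between. A walk of minimum weight does no worse, so
  \<open>few_leaves\<close> applies to it.\<close>

lemma minwalk_few: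
  assumes W: "minwalk u W v" and v: "v \<in> OV" and m: "card {q\<in>M. civ (\<tau> u) (\<tau> v) q} < k"
  shows "longs W = 0 \<and> cov W (\<tau> v) = 0"
proof -
  have w: "walk t h A u W v" using W by (simp add: minwalk_def)
  obtain V where V: "walk t h A u V (os (\<tau> u))" "sum_list (map leave V) = 0"
    using run_to_O[OF w v] by auto
  obtain V' where V': "walk t h A (os (\<tau> u)) V' (os (\<tau> v))"
    "sum_list (map leave V') = card {q\<in>M. civ (\<tau> u) (\<tau> v) q}"
    using O_walk_leave[OF tau_less tau_less] by auto
  have VV: "walk t h A u (V @ V') v" using V V' O_tau[OF v] by (auto simp: walk_append)
  then have "wt W \<le> wt (V @ V')" using W by (auto simp: minwalk_def)
  then have "sum_list (map leave W) \<le> sum_list (map leave (V @ V'))"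
    using wt_leave[OF w] wt_leave[OF VV] by linarith
  then have "sum_list (map leave W) \<le> card {q\<in>M. civ (\<tau> u) (\<tau> v) q}" using V V' by simp
  from few_leaves[OF w refl m this] show ?thesis .
qed

lemma minwalk_verts_O:
  assumes W: "minwalk u W v" and v: "v \<in> OV" and m: "card {q\<in>M. civ (\<tau> u) (\<tau> v) q} < k"
    and x: "x \<in> insert u (h ` set W)" "x \<in> OV"
  shows "x = v \<or> civ (\<tau> u) (\<tau> v) (\<tau> x)"
proof -
  have w: "walk t h A u W v" using W by (simp add: minwalk_def)
  have "x \<in> insert v (t ` set W)" using walk_heads[OF w] x by simp
  then consider "x = v" | e where "e \<in> set W" "x = t e" by blast
  then show ?thesis
  proof cases
    case 2
    then show ?thesis using no_long_visits[OF w _ _ 2(1)] minwalk_few[OF W v m] x(2) by simp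
  qed simp
qed

text \<open>Vertices inside chords have one outgoing arc. A walk starting on \<open>B\<close>
  therefore follows \<open>B\<close> as long as it is off \<open>O\<close>, and once on
  \<open>O\<close> it stays there for lack of chords.\<close>

lemma off_O_visits:
  assumes "walk t h A u W v" "longs W = 0" "u \<in> t ` set B" and B: "set B \<subseteq> A" "h ` set B = t ` set B"
  shows "\<forall>x\<in>set W. t x \<notin> OV \<longrightarrow> t x \<in> t ` set B"
  using assms(1-3)
proof (induction W arbitrary: u)
  case (Cons e W)
  have e: "e \<in> A" "t e = u" "walk t h A (h e) W v" "longs W = 0" "\<not> long e"
    using Cons.prems by (auto simp: longs_def split: if_splits)
  show ?case
  proof (cases "u \<in> OV")
    case True
    have "h ` set (e # W) \<subseteq> OV" using no_long_on_O[OF Cons.prems(1,2) True] .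
    moreover have "t ` set (e # W) \<subseteq> insert u (h ` set (e # W))"
      using walk_heads[OF Cons.prems(1)] by blast
    ultimately show ?thesis using True by blast
  next
    case False
    obtain b where b: "b \<in> set B" "t b = u" using Cons.prems by auto
    then have "b = e" using off_out[of b e] e B False by auto
    then have "h e \<in> t ` set B" using b B(2) by (metis imageI)
    then show ?thesis using Cons.IH e Cons.prems by simp
  qed
qed simp

text \<open>Off \<open>O\<close> the rank strictly decreases along arcs, which is impossible all the
  way around a closed walk.\<close>

lemma tails_meet_O:
  assumes B: "walk t h A u B u" "B \<noteq> []"
  shows "\<exists>e\<in>set B. t e \<in> OV"
proof (rule ccontr)
  assume no: "\<not> ?thesis"
  have ht: "h ` set B = t ` set B" using closed_walk_heads[OF B] .
  have "hd B \<in> set B" using B(2) by simp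
  then obtain e where e: "e \<in> set B" "\<forall>f\<in>set B. rk (h e) \<le> rk (h f)"
    using ex_has_least_nat[of "\<lambda>e. e \<in> set B" "hd B" "\<lambda>e. rk (h e)"] by blast
  obtain f where f: "f \<in> set B" "h e = t f" using e(1) ht by (metis imageE imageI)
  have "h f \<in> t ` set B" using ht f by auto
  then have "h f \<notin> OV" using no by (metis imageE)
  then have "rk (h f) < rk (t f)" using off_rk[of f] f no walk_set[OF B(1)] by auto
  then show False using e(2) f by (metis leD)
qed

text \<open>A closed walk passes all positions equally often. It uses some arc of \<open>O\<close>,
  so it passes every position, and without chords only the arc of \<open>O\<close> at a position
  passes it.\<close>

lemma no_long_covers_O:
  assumes B: "walk t h A u B u" "B \<noteq> []" and l: "\<forall>e\<in>set B. \<not> long e"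
  shows "OV \<subseteq> t ` set B"
proof
  fix x assume "x \<in> OV"
  then obtain p where p: "p < N" "x = os p" by auto
  obtain e where e: "e \<in> set B" "t e \<in> OV" using tails_meet_O[OF B] by auto
  have A: "set B \<subseteq> A" using walk_set[OF B(1)] .
  then obtain q where q: "q < N" "e = oa q" using e l by (metis arc_cases subsetD)
  have "cov B q \<noteq> 0" unfolding cov_def using e q civ_oa[OF q(1) q(1)] by (auto simp: filter_empty_conv)
  then have "cov B p \<noteq> 0" using walk_cov'[OF B(1), of p] walk_cov'[OF B(1), of q] by simp
  then obtain f where f: "f \<in> set B" "civ (\<tau> (t f)) (\<tau> (h f)) p"
    unfolding cov_def by (auto simp: filter_empty_conv)
  then have "f = oa p" using l A civ_oa p arc_cases by (metis civ_same subsetD)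
  then show "x \<in> t ` set B" using f p oa_arc by (metis imageI)
qed

text \<open>Every point of \<open>O\<close> off the dicycle \<open>B\<close> is passed by the same number \<open>w\<close> of chords of \<open>B\<close>.
  As each chord passes more than half of the marks, \<open>w\<close> exceeds half the number of chords.\<close>

lemma common_chord:
  assumes B: "walk t h A u B u" "distinct B" and l: "\<exists>e\<in>set B. long e"
    and s: "s \<in> OV" "s \<notin> t ` set B" and s': "s' \<in> OV" "s' \<notin> t ` set B"
  shows "\<exists>e\<in>set B. long e \<and> civ (\<tau> (t e)) (\<tau> (h e)) (\<tau> s) \<and> civ (\<tau> (t e)) (\<tau> (h e)) (\<tau> s')"
proof -
  define w where "w = cov B (\<tau> u)"
  define r where "r = longs B"
  have A: "set B \<subseteq> A" using walk_set[OF B(1)] .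
  have cw: "cov B q = w" for q using walk_cov'[OF B(1), of q] by (simp add: w_def)
  have r: "r \<ge> 1" unfolding r_def longs_def using l by (auto simp: Suc_le_eq filter_empty_conv)
  have ll: "longs V \<le> sum_list (map leave V)" for V
    by (induction V) (auto simp: longs_def leave_def)
  have "(2 * k - 1) * w = sum_list (map marks B)" using sum_cov[of B] cw M_card by simp
  moreover have "k * r \<le> sum_list (map marks B)" unfolding r_def using sum_marks[of B] ll[of B] by linarith
  ultimately have ge: "k * r \<le> (2 * k - 1) * w" by metis
  \<comment> \<open>Otherwise \<open>2(2k - 1)w \<le> (2k - 1)r < 2kr\<close>, against the
    inequality just obtained.\<close>
  have "r < 2 * w"
  proof (rule ccontr)
    assume "\<not> ?thesis"
    then have "(2 * k - 1) * (2 * w) \<le> (2 * k - 1) * r" by (intro mult_left_mono) auto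
    moreover have "(2 * k - 1) * r + r = 2 * (k * r)" using k_ge by (simp add: algebra_simps)
    moreover have "(2 * k - 1) * (2 * w) = 2 * ((2 * k - 1) * w)" by simp
    ultimately show False using ge r by linarith
  qed
  define S where "S x = {e \<in> set B. long e \<and> civ (\<tau> (t e)) (\<tau> (h e)) (\<tau> x)}" for x
  have c: "card (S x) = w" if x: "x \<in> OV" "x \<notin> t ` set B" for x
  proof -
    \<comment> \<open>Off \<open>B\<close> a position is passed by chords only: the arc of
      \<open>O\<close> passing it starts there, and arcs inside chords pass nothing.\<close>
    have "S x = {e \<in> set B. civ (\<tau> (t e)) (\<tau> (h e)) (\<tau> x)}"
    proof -
      have "long e" if e: "e \<in> set B" "civ (\<tau> (t e)) (\<tau> (h e)) (\<tau> x)" for e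
      proof -
        have "e \<in> A" using e A by auto
        then show ?thesis
        proof (cases rule: arc_cases)
          case (2 q)
          then have "\<tau> x = q" using civ_oa[OF 2(1) tau_less] e by simp
          then have "t e = x" using 2 oa_arc O_tau[OF x(1)] by simp
          then show ?thesis using e x by auto
        qed (use e in simp_all)
      qed
      then show ?thesis unfolding S_def by auto
    qed
    also have "card \<dots> = length (filter (\<lambda>e. civ (\<tau> (t e)) (\<tau> (h e)) (\<tau> x)) B)"
      using B(2) by (metis distinct_card distinct_filter set_filter)
    finally show ?thesis using cw[of "\<tau> x"] by (simp add: cov_def)
  qed
  have rc: "card {e \<in> set B. long e} = r"
    unfolding r_def longs_def using B(2) by (metis distinct_card distinct_filter set_filter)
  \<comment> \<open>Pigeonhole: two sets of \<open>w > r / 2\<close> chords each, among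
    \<open>r\<close> chords, have a common member.\<close>
  have "card (S s \<union> S s') \<le> r" unfolding rc[symmetric] by (rule card_mono) (auto simp: S_def)
  moreover have "card (S s) + card (S s') = card (S s \<union> S s') + card (S s \<inter> S s')"
    by (rule card_Un_Int) (auto simp: S_def)
  ultimately have "card (S s \<inter> S s') \<noteq> 0" using c[OF s] c[OF s'] \<open>r < 2 * w\<close> by linarith
  then obtain e where "e \<in> S s \<inter> S s'" by (metis card.empty ex_in_conv)
  then show ?thesis unfolding S_def by auto
qed

end

section \<open>Candidates for the dicycle\<close>

context chorded
begin

definition pverts :: "'v \<Rightarrow> 'e list \<Rightarrow> 'v set" where
  "pverts u W = insert u (h ` set W)"

text \<open>The dicycles met by the algorithm as candidates for \<open>B\<close>: the chord \<open>e\<close> closed up along \<open>O\<close>,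
  and \<open>O\<close> itself.\<close>

lemma chord_cycle_avoids:
  assumes B: "walk t h A u B u" and e: "e \<in> set B" "long e"
    and W: "minwalk (h e) W (t e)"
    and x: "x \<notin> OV \<longrightarrow> x \<notin> t ` set B" "x \<in> OV \<longrightarrow> x \<noteq> t e \<and> civ (\<tau> (t e)) (\<tau> (h e)) (\<tau> x)"
  shows "x \<notin> pverts (h e) W"
proof
  assume xin: "x \<in> pverts (h e) W"
  have te: "t e \<in> OV" "e \<in> A" using e by (auto simp: long_def)
  have ne: "B \<noteq> []" using e by auto
  \<comment> \<open>The chord passes \<open>k\<close> of the \<open>2k - 1\<close> marks, which
    leaves at most \<open>k - 1\<close> for the way back.\<close>
  have m: "card {q\<in>M. civ (\<tau> (h e)) (\<tau> (t e)) q} < k"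
  proof -
    have "card {q\<in>M. civ (\<tau> (t e)) (\<tau> (h e)) q} = k"
      using e long_cov unfolding long_def by auto
    moreover have "card ({q\<in>M. civ (\<tau> (t e)) (\<tau> (h e)) q} \<union> {q\<in>M. civ (\<tau> (h e)) (\<tau> (t e)) q}) \<le> card M"
      using finite_M by (intro card_mono) auto
    moreover have "{q\<in>M. civ (\<tau> (t e)) (\<tau> (h e)) q} \<inter> {q\<in>M. civ (\<tau> (h e)) (\<tau> (t e)) q} = {}"
      by (auto simp: civ_def split: if_splits)
    ultimately show ?thesis using M_card k_ge finite_M by (simp add: card_Un_disjoint)
  qed
  have w: "walk t h A (h e) W (t e)" using W by (simp add: minwalk_def)
  have xin': "x \<in> insert (t e) (t ` set W)" using xin walk_heads[OF w] by (simp add: pverts_def)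
  show False
  proof (cases "x \<in> OV")
    case True
    have "x = t e \<or> civ (\<tau> (h e)) (\<tau> (t e)) (\<tau> x)"
      using minwalk_verts_O[OF W te(1) m] xin True by (simp add: pverts_def)
    moreover have "x \<noteq> t e" using x True by blast
    moreover have "\<tau> x \<noteq> \<tau> (t e)" using \<open>x \<noteq> t e\<close> O_tau[OF True] O_tau[OF te(1)] by metis
    ultimately show False using civ_open_disjoint x(2) True by blast
  next
    case False
    then obtain f where f: "f \<in> set W" "x = t f" using xin' te by auto
    \<comment> \<open>If the chord is subdivided, \<open>W\<close> starts inside it. The rest of the
      chord lies on \<open>B\<close>, so it cannot contain \<open>x\<close> either.\<close>
    have "h e \<in> t ` set B" using closed_walk_heads[OF B ne] e by auto
    moreover have "longs W = 0" using minwalk_few[OF W te(1) m] by simp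
    ultimately have "\<forall>x\<in>set W. t x \<notin> OV \<longrightarrow> t x \<in> t ` set B"
      using off_O_visits[OF w _ _ walk_set[OF B] closed_walk_heads[OF B ne]] by simp
    then have "t f \<in> t ` set B" using f False by blast
    then show False using x f False by simp
  qed
qed

text \<open>Take \<open>q\<close> least such that the positions from 1 to \<open>q\<close> contain
  \<open>k\<close> marks: before \<open>q\<close> there are fewer than \<open>k\<close> of them, and
  beyond \<open>q\<close> at most \<open>(2k - 1) - k\<close> remain. As \<open>k \<ge> 2\<close>,
  there are enough marks even if 0 is one.\<close>

lemma O_split:
  obtains q where "q < N" "card {m\<in>M. civ (Suc 0) q m} < k" "card {m\<in>M. civ (Suc q mod N) 0 m} < k"
proof -
  define S where "S q = {m\<in>M. 1 \<le> m \<and> m \<le> q}" for q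
  have "M - {0} \<subseteq> S (N - 1)" using M_sub by (auto simp: S_def)
  moreover have fS: "finite (S q)" for q using finite_M by (simp add: S_def)
  ultimately have "card (M - {0}) \<le> card (S (N - 1))" by (intro card_mono)
  then have ex: "card (S (N - 1)) \<ge> k" using M_card k_ge finite_M
    by (cases "0 \<in> M") (auto simp: card_Diff_singleton)
  define q where "q = (LEAST q. card (S q) \<ge> k)"
  have q: "card (S q) \<ge> k" unfolding q_def using ex by (rule LeastI)
  have qN: "q < N" unfolding q_def using Least_le[of "\<lambda>q. card (S q) \<ge> k", OF ex] N_pos by simp
  have q0: "q > 0"
  proof (rule ccontr)
    assume "\<not> ?thesis"
    then have "S q = {}" by (auto simp: S_def)
    then show False using q k_ge by simp
  qed
  have "card (S (q - 1)) < k"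
    using not_less_Least[of "q - 1" "\<lambda>q. card (S q) \<ge> k"] q0 unfolding q_def[symmetric] by simp
  moreover have "{m\<in>M. civ (Suc 0) q m} = S (q - 1)" using q0 by (auto simp: S_def civ_def)
  ultimately have 1: "card {m\<in>M. civ (Suc 0) q m} < k" by simp
  have "card {m\<in>M. civ (Suc q mod N) 0 m} < k"
  proof (cases "Suc q = N")
    case True
    then have "{m\<in>M. civ (Suc q mod N) 0 m} = {}" by simp
    then show ?thesis unfolding \<open>{m\<in>M. civ (Suc q mod N) 0 m} = {}\<close> using k_ge by simp
  next
    case False
    then have s: "Suc q mod N = Suc q" using qN by simp
    have eq: "{m\<in>M. civ (Suc q mod N) 0 m} = {m\<in>M. q < m}" unfolding s by (auto simp: civ_def)
    have "card ({m\<in>M. q < m} \<union> S q) \<le> card M" using finite_M by (intro card_mono) (auto simp: S_def)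
    moreover have "card ({m\<in>M. q < m} \<union> S q) = card {m\<in>M. q < m} + card (S q)"
      using finite_M by (intro card_Un_disjoint) (auto simp: S_def)
    ultimately show ?thesis unfolding eq using q M_card k_ge by linarith
  qed
  then show ?thesis using that qN 1 by blast
qed

text \<open>The two arcs of \<open>O\<close> at positions 0 and \<open>q\<close> of
  \<open>O_split\<close> cut \<open>O\<close> into parts short enough for minimum walks to follow
  \<open>O\<close>.\<close>

lemma O_candidate:
  obtains e f where "e \<in> A" "f \<in> A"
    "\<forall>W. minwalk (h e) W (t f) \<longrightarrow> pverts (h e) W \<subseteq> OV"
    "\<forall>W. minwalk (h f) W (t e) \<longrightarrow> pverts (h f) W \<subseteq> OV"
proof -
  obtain q where q: "q < N" "card {m\<in>M. civ (Suc 0) q m} < k" "card {m\<in>M. civ (Suc q mod N) 0 m} < k"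
    using O_split .
  have s: "Suc 0 mod N = Suc 0" "Suc 0 < N" "Suc q mod N < N" using N_ge by auto
  have oin: "p < N \<Longrightarrow> os p \<in> OV" for p by auto
  have gen: "pverts (os a) W \<subseteq> OV" if "minwalk (os a) W (os b)" "a < N" "b < N" "card {m\<in>M. civ a b m} < k" for a b W
    using minwalk_few[OF that(1) oin[OF that(3)]] that no_long_on_O[of "os a" W "os b"] tau_os
    by (simp add: pverts_def minwalk_def)
  show ?thesis
  proof (rule that)
    show "oa 0 \<in> A" "oa q \<in> A" using oa_arc N_pos q by auto
    show "\<forall>W. minwalk (h (oa 0)) W (t (oa q)) \<longrightarrow> pverts (h (oa 0)) W \<subseteq> OV"
      using gen[of "Suc 0" _ q] q s oa_arc[OF N_pos] oa_arc[OF q(1)] by simp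
    show "\<forall>W. minwalk (h (oa q)) W (t (oa 0)) \<longrightarrow> pverts (h (oa q)) W \<subseteq> OV"
      using gen[of "Suc q mod N" _ 0] q s oa_arc[OF N_pos] oa_arc[OF q(1)] by simp
  qed
qed

text \<open>A cycle of the underlying multigraph, with \<open>c j\<close> joining \<open>y j\<close> and \<open>y (j + 1)\<close>, cannot run on
  \<open>O\<close> only, unless it meets every vertex of \<open>O\<close>.\<close>

lemma exists_off_arc:
  assumes n: "n \<ge> 1" and yn: "y n = y 0" and cinj: "inj_on c {..<n}"
    and ends: "\<And>j. j < n \<Longrightarrow> {t (c j), h (c j)} = {y j, y (Suc j)}"
    and q: "q < N" "\<And>j. j < n \<Longrightarrow> y j \<noteq> os q"
  shows "\<exists>j<n. c j \<notin> OA"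
proof (rule ccontr)
  assume "\<not> ?thesis"
  then have all: "c j \<in> OA" if "j < n" for j using that by auto
  \<comment> \<open>The distance from \<open>os q\<close> along \<open>O\<close>. Since
    \<open>os q\<close> is not on the cycle, a vertex of the cycle at maximum distance cannot be
    left towards its successor on \<open>O\<close>.\<close>
  define d where "d p = (if q \<le> p then p - q else p + N - q)" for p
  have yO: "y j \<in> OV" if "j \<le> n" for j
  proof -
    have yO': "y j \<in> OV" if j: "j < n" for j
    proof -
      obtain p where p: "p < N" "c j = oa p" using all[OF j] by auto
      then have "{os p, os (Suc p mod N)} = {y j, y (Suc j)}" using ends[OF j] oa_arc by simp
      then show ?thesis using p N_pos by (metis imageI insertI1 insertE lessThan_iff mod_less_divisor singletonD)
    qed
    then show ?thesis using that yn n by (cases "j = n") auto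
  qed
  have ynq: "y j \<noteq> os q" if "j \<le> n" for j using q(2)[of j] q(2)[of 0] yn n that by (cases "j = n") auto
  have fin: "finite ((\<lambda>j. d (\<tau> (y j))) ` {..<n})" by simp
  obtain j where j: "j < n" "\<And>i. i < n \<Longrightarrow> d (\<tau> (y i)) \<le> d (\<tau> (y j))"
  proof -
    have "Max ((\<lambda>j. d (\<tau> (y j))) ` {..<n}) \<in> (\<lambda>j. d (\<tau> (y j))) ` {..<n}"
      using fin n by (intro Max_in) (auto simp: lessThan_empty_iff)
    then obtain j where "j < n" "Max ((\<lambda>j. d (\<tau> (y j))) ` {..<n}) = d (\<tau> (y j))" by auto
    then show ?thesis using that fin by (metis Max_ge imageI lessThan_iff)
  qed
  have jmax: "d (\<tau> (y i)) \<le> d (\<tau> (y j))" if "i \<le> n" for i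
    using j(2)[of i] j(2)[of 0] that yn n by (cases "i = n") auto
  define p where "p = \<tau> (y j)"
  have p: "p < N" "y j = os p" using tau_less O_tau yO[of j] j by (auto simp: p_def)
  text \<open>At the vertex of the cycle farthest from \<open>os q\<close>, both arcs would have to be the same arc of \<open>O\<close>.\<close>
  have key: "c i = oa ((p + N - 1) mod N)" if i: "i < n" "y i = os p \<or> y (Suc i) = os p" for i
  proof -
    obtain r where r: "r < N" "c i = oa r" using all[OF i(1)] by auto
    have e: "{os r, os (Suc r mod N)} = {y i, y (Suc i)}" using ends[OF i(1)] oa_arc r by simp
    have sr: "Suc r mod N < N" using N_pos by simp
    show ?thesis
    proof (cases "r = p")
      case True
      have "os (Suc p mod N) \<in> {y i, y (Suc i)}" using e True by auto
      then obtain i' where i': "i' \<le> n" "y i' = os (Suc p mod N)" using i(1) by (metis Suc_leI insertE less_imp_le singletonD)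
      have "Suc p mod N \<noteq> q" using ynq[OF i'(1)] i'(2) by auto
      moreover have "p \<noteq> q" using ynq[of j] j p by auto
      ultimately have "d (Suc p mod N) > d p"
        using p(1) q(1) by (cases "Suc p = N") (auto simp: d_def)
      moreover have "\<tau> (y i') = Suc p mod N" using i' tau_os sr True by simp
      ultimately show ?thesis using jmax[OF i'(1)] p_def by simp
    next
      case False
      have "os p \<in> {os r, os (Suc r mod N)}" unfolding e using i(2) by auto
      then have "os p = os r \<or> os p = os (Suc r mod N)" by simp
      then have "p = r \<or> p = Suc r mod N" 
        using inj_onD[OF os_inj] p(1) r(1) sr by (metis lessThan_iff)
      then have pr: "p = Suc r mod N" using False by simp
      have "(p + N - 1) mod N = r"
      proof (cases "Suc r = N")
        case True
        then have "p = 0" using pr by simp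
        then show ?thesis using True r by simp
      next
        case False
        then have "p = Suc r" using pr r by simp
        then show ?thesis using r by simp
      qed
      then show ?thesis using r by simp
    qed
  qed
  have cj: "c j = oa ((p + N - 1) mod N)" using key[of j] j p by auto
  show False
  proof (cases "n = 1")
    case True
    then have "y 0 = y (Suc 0)" "j = 0" using yn j by auto
    then have e: "{t (c 0), h (c 0)} = {os p}" using ends[of 0] p True by simp
    obtain r where r: "r < N" "c 0 = oa r" using all[of 0] n by auto
    have "os r = os (Suc r mod N)" using e r oa_arc by auto
    then have "r = Suc r mod N" using tau_os r N_pos by (metis mod_less_divisor)
    then show False using r N_ge by (cases "Suc r = N") auto
  next
    case False
    define i where "i = (if j = 0 then n - 1 else j - 1)"
    have i: "i < n" "y (Suc i) = y j" "i \<noteq> j" using j yn n False by (auto simp: i_def)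
    then have "c i = c j" using key[of i] p cj by auto
    then have "i = j" using inj_onD[OF cinj] i(1) j(1) by blast
    then show False using i(3) by simp
  qed
qed

end

section \<open>Traversing a cycle of the underlying multigraph\<close>

lemma ugr_path:
  assumes "i \<le> j" and "\<And>l. i \<le> l \<Longrightarrow> l < j \<Longrightarrow> c l \<in> F \<and> {t (c l), h (c l)} = {y l, y (Suc l)}"
  shows "(y i, y j) \<in> (ugr t h F)\<^sup>*"
  using assms
proof (induction j)
  case (Suc j)
  show ?case
  proof (cases "i = Suc j")
    case False
    then have "(y i, y j) \<in> (ugr t h F)\<^sup>*" using Suc by simp
    moreover have "(y j, y (Suc j)) \<in> ugr t h F" using Suc.prems(2)[of j] Suc.prems(1) False by (auto simp: ugr_def)
    ultimately show ?thesis by (rule rtrancl_into_rtrancl)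
  qed simp
qed simp

lemma ends_rtrancl:
  assumes "{a, b} = {a', b'}" "(a', b') \<in> (ugr t h F)\<^sup>*"
  shows "(b, a) \<in> (ugr t h F)\<^sup>*"
proof -
  have "a = a' \<and> b = b' \<or> a = b' \<and> b = a'" using assms(1) by (simp add: doubleton_eq_iff)
  then show ?thesis using assms(2) ugr_sym[OF assms(2)] by blast
qed

text \<open>Makes any chosen edge the one with index 0. With \<open>y\<close> continued to the index
  \<open>length cs\<close>, the rest of the cycle is a path from \<open>y 1\<close> to
  \<open>y (length cs)\<close> without reduction of indices.\<close>

lemma rotate_ug:
  assumes "i < length cs" "distinct cs" "length xs = length cs"
    and ends: "\<forall>i < length cs. {t (cs ! i), h (cs ! i)} = {xs ! i, xs ! (Suc i mod length cs)}"
  obtains c y where "c 0 = cs ! i" "inj_on c {..<length cs}" "c ` {..<length cs} = set cs"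
    "y (length cs) = y 0" "y ` {..<length cs} = set xs"
    "\<And>j. j < length cs \<Longrightarrow> {t (c j), h (c j)} = {y j, y (Suc j)}"
proof -
  let ?n = "length cs"
  define c where "c j = cs ! ((i + j) mod ?n)" for j
  define y where "y j = xs ! ((i + j) mod ?n)" for j
  have n: "?n > 0" using assms by auto
  have c: "c j = rotate i cs ! j" if "j < ?n" for j using that by (simp add: c_def nth_rotate)
  have y: "y j = rotate i xs ! j" if "j < ?n" for j using that assms(3) by (simp add: y_def nth_rotate)
  have "inj_on c {..<?n} \<longleftrightarrow> inj_on ((!) (rotate i cs)) {..<?n}"
    using c by (intro inj_on_cong) auto
  then have inj: "inj_on c {..<?n}"
    using assms(2) inj_on_nth[of "rotate i cs" "{..<?n}"] by simp
  have cc: "c ` {..<?n} = set cs" using c nth_image[of ?n "rotate i cs"] by (simp add: lessThan_atLeast0)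
  have yy: "y ` {..<?n} = set xs" using y nth_image[of ?n "rotate i xs"] assms(3) by (simp add: lessThan_atLeast0)
  have "{t (c j), h (c j)} = {y j, y (Suc j)}" if "j < ?n" for j
    using ends[rule_format, of "(i + j) mod ?n"] n by (simp add: c_def y_def mod_Suc_eq)
  moreover have "c 0 = cs ! i" "y ?n = y 0" using assms(1) by (simp_all add: c_def y_def)
  ultimately show ?thesis using that inj cc yy by blast
qed

context chorded
begin

definition "cand e f W W' = pverts (h e) W \<union> pverts (h f) W'"

definition "free AG X = {a\<in>AG. t a \<notin> X \<and> h a \<notin> X}"

text \<open>The cycle is expressed by an arc \<open>g\<close> whose ends stay connected when
  \<open>g\<close> is deleted, which is the condition that the cycle search tests. All minimum walks
  are allowed, as the search for them returns an arbitrary one. If \<open>B\<close> has no chord, it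
  contains \<open>O\<close>, and \<open>O\<close> serves; if \<open>C\<close> misses
  \<open>O\<close>, any chord of \<open>B\<close> serves; otherwise an arc of \<open>C\<close> off
  \<open>O\<close> determines an ear of \<open>O\<close>, and the chord is chosen to pass both ends
  of this ear.\<close>

lemma candidate_exists:
  assumes AG: "A \<subseteq> AG"
    and B: "walk t h A u B u" "B \<noteq> []" "distinct B"
    and C: "cs \<noteq> []" "distinct cs" "distinct xs" "length xs = length cs" "set cs \<subseteq> AG"
      "\<forall>i < length cs. {t (cs ! i), h (cs ! i)} = {xs ! i, xs ! (Suc i mod length cs)}"
    and disj: "t ` set B \<inter> set xs = {}"
  shows "\<exists>e\<in>A. \<exists>f\<in>A. \<forall>W W'. minwalk (h e) W (t f) \<longrightarrow> minwalk (h f) W' (t e) \<longrightarrow>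
    (\<exists>g\<in>free AG (cand e f W W'). (h g, t g) \<in> (ugr t h (free AG (cand e f W W') - {g}))\<^sup>*)"
proof -
  let ?n = "length cs"
  have n: "?n \<ge> 1" using C(1) by (simp add: Suc_le_eq)
  have n0: "0 < ?n" using C(1) by simp
  note rot = rotate_ug[where cs = cs and xs = xs and t = t and h = h, OF _ C(2,4,6)]
  text \<open>If the candidate avoids the whole cycle, any arc of the cycle will do.\<close>
  have whole: "\<exists>g\<in>free AG X. (h g, t g) \<in> (ugr t h (free AG X - {g}))\<^sup>*" if X: "X \<inter> set xs = {}" for X
  proof -
    obtain c y where cy: "inj_on c {..<?n}" "c ` {..<?n} = set cs" "y ?n = y 0" "y ` {..<?n} = set xs"
      "\<And>j. j < ?n \<Longrightarrow> {t (c j), h (c j)} = {y j, y (Suc j)}"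
      by (rule rot[of 0]) (use C(1) in auto)
    have y0: "y 0 \<in> y ` {..<?n}" using C(1) by (intro imageI) auto
    have yin: "y j \<in> set xs" if "j \<le> ?n" for j
      using cy(3,4) that y0 by (cases "j = ?n") auto
    have fr: "c j \<in> free AG X" if j: "j < ?n" for j
    proof -
      have "{t (c j), h (c j)} \<subseteq> set xs" using yin[of j] yin[of "Suc j"] cy(5)[OF j] j by auto
      moreover have "c j \<in> AG" using cy(2) j C(5) by auto
      ultimately show ?thesis using X unfolding free_def by auto
    qed
    have p: "(y 1, y ?n) \<in> (ugr t h (free AG X - {c 0}))\<^sup>*"
    proof (rule ugr_path[OF n])
      fix l assume l: "1 \<le> l" "l < ?n"
      then have "c l \<noteq> c 0" using inj_onD[OF cy(1), of l 0] C(1) by auto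
      then show "c l \<in> free AG X - {c 0} \<and> {t (c l), h (c l)} = {y l, y (Suc l)}"
        using fr cy(5) l by auto
    qed
    have c0: "{t (c 0), h (c 0)} = {y 1, y ?n}" using cy(3) cy(5)[OF n0] by (simp add: insert_commute)
    have "(h (c 0), t (c 0)) \<in> (ugr t h (free AG X - {c 0}))\<^sup>*"
      by (rule ends_rtrancl[OF c0 p])
    then show ?thesis using fr[OF n0] by (intro bexI[of _ "c 0"]) auto
  qed
  show ?thesis
  proof (cases "\<exists>e\<in>set B. long e")
    case False
    \<comment> \<open>All vertices of the candidate \<open>O\<close> now lie on \<open>B\<close>, so
      the whole of \<open>C\<close> survives.\<close>
    have O: "OV \<subseteq> t ` set B" using no_long_covers_O[OF B(1,2)] False by auto
    obtain e f where ef: "e \<in> A" "f \<in> A"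
      "\<forall>W. minwalk (h e) W (t f) \<longrightarrow> pverts (h e) W \<subseteq> OV"
      "\<forall>W. minwalk (h f) W (t e) \<longrightarrow> pverts (h f) W \<subseteq> OV"
      using O_candidate .
    show ?thesis
    proof (rule bexI[OF _ ef(1)], rule bexI[OF _ ef(2)], intro allI impI)
      fix W W' assume "minwalk (h e) W (t f)" "minwalk (h f) W' (t e)"
      then have "cand e f W W' \<subseteq> t ` set B" using ef O unfolding cand_def by blast
      then show "\<exists>g\<in>free AG (cand e f W W'). (h g, t g) \<in> (ugr t h (free AG (cand e f W W') - {g}))\<^sup>*"
        using disj by (intro whole) blast
    qed
  next
    case lo: True
    show ?thesis
    proof (cases "OV \<inter> set xs = {}")
      case True
      obtain e where e: "e \<in> set B" "long e" using lo by auto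
      then have eA: "e \<in> A" by (simp add: long_def)
      show ?thesis
      proof (rule bexI[OF _ eA], rule bexI[OF _ eA], intro allI impI)
        fix W W' assume W: "minwalk (h e) W (t e)" "minwalk (h e) W' (t e)"
        have "x \<notin> cand e e W W'" if "x \<in> set xs" for x
        proof -
          have "x \<notin> OV" "x \<notin> t ` set B" using that True disj by auto
          then show ?thesis
            using chord_cycle_avoids[OF B(1) e W(1), of x] chord_cycle_avoids[OF B(1) e W(2), of x]
            unfolding cand_def by simp
        qed
        then show "\<exists>g\<in>free AG (cand e e W W'). (h g, t g) \<in> (ugr t h (free AG (cand e e W W') - {g}))\<^sup>*"
          by (intro whole) blast
      qed
    next
      case False
      obtain b where b: "b \<in> set B" "t b \<in> OV" using lo by (auto simp: long_def)
      then obtain q where q: "q < N" "t b = os q" by auto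
      have "os q \<in> t ` set B" using b q by (metis imageI)
      then have qx: "os q \<notin> set xs" using disj by auto
      \<comment> \<open>\<open>C\<close> misses the vertex \<open>os q\<close> of \<open>B\<close>
        on \<open>O\<close>, so by \<open>exists_off_arc\<close> it cannot run on \<open>O\<close>
        only.\<close>
      obtain i where i: "i < ?n" "cs ! i \<notin> OA"
      proof -
        obtain c y where cy: "inj_on c {..<?n}" "c ` {..<?n} = set cs" "y ?n = y 0" "y ` {..<?n} = set xs"
          "\<And>j. j < ?n \<Longrightarrow> {t (c j), h (c j)} = {y j, y (Suc j)}"
          by (rule rot[of 0]) (use C(1) in auto)
        have "\<exists>j<?n. c j \<notin> OA"
        proof (rule exists_off_arc[OF n cy(3,1,5) q(1)])
          fix j assume "j < ?n"
          then have "y j \<in> y ` {..<?n}" by simp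
          then show "y j \<noteq> os q" using cy(4) qx by auto
        qed
        then obtain j where j: "j < ?n" "c j \<notin> OA" by auto
        then have "c j \<in> set cs" using cy(2) by auto
        then show ?thesis using that j by (metis in_set_conv_nth)
      qed
      obtain c y where cy: "c 0 = cs ! i" "inj_on c {..<?n}" "c ` {..<?n} = set cs" "y ?n = y 0"
        "y ` {..<?n} = set xs" "\<And>j. j < ?n \<Longrightarrow> {t (c j), h (c j)} = {y j, y (Suc j)}"
        by (rule rot[OF i(1)]) auto
      have y0: "y 0 \<in> y ` {..<?n}" using C(1) by (intro imageI) auto
    have yin: "y j \<in> set xs" if "j \<le> ?n" for j
        using cy(4,5) that y0 by (cases "j = ?n") auto
      \<comment> \<open>Index 0 is left out in favour of \<open>?n\<close>: removing
        \<open>c 0\<close> from \<open>C\<close> leaves the path from \<open>y 1\<close> to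
        \<open>y ?n\<close>. The first and the last visit of this path to \<open>O\<close> are the
        ends of the ear through \<open>c 0\<close>; they may coincide.\<close>
      define J where "J = {j \<in> {1..?n}. y j \<in> OV}"
      obtain x where x: "x \<in> OV" "x \<in> set xs" using False by auto
      then have "x \<in> y ` {..<?n}" using cy(5) by simp
      then obtain j where j: "j < ?n" "y j = x" by auto
      then have "(if j = 0 then ?n else j) \<in> J" using x cy(4) n by (auto simp: J_def)
      then have J: "finite J" "J \<noteq> {}" by (auto simp: J_def)
      define j1 where "j1 = Min J"
      define j2 where "j2 = Max J"
      have j12: "j1 \<in> J" "j2 \<in> J" "j1 \<le> j2" using J by (auto simp: j1_def j2_def)
      have out: "y j \<notin> OV" if "1 \<le> j" "j \<le> ?n" "j < j1 \<or> j2 < j" for j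
      proof
        assume "y j \<in> OV"
        then have "j \<in> J" using that by (auto simp: J_def)
        then show False using Min_le[OF J(1), of j] Max_ge[OF J(1), of j] that(3) unfolding j1_def j2_def by auto
      qed
      have J1: "1 \<le> j1" "j1 \<le> ?n" "y j1 \<in> OV" "1 \<le> j2" "j2 \<le> ?n" "y j2 \<in> OV"
        using j12 unfolding J_def by auto
      have nB: "y j1 \<notin> t ` set B" "y j2 \<notin> t ` set B"
        using yin[OF J1(2)] yin[OF J1(5)] disj by auto
      \<comment> \<open>Both ends of the ear are vertices of \<open>O\<close> off \<open>B\<close>,
        so one chord of \<open>B\<close> passes both of them.\<close>
      obtain e where e: "e \<in> set B" "long e"
        "civ (\<tau> (t e)) (\<tau> (h e)) (\<tau> (y j1))" "civ (\<tau> (t e)) (\<tau> (h e)) (\<tau> (y j2))"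
        using common_chord[OF B(1,3) lo J1(3) nB(1) J1(6) nB(2)] by auto
      have te: "t e \<in> OV" "e \<in> A" using e(2) unfolding long_def by auto
      show ?thesis
      proof (rule bexI[OF _ te(2)], rule bexI[OF _ te(2)], intro allI impI)
        fix W W' assume W: "minwalk (h e) W (t e)" "minwalk (h e) W' (t e)"
        let ?X = "cand e e W W'"
        let ?F = "free AG ?X - {c 0}"
        have av: "z \<notin> ?X" if "z \<notin> OV \<longrightarrow> z \<notin> t ` set B"
            "z \<in> OV \<longrightarrow> z \<noteq> t e \<and> civ (\<tau> (t e)) (\<tau> (h e)) (\<tau> z)" for z
          using chord_cycle_avoids[OF B(1) e(1,2) W(1) that] chord_cycle_avoids[OF B(1) e(1,2) W(2) that]
          unfolding cand_def by blast
        have yX: "y j \<notin> ?X" if "1 \<le> j" "j \<le> ?n" "j \<le> j1 \<or> j2 \<le> j" for j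
        proof (rule av)
          show "y j \<notin> OV \<longrightarrow> y j \<notin> t ` set B" using yin[OF that(2)] disj by auto
          show "y j \<in> OV \<longrightarrow> y j \<noteq> t e \<and> civ (\<tau> (t e)) (\<tau> (h e)) (\<tau> (y j))"
          proof
            assume "y j \<in> OV"
            then have "\<not> (j < j1 \<or> j2 < j)" using out[OF that(1,2)] by blast
            then have "j = j1 \<or> j = j2" using that(3) by linarith
            then show "y j \<noteq> t e \<and> civ (\<tau> (t e)) (\<tau> (h e)) (\<tau> (y j))" using e nB by auto
          qed
        qed
        have y0X: "y 0 \<notin> ?X" using yX[of ?n] cy(4) n J1(5) by simp
        have step: "c l \<in> free AG ?X \<and> {t (c l), h (c l)} = {y l, y (Suc l)}"
          if l: "l < ?n" "y l \<notin> ?X" "y (Suc l) \<notin> ?X" for l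
        proof -
          have "c l \<in> AG" using cy(3) C(5) l by auto
          moreover have "t (c l) \<in> {y l, y (Suc l)}" "h (c l) \<in> {y l, y (Suc l)}"
            using cy(6)[OF l(1)] by blast+
          ultimately show ?thesis using cy(6)[OF l(1)] l(2,3) unfolding free_def by auto
        qed
        have c0: "c l \<noteq> c 0" if "1 \<le> l" "l < ?n" for l using inj_onD[OF cy(2), of l 0] C(1) that by auto
        have p1: "(y 1, y j1) \<in> (ugr t h ?F)\<^sup>*"
        proof (rule ugr_path[OF J1(1)])
          fix l assume l: "1 \<le> l" "l < j1"
          then show "c l \<in> ?F \<and> {t (c l), h (c l)} = {y l, y (Suc l)}"
            using step[of l] yX[of l] yX[of "Suc l"] c0[of l] J1(2) by simp
        qed
        have p2: "(y j2, y ?n) \<in> (ugr t h ?F)\<^sup>*"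
        proof (rule ugr_path[OF J1(5)])
          fix l assume l: "j2 \<le> l" "l < ?n"
          then show "c l \<in> ?F \<and> {t (c l), h (c l)} = {y l, y (Suc l)}"
            using step[of l] yX[of l] yX[of "Suc l"] c0[of l] J1(4) by simp
        qed
        have seg: "(os p, os q) \<in> (ugr t h ?F)\<^sup>*"
          if pq: "p < N" "q < N" "civ (\<tau> (t e)) (\<tau> (h e)) q" "q \<noteq> \<tau> (t e)"
            "\<forall>r. civ p q r \<longrightarrow> civ (\<tau> (t e)) (\<tau> (h e)) r \<and> r \<noteq> \<tau> (t e)" for p q
        proof -
          obtain V where V: "walk t h A (os p) V (os q)" "set V \<subseteq> oa ` {r. r < N \<and> civ p q r}"
            using O_walk[OF pq(1,2)] by auto
          \<comment> \<open>Beyond its tail, the stretch of \<open>O\<close> that \<open>e\<close>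
            passes is avoided by the candidate. Its arcs also survive the deletion of
            \<open>c 0\<close>, which is not an arc of \<open>O\<close>.\<close>
          have F: "oa r \<in> ?F" if r: "r < N" "civ p q r" for r
          proof -
            have ok: "os r' \<notin> ?X" if r': "r' < N" "civ (\<tau> (t e)) (\<tau> (h e)) r'" "r' \<noteq> \<tau> (t e)" for r'
            proof (rule av)
              show "os r' \<notin> OV \<longrightarrow> os r' \<notin> t ` set B" using r' by blast
              have "os r' \<noteq> t e" using tau_os[OF r'(1)] r'(3) by metis
              then show "os r' \<in> OV \<longrightarrow> os r' \<noteq> t e \<and> civ (\<tau> (t e)) (\<tau> (h e)) (\<tau> (os r'))"
                using tau_os[OF r'(1)] r'(2) by simp
            qed
            have "os r \<notin> ?X" using ok[OF r(1)] pq(5) r by blast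
            moreover have "os (Suc r mod N) \<notin> ?X"
            proof (rule ok)
              show "Suc r mod N < N" using N_pos by simp
              show "civ (\<tau> (t e)) (\<tau> (h e)) (Suc r mod N)" "Suc r mod N \<noteq> \<tau> (t e)"
                using civ_Suc[OF r(2,1) pq(2)] pq(3-5) by metis+
            qed
            moreover have "oa r \<in> OA" using r by blast
            then have "oa r \<noteq> c 0" using i(2) cy(1) by metis
            ultimately show ?thesis using oa_arc[OF r(1)] AG \<open>oa r \<noteq> c 0\<close> by (auto simp: free_def)
          qed
          have "set V \<subseteq> ?F"
          proof
            fix a assume "a \<in> set V"
            then obtain r where "r < N" "civ p q r" "a = oa r" using V(2) by auto
            then show "a \<in> ?F" using F by simp
          qed
          from walk_ugr[OF V(1) this] show ?thesis .
        qed
        have ne: "\<tau> (y j1) \<noteq> \<tau> (t e)" "\<tau> (y j2) \<noteq> \<tau> (t e)"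
        proof -
          have "y j1 \<noteq> t e" "y j2 \<noteq> t e" using nB e(1) by auto
          then show "\<tau> (y j1) \<noteq> \<tau> (t e)" "\<tau> (y j2) \<noteq> \<tau> (t e)"
            using O_tau[OF J1(3)] O_tau[OF J1(6)] O_tau[OF te(1)] by metis+
        qed
        have "(y j1, y j2) \<in> (ugr t h ?F)\<^sup>*"
          using civ_linear[OF e(3,4) ne]
        proof
          assume "\<forall>r. civ (\<tau> (y j1)) (\<tau> (y j2)) r \<longrightarrow> civ (\<tau> (t e)) (\<tau> (h e)) r \<and> r \<noteq> \<tau> (t e)"
          from seg[OF tau_less tau_less e(4) ne(2) this] show ?thesis
            using O_tau[OF J1(3)] O_tau[OF J1(6)] by simp
        next
          assume "\<forall>r. civ (\<tau> (y j2)) (\<tau> (y j1)) r \<longrightarrow> civ (\<tau> (t e)) (\<tau> (h e)) r \<and> r \<noteq> \<tau> (t e)"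
          from seg[OF tau_less tau_less e(3) ne(1) this] show ?thesis
            using O_tau[OF J1(3)] O_tau[OF J1(6)] ugr_sym by simp
        qed
        then have p: "(y 1, y ?n) \<in> (ugr t h ?F)\<^sup>*" using p1 p2 by (meson rtrancl_trans)
        have e0: "{t (c 0), h (c 0)} = {y 1, y ?n}" using cy(4) cy(6)[OF n0] by (simp add: insert_commute)
        have "(h (c 0), t (c 0)) \<in> (ugr t h ?F)\<^sup>*" by (rule ends_rtrancl[OF e0 p])
        moreover have "c 0 \<in> free AG ?X" using step[OF n0 y0X] yX[of 1] J1(1) n by simp
        ultimately show "\<exists>g\<in>free AG ?X. (h g, t g) \<in> (ugr t h (free AG ?X - {g}))\<^sup>*"
          by (rule bexI)
      qed
    qed
  qed
qed

end

section \<open>Vaults\<close>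

text \<open>Positions on a concatenation of \<open>l\<close> nonempty blocks. It serves twice: the
  blocks are the dipaths of the vault in the order of \<open>O\<close>, and later the dipaths that
  replace the arcs of \<open>O\<close>.\<close>

locale blocks =
  fixes len :: "nat \<Rightarrow> nat" and l :: nat
  assumes len_pos: "m < l \<Longrightarrow> 0 < len m" and l_pos: "0 < l"
begin

definition "off m = (\<Sum>j<m. len j)"

definition "blk q = (LEAST m. q < off (Suc m))"

lemma off_0 [simp]: "off 0 = 0" and off_Suc: "off (Suc m) = off m + len m"
  by (simp_all add: off_def)

lemma off_mono: "m \<le> m' \<Longrightarrow> off m \<le> off m'"
  unfolding off_def by (intro sum_mono2) auto

lemma off_less_iff: "j < len m \<Longrightarrow> off m + j < off m' \<longleftrightarrow> m < m'"
proof (cases "m < m'")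
  case True
  moreover assume "j < len m"
  ultimately show ?thesis using off_mono[of "Suc m" m'] by (simp add: off_Suc)
next
  case False
  then show ?thesis using off_mono[of m' m] by simp
qed

lemma off_le_iff: "j < len m \<Longrightarrow> off m' \<le> off m + j \<longleftrightarrow> m' \<le> m"
  using off_less_iff[of j m m'] by (metis linorder_not_le)

lemma blk_off [simp]: "j < len m \<Longrightarrow> blk (off m + j) = m"
  unfolding blk_def by (rule Least_equality) (auto simp: off_less_iff less_Suc_eq_le)

lemma blk_ex: "q < off l' \<Longrightarrow> \<exists>m<l'. \<exists>j<len m. q = off m + j"
proof (induction l')
  case (Suc l')
  then show ?case
  proof (cases "q < off l'")
    case False
    then have "q - off l' < len l'" "q = off l' + (q - off l')" using Suc.prems by (auto simp: off_Suc)
    then show ?thesis by blast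
  qed (use Suc less_Suc_eq in blast)
qed simp

lemma Suc_off_mod:
  assumes m: "m < l" "j < len m"
  shows "Suc (off m + j) mod off l = (if Suc j < len m then off m + Suc j else off (Suc m mod l))"
proof (cases "Suc j < len m")
  case True
  then have "off m + Suc j < off l" using off_less_iff m(1) by blast
  then show ?thesis using True by simp
next
  case False
  then have e: "Suc (off m + j) = off (Suc m)" using m by (simp add: off_Suc)
  show ?thesis
  proof (cases "Suc m = l")
    case True
    then show ?thesis using e False by simp
  next
    case F2: False
    then have "Suc m < l" using m by simp
    then have "off (Suc m) < off l" using off_less_iff[of 0 "Suc m" l] len_pos[of "Suc m"] by simp
    then show ?thesis using e False \<open>Suc m < l\<close> by simp
  qed
qed

lemma off_inj: "j < len m \<Longrightarrow> j' < len m' \<Longrightarrow> off m + j = off m' + j' \<longleftrightarrow> m = m' \<and> j = j'"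
  by (metis add_left_cancel blk_off)

end

locale vault_data =
  fixes G :: "('a, 'b) pre_digraph" and l :: nat and p :: "nat \<Rightarrow> 'a list" and b c :: "nat \<Rightarrow> nat"
  assumes l: "l \<ge> 5" "odd l"
    and p: "i < l \<Longrightarrow> p i \<noteq> [] \<and> distinct (p i)"
    and p_disj: "i < l \<Longrightarrow> j < l \<Longrightarrow> i \<noteq> j \<Longrightarrow> set (p i) \<inter> set (p j) = {}"
    and bc: "i < l \<Longrightarrow> b i < length (p i) \<and> c i < length (p i) \<and> b i \<le> c i"
    and V: "verts G = (\<Union>i<l. set (p i))"
    and pa: "i < l \<Longrightarrow> Suc j < length (p i) \<Longrightarrow> card (arcs_between G (p i ! j) (p i ! Suc j)) = 1"
    and ja: "i < l \<Longrightarrow> card (arcs_between G (last (p i)) (hd (p ((i + 2) mod l)))) = 1"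
    and sa: "i < l \<Longrightarrow> \<exists>e\<in>arcs G. tail G e \<in> set (drop (c i) (p i)) \<and>
               head G e \<in> set (take (Suc (b (Suc i mod l))) (p (Suc i mod l)))"
    and arcs: "e \<in> arcs G \<Longrightarrow>
        (\<exists>i<l. \<exists>j. Suc j < length (p i) \<and> e \<in> arcs_between G (p i ! j) (p i ! Suc j)) \<or>
        (\<exists>i<l. tail G e \<in> set (drop (c i) (p i)) \<and>
               head G e \<in> set (take (Suc (b (Suc i mod l))) (p (Suc i mod l)))) \<or>
        (\<exists>i<l. e \<in> arcs_between G (last (p i)) (hd (p ((i + 2) mod l))))"
begin

text \<open>The inverse of 2 modulo the odd number \<open>l\<close>; it makes the order
  \<open>s\<close> in which \<open>O\<close> visits the dipaths a bijection.\<close>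

definition "k = (l + 1) div 2"
definition "s m = 2 * m mod l"

lemma lk: "l = 2 * k - 1" "k \<ge> 3" "k < l" "2 * k = l + 1"
  using l by (auto simp: k_def elim: oddE)

lemma s_less: "s m < l"
  using l by (simp add: s_def)

lemma s_inv: "m < l \<Longrightarrow> s m * k mod l = m"
proof -
  assume m: "m < l"
  have "s m * k mod l = 2 * m * k mod l" by (simp add: s_def mod_mult_left_eq)
  also have "2 * m * k = m * (l + 1)" using lk(4) by (metis mult.assoc mult.commute)
  also have "m * (l + 1) mod l = m" using m by (simp add: algebra_simps)
  finally show ?thesis .
qed

lemma s_surj: "i < l \<Longrightarrow> s (i * k mod l) = i"
proof -
  assume i: "i < l"
  have "s (i * k mod l) = 2 * (i * k) mod l" by (simp add: s_def mod_mult_right_eq)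
  also have "2 * (i * k) = i * (l + 1)" using lk(4) by (metis mult.assoc mult.commute)
  also have "i * (l + 1) mod l = i" using i by (simp add: algebra_simps)
  finally show ?thesis .
qed

lemma s_ex: "i < l \<Longrightarrow> \<exists>m<l. s m = i"
  using s_surj[of i] l by (intro exI[of _ "i * k mod l"]) auto

lemma s_inj: "m < l \<Longrightarrow> m' < l \<Longrightarrow> s m = s m' \<longleftrightarrow> m = m'"
  using s_inv by metis

lemma s_jump: "(s m + 2) mod l = s (Suc m mod l)"
  by (simp add: s_def mod_simps)

text \<open>A jump goes to the next dipath in the order of \<open>O\<close>, whereas a step goes
  \<open>k\<close> dipaths ahead, since \<open>2k = l + 1\<close>.\<close>

lemma s_step: "Suc (s m) mod l = s ((m + k) mod l)"
proof -
  have "s ((m + k) mod l) = (2 * (m + k)) mod l" by (simp add: s_def mod_mult_right_eq)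
  also have "2 * (m + k) = Suc (2 * m) + l" using lk(4) by simp
  also have "\<dots> mod l = Suc (2 * m) mod l" by (rule mod_add_self2)
  finally show ?thesis by (simp add: s_def mod_Suc_eq)
qed

sublocale blocks "\<lambda>m. length (p (s m))" l
  using p s_less l by unfold_locales auto

definition "n = off l"
definition "os q = p (s (blk q)) ! (q - off (blk q))"
text \<open>The choice is forced: between consecutive vertices of \<open>O\<close> there is exactly
  one arc, from the unit cardinalities in the definition of a vault.\<close>

definition "oa q = (SOME e. e \<in> arcs_between G (os q) (os (Suc q mod n)))"
definition "\<tau> v = (if v \<in> os ` {..<n} then inv_into {..<n} os v else 0)"
text \<open>The last position of each block, where the arc of \<open>O\<close> is the jump.\<close>

definition "M = (\<lambda>m. off (Suc m) - 1) ` {..<l}"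

lemma os_off: "j < length (p (s m)) \<Longrightarrow> os (off m + j) = p (s m) ! j"
  by (simp add: os_def)

lemma off_n: "m < l \<Longrightarrow> j < length (p (s m)) \<Longrightarrow> off m + j < n"
  unfolding n_def by (simp add: off_less_iff)

lemma q_ex: "q < n \<Longrightarrow> \<exists>m<l. \<exists>j<length (p (s m)). q = off m + j"
  unfolding n_def by (rule blk_ex)

lemma os_inj: "inj_on os {..<n}"
proof (rule inj_onI)
  fix q q' assume "q \<in> {..<n}" "q' \<in> {..<n}" and eq: "os q = os q'"
  then obtain m j m' j' where m: "m < l" "j < length (p (s m))" "q = off m + j"
    "m' < l" "j' < length (p (s m'))" "q' = off m' + j'" using q_ex by (metis lessThan_iff)
  have e: "p (s m) ! j = p (s m') ! j'" using eq m by (simp add: os_off)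
  then have "set (p (s m)) \<inter> set (p (s m')) \<noteq> {}" using m nth_mem by (metis disjoint_iff)
  then have "s m = s m'" using p_disj[OF s_less s_less] by metis
  then have "m = m'" using s_inj m by simp
  then show "q = q'" using e m p[OF s_less] by (simp add: nth_eq_iff_index_eq)
qed

lemma os_verts: "os ` {..<n} = verts G"
proof
  show "os ` {..<n} \<subseteq> verts G"
  proof
    fix v assume "v \<in> os ` {..<n}"
    then obtain m j where "m < l" "j < length (p (s m))" "v = p (s m) ! j" using q_ex os_off by force
    then show "v \<in> verts G" unfolding V using s_less nth_mem by blast
  qed
  show "verts G \<subseteq> os ` {..<n}"
  proof
    fix v assume "v \<in> verts G"
    then obtain i where "i < l" "v \<in> set (p i)" unfolding V by auto
    then obtain m where m: "m < l" "v \<in> set (p (s m))" using s_ex by metis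
    then obtain j where "j < length (p (s m))" "v = p (s m) ! j" by (metis in_set_conv_nth)
    then have "v = os (off m + j)" "off m + j < n" using m os_off off_n by auto
    then show "v \<in> os ` {..<n}" by blast
  qed
qed

lemma tau_os: "q < n \<Longrightarrow> \<tau> (os q) = q"
  using os_inj by (simp add: \<tau>_def)

lemma n_pos: "0 < n"
  using off_n[of 0 0] p[OF s_less, of 0] l by simp

lemma tau_less: "\<tau> v < n"
  using n_pos inv_into_into[of v os "{..<n}"] by (auto simp: \<tau>_def)

lemma Suc_off: "m < l \<Longrightarrow> j < length (p (s m)) \<Longrightarrow>
   Suc (off m + j) mod n = (if Suc j < length (p (s m)) then off m + Suc j else off (Suc m mod l))"
  unfolding n_def by (rule Suc_off_mod)

lemma os_hd: "m < l \<Longrightarrow> os (off m) = hd (p (s m))"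
  using os_off[of 0 m] p[OF s_less, of m] by (simp add: hd_conv_nth)

lemma os_Suc: "m < l \<Longrightarrow> j < length (p (s m)) \<Longrightarrow>
   os (Suc (off m + j) mod n) =
     (if Suc j < length (p (s m)) then p (s m) ! Suc j else hd (p ((s m + 2) mod l)))"
  using Suc_off[of m j] os_off[of "Suc j" m] os_hd[of "Suc m mod l"] l s_jump[of m]
  by (auto simp del: add_Suc_right add_2_eq_Suc add_2_eq_Suc')

lemma card_oa: "q < n \<Longrightarrow> card (arcs_between G (os q) (os (Suc q mod n))) = 1"
proof -
  assume "q < n"
  then obtain m j where m: "m < l" "j < length (p (s m))" "q = off m + j" using q_ex by blast
  show ?thesis
  proof (cases "Suc j < length (p (s m))")
    case True
    then show ?thesis using pa[OF s_less True] m os_Suc[OF m(1,2)] os_off[OF m(2)] by simp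
  next
    case False
    then have "j = length (p (s m)) - 1" using m by simp
    then have "p (s m) ! j = last (p (s m))" using p[OF s_less, of m] by (simp add: last_conv_nth)
    then show ?thesis using False ja[OF s_less, of m] m os_Suc[OF m(1,2)] os_off[OF m(2)] by simp
  qed
qed

lemma oa_unique:
  assumes "q < n" shows "e \<in> arcs_between G (os q) (os (Suc q mod n)) \<longleftrightarrow> e = oa q"
proof -
  obtain x where x: "arcs_between G (os q) (os (Suc q mod n)) = {x}"
    using card_oa[OF assms] by (auto simp: card_1_singleton_iff)
  then have "oa q = x" unfolding oa_def by simp
  then show ?thesis using x by simp
qed

lemma oa_arc: "q < n \<Longrightarrow> oa q \<in> arcs G \<and> tail G (oa q) = os q \<and> head G (oa q) = os (Suc q mod n)"
  using oa_unique[of q "oa q"] by (auto simp: arcs_between_def)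

text \<open>Arcs off \<open>O\<close> are the step arcs.\<close>

lemma step_pos:
  assumes e: "e \<in> arcs G" "e \<notin> oa ` {..<n}"
  obtains m j j' where "m < l" "c (s m) \<le> j" "j < length (p (s m))" "tail G e = os (off m + j)"
    "j' \<le> b (s ((m + k) mod l))" "head G e = os (off ((m + k) mod l) + j')"
proof -
  have no: "\<not> (tail G e = os q \<and> head G e = os (Suc q mod n))" if "q < n" for q
    using oa_unique[OF that, of e] e that by (auto simp: arcs_between_def)
  consider (path) i j where "i < l" "Suc j < length (p i)" "e \<in> arcs_between G (p i ! j) (p i ! Suc j)"
    | (step) i where "i < l" "tail G e \<in> set (drop (c i) (p i))"
               "head G e \<in> set (take (Suc (b (Suc i mod l))) (p (Suc i mod l)))"
    | (jump) i where "i < l" "e \<in> arcs_between G (last (p i)) (hd (p ((i + 2) mod l)))"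
    using arcs[OF e(1)] by blast
  then show ?thesis
  proof cases
    case path
    obtain m where m: "m < l" "s m = i" using s_ex path by auto
    then have "tail G e = os (off m + j)" "head G e = os (Suc (off m + j) mod n)"
      using path os_off[of j m] os_Suc[of m j] by (auto simp: arcs_between_def)
    then show ?thesis using no off_n[of m j] m path by auto
  next
    case jump
    obtain m where m: "m < l" "s m = i" using s_ex jump by auto
    let ?j = "length (p i) - 1"
    have j: "?j < length (p (s m))" "last (p i) = p i ! ?j" "\<not> Suc ?j < length (p i)"
      using p[OF jump(1)] m by (auto simp: last_conv_nth)
    then have "tail G e = os (off m + ?j)" "head G e = os (Suc (off m + ?j) mod n)"
      using jump os_off[of ?j m] os_Suc[of m ?j] m by (auto simp: arcs_between_def)
    then show ?thesis using no off_n[of m ?j] m j by auto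
  next
    case step
    obtain m where m: "m < l" "s m = i" using s_ex step by auto
    let ?m = "(m + k) mod l"
    have i': "Suc i mod l = s ?m" using s_step[of m] m by simp
    obtain j0 where j0: "j0 < length (drop (c i) (p i))" "tail G e = drop (c i) (p i) ! j0"
      using step(2) by (metis in_set_conv_nth)
    obtain j' where j': "j' < length (take (Suc (b (s ?m))) (p (s ?m)))"
      "head G e = take (Suc (b (s ?m))) (p (s ?m)) ! j'"
      using step(3) unfolding i' by (metis in_set_conv_nth)
    have "tail G e = os (off m + (c i + j0))"
      using j0 m os_off[of "c i + j0" m] by simp
    moreover have "head G e = os (off ?m + j')"
      using j' os_off[of j' ?m] by simp
    ultimately show ?thesis using that[of m "c i + j0" j'] m j0 j' by simp
  qed
qed

text \<open>The arc is not on \<open>O\<close> because it ends \<open>k\<close> blocks further on,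
  whereas an arc of \<open>O\<close> stays in its block or goes to the next one, and
  \<open>1 < k < l\<close>.\<close>

lemma step_ex:
  assumes "m < l"
  obtains e j j' where "e \<in> arcs G" "e \<notin> oa ` {..<n}" "c (s m) \<le> j" "j < length (p (s m))"
    "tail G e = os (off m + j)" "j' \<le> b (s ((m + k) mod l))" "head G e = os (off ((m + k) mod l) + j')"
proof -
  let ?m = "(m + k) mod l"
  have ml: "?m < l" using l by simp
  have i': "Suc (s m) mod l = s ?m" using s_step by simp
  obtain e where e: "e \<in> arcs G" "tail G e \<in> set (drop (c (s m)) (p (s m)))"
    "head G e \<in> set (take (Suc (b (s ?m))) (p (s ?m)))"
    using sa[OF s_less, of m] unfolding i' by auto
  obtain j0 where j0: "j0 < length (drop (c (s m)) (p (s m)))" "tail G e = drop (c (s m)) (p (s m)) ! j0"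
    using e(2) by (metis in_set_conv_nth)
  obtain j' where j': "j' < length (take (Suc (b (s ?m))) (p (s ?m)))"
    "head G e = take (Suc (b (s ?m))) (p (s ?m)) ! j'"
    using e(3) by (metis in_set_conv_nth)
  have t: "tail G e = os (off m + (c (s m) + j0))" using j0 os_off[of "c (s m) + j0" m] by simp
  have h: "head G e = os (off ?m + j')" using j' os_off[of j' ?m] by simp
  have jl: "c (s m) + j0 < length (p (s m))" "j' < length (p (s ?m))" using j0 j' by auto
  have "e \<notin> oa ` {..<n}"
  proof
    assume "e \<in> oa ` {..<n}"
    then obtain q where q: "q < n" "e = oa q" by auto
    then have "os q = os (off m + (c (s m) + j0))" using t oa_arc by simp
    then have qq: "q = off m + (c (s m) + j0)"
      using inj_onD[OF os_inj] q off_n[OF assms jl(1)] by blast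
    have "os (Suc q mod n) = os (off ?m + j')" using h q oa_arc by simp
    then have "Suc q mod n = off ?m + j'"
      using inj_onD[OF os_inj, of "Suc q mod n" "off ?m + j'"] n_pos off_n[OF ml jl(2)] by simp
    then have "(if Suc (c (s m) + j0) < length (p (s m)) then off m + Suc (c (s m) + j0) else off (Suc m mod l)) = off ?m + j'"
      using Suc_off[OF assms jl(1)] qq by simp
    then have "m = ?m \<or> Suc m mod l = ?m"
      using off_inj[OF _ jl(2), of "Suc (c (s m) + j0)" m] off_inj[OF _ jl(2), of 0 "Suc m mod l"]
        p[OF s_less, of "Suc m mod l"] by (auto split: if_splits)
    moreover have "m \<noteq> ?m"
      using assms lk by (cases "m + k < l") (auto simp: mod_if)
    moreover have "Suc m mod l \<noteq> ?m"
      using assms lk by (cases "m + k < l"; cases "Suc m = l") (auto simp: mod_if)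
    ultimately show False by simp
  qed
  then show ?thesis using that[OF e(1) _ _ jl(1) t _ h] j' by simp
qed

lemma mark_le: "i < l \<Longrightarrow> j < length (p (s m)) \<Longrightarrow> off m + j \<le> off (Suc i) - 1 \<longleftrightarrow> m \<le> i"
proof -
  assume i: "i < l" "j < length (p (s m))"
  have "0 < off (Suc i)" using p[OF s_less, of i] by (simp add: off_Suc)
  then have "off m + j \<le> off (Suc i) - 1 \<longleftrightarrow> off m + j < off (Suc i)" by linarith
  then show ?thesis using off_less_iff[OF i(2), of "Suc i"] by (simp add: less_Suc_eq_le)
qed

lemma mark_less: "i < l \<Longrightarrow> j < length (p (s m)) \<Longrightarrow> off (Suc i) - 1 < off m + j \<longleftrightarrow> i < m"
  using mark_le[of i j m] by (simp flip: not_le)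

text \<open>A block's mark is at its end, so the marks between a vertex of block \<open>m\<close>
  and one of block \<open>m + k\<close> are those of the \<open>k\<close> blocks from
  \<open>m\<close> to \<open>m + k - 1\<close>, wherever inside their blocks the two vertices
  lie.\<close>

lemma card_marks:
  assumes "m < l" and j: "j < length (p (s m))" "j' < length (p (s ((m + k) mod l)))"
  shows "card {q \<in> M. civ (off m + j) (off ((m + k) mod l) + j') q} = k"
proof -
  let ?m = "(m + k) mod l"
  let ?f = "\<lambda>i. off (Suc i) - 1"
  have ne: "m \<noteq> ?m" using assms lk by (cases "m + k < l") (auto simp: mod_if)
  have "off m + j \<le> off ?m + j' \<longleftrightarrow> m \<le> ?m"
    using off_less_iff[OF j(1), of ?m] off_less_iff[OF j(2), of m] ne by linarith
  then have "civ (off m + j) (off ?m + j') (?f i) \<longleftrightarrow> civ m ?m i" if "i < l" for i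
    unfolding civ_def using mark_le[OF that j(1)] mark_less[OF that j(2)] by simp
  then have "{q \<in> M. civ (off m + j) (off ?m + j') q} = ?f ` {i. i < l \<and> civ m ?m i}"
    unfolding M_def by auto
  moreover have "inj_on ?f {i. i < l \<and> civ m ?m i}"
  proof (rule inj_onI)
    fix i i' assume i: "i \<in> {i. i < l \<and> civ m ?m i}" "i' \<in> {i. i < l \<and> civ m ?m i}" "?f i = ?f i'"
    have f: "?f i = off i + (length (p (s i)) - 1)" for i
      using p[OF s_less, of i] by (simp add: off_Suc Suc_le_eq)
    have "length (p (s i)) - 1 < length (p (s i))" for i using p[OF s_less, of i] by simp
    then show "i = i'" using i(3) unfolding f using off_inj by blast
  qed
  ultimately have "card {q \<in> M. civ (off m + j) (off ?m + j') q} = card {i. i < l \<and> civ m ?m i}"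
    by (simp add: card_image)
  also have "\<dots> = k"
  proof (cases "m + k < l")
    case True
    then have "{i. i < l \<and> civ m ?m i} = {m..<m + k}" by (auto simp: civ_def)
    then show ?thesis by simp
  next
    case False
    then have e: "?m = m + k - l" using assms lk by (auto simp: mod_if)
    then have lt: "?m < m" using lk assms(1) False by linarith
    then have "{i. i < l \<and> civ m ?m i} = {m..<l} \<union> {..<?m}" using assms by (auto simp: civ_def)
    moreover have "card ({m..<l} \<union> {..<?m}) = (l - m) + ?m" using lt by (subst card_Un_disjoint) auto
    ultimately show ?thesis using e False assms by simp
  qed
  finally show ?thesis .
qed

lemma card_M: "card M = 2 * k - 1"
proof -
  have f: "off (Suc i) - 1 = off i + (length (p (s i)) - 1)" for i
    using p[OF s_less, of i] by (simp add: off_Suc Suc_le_eq)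
  have g: "length (p (s i)) - 1 < length (p (s i))" for i using p[OF s_less, of i] by simp
  have "inj_on (\<lambda>m. off (Suc m) - 1) {..<l}"
  proof (rule inj_onI)
    fix i i' assume "off (Suc i) - 1 = off (Suc i') - 1"
    then show "i = i'" unfolding f using off_inj[OF g g] by blast
  qed
  then have "card M = l" unfolding M_def by (simp add: card_image)
  then show ?thesis using lk(1) by (rule trans)
qed

lemma os_eq: "x < n \<Longrightarrow> os x = os (off m + j) \<Longrightarrow> m < l \<Longrightarrow> j < length (p (s m)) \<Longrightarrow> x = off m + j"
  using inj_onD[OF os_inj, of x "off m + j"] off_n[of m j] by simp

lemma chorded_vault: "chorded (tail G) (head G) (arcs G) n os oa \<tau> (\<lambda>_. 0) M k"
proof
  have ml: "(m + k) mod l < l" for m using l by simp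
  have bl: "j' \<le> b (s m) \<Longrightarrow> j' < length (p (s m))" for j' m using bc[OF s_less, of m] by simp
  \<comment> \<open>All vertices lie on \<open>O\<close>, so the conditions on the inside of chords
    are vacuous and the rank may be constant.\<close>
  have tO: "tail G e \<in> os ` {..<n}" if "e \<in> arcs G" for e
  proof (cases "e \<in> oa ` {..<n}")
    case True then show ?thesis using oa_arc by auto
  next
    case False
    from step_pos[OF that False] show ?thesis by (metis off_n imageI lessThan_iff)
  qed
  show "inj_on os {..<n}" by (rule os_inj)
  show "q < n \<Longrightarrow> oa q \<in> arcs G \<and> tail G (oa q) = os q \<and> head G (oa q) = os (Suc q mod n)" for q
    by (rule oa_arc)
  show "q < n \<Longrightarrow> \<tau> (os q) = q" for q by (rule tau_os)
  show "\<tau> v < n" for v by (rule tau_less)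
  show "e \<in> arcs G \<Longrightarrow> tail G e \<notin> os ` {..<n} \<Longrightarrow> \<tau> (head G e) = \<tau> (tail G e)"
    "e \<in> arcs G \<Longrightarrow> tail G e \<notin> os ` {..<n} \<Longrightarrow> head G e \<notin> os ` {..<n} \<Longrightarrow> (0::nat) < 0"
    "e \<in> arcs G \<Longrightarrow> f \<in> arcs G \<Longrightarrow> tail G e = tail G f \<Longrightarrow> tail G e \<notin> os ` {..<n} \<Longrightarrow> e = f" for e f
    using tO by blast+
  have hO: "head G e \<in> os ` {..<n}" if "e \<in> arcs G" for e
  proof (cases "e \<in> oa ` {..<n}")
    case True then show ?thesis using oa_arc n_pos by auto
  next
    case False
    from step_pos[OF that False] show ?thesis by (metis off_n imageI lessThan_iff bl ml)
  qed
  show "e \<in> arcs G \<Longrightarrow> f \<in> arcs G \<Longrightarrow> head G e = head G f \<Longrightarrow> head G e \<notin> os ` {..<n} \<Longrightarrow> e = f" for e f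
    using hO by blast
  show "M \<subseteq> {..<n}"
  proof
    fix q assume "q \<in> M"
    then obtain m where m: "m < l" "q = off (Suc m) - 1" by (auto simp: M_def)
    then have "q = off m + (length (p (s m)) - 1)" using p[OF s_less, of m] by (simp add: off_Suc Suc_le_eq)
    then show "q \<in> {..<n}" using off_n[of m "length (p (s m)) - 1"] p[OF s_less, of m] m by simp
  qed
  show "card M = 2 * k - 1" by (rule card_M)
  show "2 \<le> k" using lk by simp
  show "card {q \<in> M. civ (\<tau> (tail G e)) (\<tau> (head G e)) q} = k"
    if e: "e \<in> arcs G" "e \<notin> oa ` {..<n}" for e
  proof -
    obtain m j j' where m: "m < l" "c (s m) \<le> j" "j < length (p (s m))" "tail G e = os (off m + j)"
      "j' \<le> b (s ((m + k) mod l))" "head G e = os (off ((m + k) mod l) + j')"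
      using step_pos[OF e] .
    then show ?thesis using card_marks[OF m(1,3) bl[OF m(5)]] tau_os off_n[OF m(1,3)] off_n[OF ml bl[OF m(5)]]
      by simp
  qed
  show "\<exists>q\<in>M. x \<le> q \<and> q < y"
    if e: "e \<in> arcs G" "f \<in> arcs G" "e \<notin> oa ` {..<n}" "f \<notin> oa ` {..<n}"
      and xy: "tail G e = os x" "head G f = os y" "x < y" "y < n" for e f x y
  proof -
    obtain m j where m: "m < l" "c (s m) \<le> j" "j < length (p (s m))" "tail G e = os (off m + j)"
      using step_pos[OF e(1,3)] by metis
    obtain m' j' where m': "m' < l" "j' \<le> b (s m')" "head G f = os (off m' + j')"
      using step_pos[OF e(2,4)] ml by metis
    have x: "x = off m + j" using os_eq[OF _ _ m(1,3)] xy m(4) by simp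
    have y: "y = off m' + j'" using os_eq[OF xy(4) _ m'(1) bl[OF m'(2)]] xy m'(3) by simp
    \<comment> \<open>Within one dipath, heads of step arcs lie up to \<open>b\<close> and tails
      from \<open>c\<close> on, and \<open>b \<le> c\<close>; so a tail strictly before a head is in
      an earlier block.\<close>
    have "m < m'"
    proof (rule ccontr)
      assume "\<not> ?thesis"
      then have "m = m' \<or> m' < m" by linarith
      then show False
      proof
        assume "m = m'"
        then show False using xy(3) x y m m' bc[OF s_less, of m] by simp
      next
        assume "m' < m"
        then have "off m' + j' < off m" using off_less_iff[OF bl[OF m'(2)]] by simp
        then show False using xy(3) x y by simp
      qed
    qed
    then have "x \<le> off (Suc m) - 1" "off (Suc m) - 1 < y"
      using mark_le[OF m(1,3)] mark_less[OF m(1) bl[OF m'(2)]] x y by simp_all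
    then show ?thesis using m(1) unfolding M_def by blast
  qed
  have nomark: "\<not> (\<exists>q\<in>M. y \<le> q \<and> q < x)"
    if "y = off m + j'" "x = off m + j" "j < length (p (s m))" "j' < length (p (s m))" for x y m j j'
    unfolding M_def using that mark_le[OF _ that(4)] mark_less[OF _ that(3)] by auto
  show "\<exists>y\<le>x. (\<exists>f\<in>arcs G. f \<notin> oa ` {..<n} \<and> head G f = os y) \<and> \<not> (\<exists>q\<in>M. y \<le> q \<and> q < x)"
    if e: "e \<in> arcs G" "e \<notin> oa ` {..<n}" and x: "tail G e = os x" "x < n" for e x
  proof -
    obtain m j where m: "m < l" "c (s m) \<le> j" "j < length (p (s m))" "tail G e = os (off m + j)"
      using step_pos[OF e] by metis
    have xx: "x = off m + j" using os_eq[OF x(2) _ m(1,3)] x m(4) by simp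
    \<comment> \<open>The block from which steps lead into block \<open>m\<close>; adding
      \<open>l\<close> avoids a truncated subtraction.\<close>
    define m0 where "m0 = (m + l - k) mod l"
    have m0: "m0 < l" "(m0 + k) mod l = m"
    proof -
      show "m0 < l" using l by (simp add: m0_def)
      have "(m0 + k) mod l = (m + l - k + k) mod l" unfolding m0_def by (rule mod_add_left_eq)
      also have "m + l - k + k = m + l" using lk(3) by simp
      finally show "(m0 + k) mod l = m" using m by simp
    qed
    obtain f j' where f: "f \<in> arcs G" "f \<notin> oa ` {..<n}" "j' \<le> b (s m)" "head G f = os (off m + j')"
      using step_ex[OF m0(1)] m0(2) by metis
    have "off m + j' \<le> x" using f(3) xx m bc[OF s_less, of m] by simp
    then show ?thesis using f nomark[OF refl xx m(3) bl[OF f(3)]] by blast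
  qed
  show "\<exists>x\<le>q. (\<exists>e\<in>arcs G. e \<notin> oa ` {..<n} \<and> tail G e = os x) \<and> \<not> (\<exists>q'\<in>M. x \<le> q' \<and> q' < q)"
    if "q \<in> M" for q
  proof -
    obtain m where m: "m < l" "q = off (Suc m) - 1" using \<open>q \<in> M\<close> by (auto simp: M_def)
    obtain e j where e: "e \<in> arcs G" "e \<notin> oa ` {..<n}" "j < length (p (s m))" "tail G e = os (off m + j)"
      using step_ex[OF m(1)] by metis
    have q: "q = off m + (length (p (s m)) - 1)" using m p[OF s_less, of m] by (simp add: off_Suc Suc_le_eq)
    have "\<not> (\<exists>q'\<in>M. off m + j \<le> q' \<and> q' < q)"
      using p[OF s_less, of m] by (intro nomark[OF refl q _ e(3)]) simp
    moreover have "off m + j \<le> q" using q e(3) by simp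
    ultimately show ?thesis using e by blast
  qed
  have after: "\<exists>q\<in>M. x \<le> q" if xn: "x < n" for x
  proof -
    obtain m j where m: "m < l" "j < length (p (s m))" "x = off m + j" using q_ex[OF xn] by blast
    then have "x \<le> off (Suc m) - 1" using mark_le by simp
    then show ?thesis using m(1) unfolding M_def by blast
  qed
  then show "y < n \<Longrightarrow> \<exists>q\<in>M. y \<le> q" "x < n \<Longrightarrow> \<exists>q\<in>M. x \<le> q" for x y by auto
qed

end

lemma vault_chorded:
  assumes "vault G"
  shows "\<exists>n os oa \<tau> M k. chorded (tail G) (head G) (arcs G) n os oa \<tau> (\<lambda>_. 0) M k \<and> os ` {..<n} = verts G"
proof -
  obtain l p b c where *: "l \<ge> 5" "odd l"
    "\<forall>i<l. p i \<noteq> [] \<and> distinct (p i)"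
    "\<forall>i<l. \<forall>j<l. i \<noteq> j \<longrightarrow> set (p i) \<inter> set (p j) = {}"
    "\<forall>i<l. b i < length (p i) \<and> c i < length (p i) \<and>
       (c i = Suc (b i) \<or> b i = c i \<and> (b i = 0 \<or> b i = length (p i) - 1))"
    "verts G = (\<Union>i<l. set (p i))"
    "\<forall>i<l. \<forall>j. Suc j < length (p i) \<longrightarrow> card (arcs_between G (p i ! j) (p i ! Suc j)) = 1"
    "\<forall>i<l. \<exists>e. e \<in> arcs G \<and> tail G e \<in> set (drop (c i) (p i)) \<and>
               head G e \<in> set (take (Suc (b (Suc i mod l))) (p (Suc i mod l)))"
    "\<forall>i<l. card (arcs_between G (last (p i)) (hd (p ((i + 2) mod l)))) = 1"
    "\<forall>e\<in>arcs G. (\<exists>i<l. \<exists>j. Suc j < length (p i) \<and> e \<in> arcs_between G (p i ! j) (p i ! Suc j)) \<or>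
        (\<exists>i<l. e \<in> arcs G \<and> tail G e \<in> set (drop (c i) (p i)) \<and>
               head G e \<in> set (take (Suc (b (Suc i mod l))) (p (Suc i mod l)))) \<or>
        (\<exists>i<l. e \<in> arcs_between G (last (p i)) (hd (p ((i + 2) mod l))))"
    using assms unfolding vault_def Let_def by (elim conjE exE) (rule that; assumption)
  interpret vault_data G l p b c
  proof
    show "5 \<le> l" "odd l" "verts G = (\<Union>i<l. set (p i))" by (fact *)+
    show "p i \<noteq> [] \<and> distinct (p i)" if "i < l" for i using *(3) that by blast
    show "set (p i) \<inter> set (p j) = {}" if "i < l" "j < l" "i \<noteq> j" for i j using *(4) that by blast
    show "b i < length (p i) \<and> c i < length (p i) \<and> b i \<le> c i" if "i < l" for i
      using *(5)[rule_format, OF that] by auto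
    show "card (arcs_between G (p i ! j) (p i ! Suc j)) = 1" if "i < l" "Suc j < length (p i)" for i j
      using *(7) that by blast
    show "card (arcs_between G (last (p i)) (hd (p ((i + 2) mod l)))) = 1" if "i < l" for i
      using *(9) that by blast
    show "\<exists>e\<in>arcs G. tail G e \<in> set (drop (c i) (p i)) \<and>
               head G e \<in> set (take (Suc (b (Suc i mod l))) (p (Suc i mod l)))" if "i < l" for i
      using *(8) that by blast
    show "(\<exists>i<l. \<exists>j. Suc j < length (p i) \<and> e \<in> arcs_between G (p i ! j) (p i ! Suc j)) \<or>
        (\<exists>i<l. tail G e \<in> set (drop (c i) (p i)) \<and>
               head G e \<in> set (take (Suc (b (Suc i mod l))) (p (Suc i mod l)))) \<or>
        (\<exists>i<l. e \<in> arcs_between G (last (p i)) (hd (p ((i + 2) mod l))))" if "e \<in> arcs G" for e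
      using *(10) that by blast
  qed
  show ?thesis using chorded_vault os_verts by blast
qed

section \<open>Subdivisions\<close>

locale subdivided = V: chorded "tail V" "head V" "arcs V" n ov oa \<tau>V "\<lambda>_. 0" M k
  for V :: "('c, 'd) pre_digraph" and n ov oa \<tau>V M k +
  fixes H :: "('a, 'b) pre_digraph" and \<phi> :: "'c \<Rightarrow> 'a" and \<pi> :: "'d \<Rightarrow> 'b list"
  assumes ov: "ov ` {..<n} = verts V"
    and wfH: "wf_digraph H" and wfV: "wf_digraph V"
    and phi: "inj_on \<phi> (verts V)"
    and pi: "e \<in> arcs V \<Longrightarrow>
        pre_digraph.awalk H (\<phi> (tail V e)) (\<pi> e) (\<phi> (head V e)) \<and> \<pi> e \<noteq> [] \<and>
          distinct (inner_verts H (\<pi> e)) \<and>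
          set (inner_verts H (\<pi> e)) \<inter> \<phi> ` verts V = {}"
    and pi_disj: "e \<in> arcs V \<Longrightarrow> f \<in> arcs V \<Longrightarrow> e \<noteq> f \<Longrightarrow>
          set (\<pi> e) \<inter> set (\<pi> f) = {} \<and>
          set (inner_verts H (\<pi> e)) \<inter> set (inner_verts H (\<pi> f)) = {}"
    and arcsH: "arcs H = (\<Union>e \<in> arcs V. set (\<pi> e))"
begin

interpretation H: wf_digraph H by (rule wfH)

abbreviation "L e \<equiv> length (\<pi> e)"

lemma L_pos: "e \<in> arcs V \<Longrightarrow> 0 < L e"
  using pi by simp

lemma cas_nth:
  "H.cas u W v \<Longrightarrow> j < length W \<Longrightarrow>
   tail H (W ! j) = (if j = 0 then u else head H (W ! (j - 1))) \<and>
   (Suc j = length W \<longrightarrow> head H (W ! j) = v)"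
proof (induction W arbitrary: u j)
  case (Cons e W)
  then show ?case
  proof (cases j)
    case 0
    then show ?thesis using Cons by auto
  next
    case (Suc i)
    have "H.cas (head H e) W v" "i < length W" "tail H e = u" using Cons.prems Suc by auto
    then show ?thesis using Cons.IH[of "head H e" i] unfolding Suc nth_Cons_Suc by (cases i) simp_all
  qed
qed simp

lemma cas_pi: "e \<in> arcs V \<Longrightarrow> H.cas (\<phi> (tail V e)) (\<pi> e) (\<phi> (head V e))"
  using pi by (simp add: H.awalk_def)

lemma inner_nth: "Suc j < L e \<Longrightarrow> inner_verts H (\<pi> e) ! j = head H (\<pi> e ! j)"
  by (simp add: inner_verts_def nth_butlast)

lemma tail_0: "e \<in> arcs V \<Longrightarrow> tail H (\<pi> e ! 0) = \<phi> (tail V e)"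
  using cas_nth[OF cas_pi, of e 0] L_pos by simp

lemma head_nth: "e \<in> arcs V \<Longrightarrow> j < L e \<Longrightarrow>
   head H (\<pi> e ! j) = (if Suc j = L e then \<phi> (head V e) else tail H (\<pi> e ! Suc j))"
  using cas_nth[OF cas_pi, of e j] cas_nth[OF cas_pi, of e "Suc j"] by auto

lemma tail_inner: "e \<in> arcs V \<Longrightarrow> 0 < j \<Longrightarrow> j < L e \<Longrightarrow>
   tail H (\<pi> e ! j) = inner_verts H (\<pi> e) ! (j - 1) \<and> j - 1 < length (inner_verts H (\<pi> e))"
  using cas_nth[OF cas_pi, of e j] inner_nth[of "j - 1" e] by (auto simp: inner_verts_def)

text \<open>For \<open>0 < j\<close> the tail is an inner vertex. Inner vertices of a path are
  distinct, differ from the images of the vertices of \<open>V\<close> and are not shared between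
  paths, so such a vertex determines its path and its place on it.\<close>

lemma tail_inj:
  assumes e: "e \<in> arcs V" "f \<in> arcs V" "j < L e" "i < L f" "tail H (\<pi> e ! j) = tail H (\<pi> f ! i)"
    and j: "0 < j"
  shows "e = f \<and> i = j"
proof -
  have je: "tail H (\<pi> e ! j) \<in> set (inner_verts H (\<pi> e))" using tail_inner[OF e(1) j e(3)] by simp
  have "i > 0"
  proof (rule ccontr)
    assume "\<not> ?thesis"
    then have "tail H (\<pi> e ! j) \<in> \<phi> ` verts V"
      using e(5) tail_0[OF e(2)] wf_digraph.tail_in_verts[OF wfV e(2)] by simp
    then show False using je pi[OF e(1)] by blast
  qed
  then have ie: "tail H (\<pi> e ! j) \<in> set (inner_verts H (\<pi> f))" using tail_inner[OF e(2) _ e(4)] e(5) by simp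
  then have ef: "e = f" using je pi_disj[OF e(1,2)] by blast
  have "j - 1 = i - 1"
    using tail_inner[OF e(1) j e(3)] tail_inner[OF e(2) \<open>i > 0\<close> e(4)] e(5) pi[OF e(1)] ef
    by (metis nth_eq_iff_index_eq)
  then show ?thesis using ef j \<open>i > 0\<close> by simp
qed

lemma oaA: "q < n \<Longrightarrow> oa q \<in> arcs V"
  using V.oa_arc by simp

sublocale blocks "\<lambda>q. L (oa q)" n
  using L_pos oaA V.N_pos by unfold_locales auto

definition "N = off n"
definition "oa' x = \<pi> (oa (blk x)) ! (x - off (blk x))"
definition "os' x = tail H (oa' x)"

text \<open>The arc of \<open>V\<close> on whose path the inner vertex \<open>v\<close> lies, with
  the index of the arc leaving \<open>v\<close>; unique by \<open>tail_inj\<close>.\<close>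

definition "place v = (SOME ej. fst ej \<in> arcs V \<and> 0 < snd ej \<and> snd ej < L (fst ej) \<and> v = tail H (\<pi> (fst ej) ! snd ej))"

text \<open>Inside the path of a chord, the position is that of the end of the chord. The value 0 is
  a default for arguments that are neither on \<open>O\<close> nor inside a path.\<close>

definition "\<tau> v = (if v \<in> os' ` {..<N} then inv_into {..<N} os' v
   else if \<exists>e j. e \<in> arcs V \<and> 0 < j \<and> j < L e \<and> v = tail H (\<pi> e ! j)
   then off (\<tau>V (head V (fst (place v)))) else 0)"

definition "rk v = L (fst (place v)) - snd (place v)"

lemma place_eq: "e \<in> arcs V \<Longrightarrow> 0 < j \<Longrightarrow> j < L e \<Longrightarrow> place (tail H (\<pi> e ! j)) = (e, j)"
  unfolding place_def
proof (rule some_equality)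
  fix ej assume e: "e \<in> arcs V" "0 < j" "j < L e"
    and *: "fst ej \<in> arcs V \<and> 0 < snd ej \<and> snd ej < L (fst ej) \<and> tail H (\<pi> e ! j) = tail H (\<pi> (fst ej) ! snd ej)"
  then show "ej = (e, j)" using tail_inj[of e "fst ej" j "snd ej"] by (cases ej) auto
qed auto

lemma oa'_off: "j < L (oa q) \<Longrightarrow> oa' (off q + j) = \<pi> (oa q) ! j"
  by (simp add: oa'_def)

lemma off_N: "q < n \<Longrightarrow> j < L (oa q) \<Longrightarrow> off q + j < N"
  unfolding N_def by (simp add: off_less_iff)

lemma x_ex: "x < N \<Longrightarrow> \<exists>q<n. \<exists>j<L (oa q). x = off q + j"
  unfolding N_def by (rule blk_ex)

lemma N_pos: "0 < N"
  using off_N[of 0 0] V.N_pos L_pos[OF oaA] by simp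

lemma os'_off: "q < n \<Longrightarrow> os' (off q) = \<phi> (ov q)"
  using oa'_off[of 0 q] L_pos[OF oaA, of q] tail_0[OF oaA, of q] V.oa_arc[of q] by (simp add: os'_def)

lemma os'_inj: "inj_on os' {..<N}"
proof (rule inj_onI)
  fix x y assume "x \<in> {..<N}" "y \<in> {..<N}" and eq: "os' x = os' y"
  then have "x < N" "y < N" by simp_all
  then obtain q j q' j' where q: "q < n" "j < L (oa q)" "x = off q + j"
    "q' < n" "j' < L (oa q')" "y = off q' + j'" using x_ex by metis
  have e: "tail H (\<pi> (oa q) ! j) = tail H (\<pi> (oa q') ! j')" using eq q by (simp add: os'_def oa'_off)
  show "x = y"
  proof (cases "0 < j \<or> 0 < j'")
    case True
    then have "oa q = oa q' \<and> j = j'"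
      using tail_inj[OF oaA oaA q(2,5) e] tail_inj[OF oaA oaA q(5,2) e[symmetric]] q by auto
    then show ?thesis using V.OA_eq q by auto
  next
    case False
    then have "\<phi> (ov q) = \<phi> (ov q')" using e q tail_0[OF oaA] V.oa_arc by simp
    then have "ov q = ov q'" using inj_onD[OF phi] ov q by blast
    then have "q = q'" using inj_onD[OF V.os_inj] q by blast
    then show ?thesis using False q by simp
  qed
qed

lemma tau_os': "x < N \<Longrightarrow> \<tau> (os' x) = x"
  using os'_inj by (simp add: \<tau>_def)

lemma phi_os': "v \<in> verts V \<Longrightarrow> \<phi> v = os' (off (\<tau>V v)) \<and> off (\<tau>V v) < N"
proof -
  assume v: "v \<in> verts V"
  then have "ov (\<tau>V v) = v" using V.O_tau ov by simp
  then show ?thesis using os'_off[OF V.tau_less, of v] off_N[OF V.tau_less, of 0 v] L_pos[OF oaA[OF V.tau_less]]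
    by simp
qed

lemma tau_phi: "v \<in> verts V \<Longrightarrow> \<tau> (\<phi> v) = off (\<tau>V v)"
  using phi_os' tau_os' by metis

lemma arc_ex: "f \<in> arcs H \<Longrightarrow> \<exists>e\<in>arcs V. \<exists>j<L e. f = \<pi> e ! j"
  unfolding arcsH by (auto simp: in_set_conv_nth)

lemma arc_in: "e \<in> arcs V \<Longrightarrow> j < L e \<Longrightarrow> \<pi> e ! j \<in> arcs H"
  unfolding arcsH by (metis UN_I nth_mem)

lemma oa'_iff: "e \<in> arcs V \<Longrightarrow> j < L e \<Longrightarrow> \<pi> e ! j \<in> oa' ` {..<N} \<longleftrightarrow> e \<in> oa ` {..<n}"
proof
  assume e: "e \<in> arcs V" "j < L e" and "\<pi> e ! j \<in> oa' ` {..<N}"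
  then obtain x where x: "x < N" "\<pi> e ! j = oa' x" by auto
  then obtain q i where q: "q < n" "i < L (oa q)" "x = off q + i" using x_ex by blast
  then have "\<pi> e ! j = \<pi> (oa q) ! i" using x oa'_off by simp
  then have "set (\<pi> e) \<inter> set (\<pi> (oa q)) \<noteq> {}" using e(2) q(2) by (metis disjoint_iff nth_mem)
  then have "e = oa q" using pi_disj[OF e(1) oaA[OF q(1)]] by blast
  then show "e \<in> oa ` {..<n}" using q by blast
next
  assume e: "e \<in> arcs V" "j < L e" and "e \<in> oa ` {..<n}"
  then obtain q where q: "q < n" "e = oa q" by auto
  then have "oa' (off q + j) = \<pi> e ! j" "off q + j < N" using e oa'_off off_N by auto
  then show "\<pi> e ! j \<in> oa' ` {..<N}" by (metis imageI lessThan_iff)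
qed

lemma tail_off_O: 
  assumes e: "e \<in> arcs V" "j < L e"
  shows "tail H (\<pi> e ! j) \<notin> os' ` {..<N} \<longleftrightarrow> 0 < j \<and> e \<notin> oa ` {..<n}"
proof
  assume no: "tail H (\<pi> e ! j) \<notin> os' ` {..<N}"
  have "tail V e \<in> verts V" using wf_digraph.tail_in_verts[OF wfV e(1)] .
  then have "0 < j" using no tail_0[OF e(1)] phi_os' by (cases j) auto
  moreover have "e \<notin> oa ` {..<n}"
  proof
    assume "e \<in> oa ` {..<n}"
    then obtain q where "q < n" "e = oa q" by auto
    then have "os' (off q + j) = tail H (\<pi> e ! j)" "off q + j < N" using e oa'_off off_N by (auto simp: os'_def)
    then show False using no by (metis imageI lessThan_iff)
  qed
  ultimately show "0 < j \<and> e \<notin> oa ` {..<n}" by simp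
next
  assume j: "0 < j \<and> e \<notin> oa ` {..<n}"
  show "tail H (\<pi> e ! j) \<notin> os' ` {..<N}"
  proof
    assume "tail H (\<pi> e ! j) \<in> os' ` {..<N}"
    then obtain x where x: "x < N" "tail H (\<pi> e ! j) = os' x" by auto
    then obtain q i where q: "q < n" "i < L (oa q)" "x = off q + i" using x_ex by blast
    then have "tail H (\<pi> e ! j) = tail H (\<pi> (oa q) ! i)" using x oa'_off by (simp add: os'_def)
    then have "e = oa q" using tail_inj[OF e(1) oaA e(2) q(2)] q j by blast
    then show False using j q by blast
  qed
qed

lemma tau_inner: "e \<in> arcs V \<Longrightarrow> e \<notin> oa ` {..<n} \<Longrightarrow> 0 < j \<Longrightarrow> j < L e \<Longrightarrow>
   \<tau> (tail H (\<pi> e ! j)) = off (\<tau>V (head V e)) \<and> rk (tail H (\<pi> e ! j)) = L e - j"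
  using tail_off_O[of e j] place_eq[of e j] by (auto simp: \<tau>_def rk_def)

lemma head_V: "e \<in> arcs V \<Longrightarrow> head V e \<in> verts V" and tail_V: "e \<in> arcs V \<Longrightarrow> tail V e \<in> verts V"
  using wfV by (auto simp: wf_digraph_def)

lemma tau_head: "e \<in> arcs V \<Longrightarrow> e \<notin> oa ` {..<n} \<Longrightarrow> j < L e \<Longrightarrow> \<tau> (head H (\<pi> e ! j)) = off (\<tau>V (head V e))"
  using head_nth[of e j] tau_inner[of e "Suc j"] tau_phi[OF head_V] by auto

lemma off_strict: "q < n \<Longrightarrow> off q < off q' \<longleftrightarrow> q < q'"
  using off_less_iff[of 0 q q'] L_pos[OF oaA, of q] by simp

lemma off_le: "q < n \<Longrightarrow> off q' \<le> off q \<longleftrightarrow> q' \<le> q"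
  using off_le_iff[of 0 q q'] L_pos[OF oaA, of q] by simp

text \<open>An arc leaving \<open>O\<close> off \<open>O\<close> is the first arc of a subdivided
  chord, so exits sit at the positions \<open>off q\<close> of vertices of \<open>V\<close>.\<close>

lemma exitD:
  assumes "f \<in> arcs H" "f \<notin> oa' ` {..<N}" "tail H f = os' x" "x < N"
  obtains e where "e \<in> arcs V" "e \<notin> oa ` {..<n}" "f = \<pi> e ! 0" "tail V e = ov (\<tau>V (tail V e))"
    "x = off (\<tau>V (tail V e))"
proof -
  obtain e j where e: "e \<in> arcs V" "j < L e" "f = \<pi> e ! j" using arc_ex assms by blast
  have no: "e \<notin> oa ` {..<n}" using oa'_iff e assms by blast
  have "tail H f \<in> os' ` {..<N}" using assms(3,4) by auto
  then have "j = 0" using tail_off_O[OF e(1,2)] no e(3) by auto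
  then have "tail H f = \<phi> (tail V e)" using e tail_0 by simp
  then have "os' x = os' (off (\<tau>V (tail V e)))" using phi_os'[OF tail_V[OF e(1)]] assms by simp
  then have "x = off (\<tau>V (tail V e))" using tau_os'[OF assms(4)] tau_os' phi_os'[OF tail_V[OF e(1)]] by metis
  moreover have "tail V e = ov (\<tau>V (tail V e))" using V.O_tau ov tail_V[OF e(1)] by simp
  ultimately show ?thesis using that[of e] e no \<open>j = 0\<close> by simp
qed

lemma entryD:
  assumes "f \<in> arcs H" "f \<notin> oa' ` {..<N}" "head H f = os' y" "y < N"
  obtains e where "e \<in> arcs V" "e \<notin> oa ` {..<n}" "head V e = ov (\<tau>V (head V e))"
    "y = off (\<tau>V (head V e))"
proof -
  obtain e j where e: "e \<in> arcs V" "j < L e" "f = \<pi> e ! j" using arc_ex assms by blast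
  have no: "e \<notin> oa ` {..<n}" using oa'_iff e assms by blast
  have "y = off (\<tau>V (head V e))" using tau_head[OF e(1) no e(2)] e(3) assms(3) tau_os'[OF assms(4)] by simp
  moreover have "head V e = ov (\<tau>V (head V e))" using V.O_tau ov head_V[OF e(1)] by simp
  ultimately show ?thesis using that[of e] e no by simp
qed

text \<open>A mark moves to the first arc of the path replacing the marked arc. Then exits, entries
  and marks all have positions of the form \<open>off q\<close>, and \<open>off\<close> is strictly
  increasing, so counts of passed marks and the order within segments carry over from
  \<open>V\<close>.\<close>

lemma chorded_subdivision: "chorded (tail H) (head H) (arcs H) N os' oa' \<tau> rk (off ` M) k"
proof
  show "inj_on os' {..<N}" by (rule os'_inj)
  show "x < N \<Longrightarrow> \<tau> (os' x) = x" for x by (rule tau_os')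
  show "\<tau> v < N" for v
  proof -
    have "off (\<tau>V w) < N" for w
      using off_N[OF V.tau_less, of 0 w] L_pos[OF oaA[OF V.tau_less]] by simp
    then show ?thesis unfolding \<tau>_def using inv_into_into[of v os' "{..<N}"] N_pos by auto
  qed
  show "oa' x \<in> arcs H \<and> tail H (oa' x) = os' x \<and> head H (oa' x) = os' (Suc x mod N)" if "x < N" for x
  proof -
    obtain q j where q: "q < n" "j < L (oa q)" "x = off q + j" using x_ex \<open>x < N\<close> by blast
    have "head H (oa' x) = os' (Suc x mod N)"
    proof (cases "Suc j < L (oa q)")
      case True
      then have "Suc x mod N = off q + Suc j" using Suc_off_mod[OF q(1,2)] q by (simp add: N_def)
      then show ?thesis using head_nth[OF oaA[OF q(1)] q(2)] True oa'_off[OF True] oa'_off[OF q(2)] q(3)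
        by (simp add: os'_def)
    next
      case False
      then have "Suc x mod N = off (Suc q mod n)" using Suc_off_mod[OF q(1,2)] q by (simp add: N_def)
      moreover have "Suc j = L (oa q)" using False q by simp
      moreover have "Suc q mod n < n" using V.N_pos by simp
      ultimately show ?thesis using head_nth[OF oaA[OF q(1)] q(2)] oa'_off[OF q(2)] q(3) V.oa_arc[OF q(1)] os'_off
        by simp
    qed
    then show ?thesis using arc_in[OF oaA[OF q(1)] q(2)] oa'_off[OF q(2)] q(3) by (simp add: os'_def)
  qed
  have offO: "\<exists>e j. e \<in> arcs V \<and> e \<notin> oa ` {..<n} \<and> 0 < j \<and> j < L e \<and> f = \<pi> e ! j"
    if f: "f \<in> arcs H" "tail H f \<notin> os' ` {..<N}" for f
    using arc_ex[OF f(1)] tail_off_O f(2) by metis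
  show "\<tau> (head H f) = \<tau> (tail H f)" if f: "f \<in> arcs H" "tail H f \<notin> os' ` {..<N}" for f
    using offO[OF f] tau_head tau_inner by metis
  have phiO: "\<phi> v \<in> os' ` {..<N}" if "v \<in> verts V" for v using phi_os'[OF that] by auto
  show "rk (head H f) < rk (tail H f)"
    if f: "f \<in> arcs H" "tail H f \<notin> os' ` {..<N}" "head H f \<notin> os' ` {..<N}" for f
  proof -
    obtain e j where e: "e \<in> arcs V" "e \<notin> oa ` {..<n}" "0 < j" "j < L e" "f = \<pi> e ! j"
      using offO[OF f(1,2)] by blast
    have "Suc j \<noteq> L e" using head_nth[OF e(1,4)] f(3) e(5) phiO[OF head_V[OF e(1)]] by auto
    then show ?thesis using head_nth[OF e(1,4)] tau_inner[OF e(1,2), of "Suc j"] tau_inner[OF e(1,2,3,4)] e by simp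
  qed
  show "e = f" if ef: "e \<in> arcs H" "f \<in> arcs H" "tail H e = tail H f" "tail H e \<notin> os' ` {..<N}" for e f
  proof -
    obtain e0 j where e: "e0 \<in> arcs V" "0 < j" "j < L e0" "e = \<pi> e0 ! j" using offO[OF ef(1,4)] by blast
    obtain f0 i where f: "f0 \<in> arcs V" "i < L f0" "f = \<pi> f0 ! i" using arc_ex[OF ef(2)] by blast
    show ?thesis using tail_inj[OF e(1) f(1) e(3) f(2) _ e(2)] ef(3) e f by simp
  qed
  show "e = f" if ef: "e \<in> arcs H" "f \<in> arcs H" "head H e = head H f" "head H e \<notin> os' ` {..<N}" for e f
  proof -
    obtain e0 j where e: "e0 \<in> arcs V" "j < L e0" "e = \<pi> e0 ! j" using arc_ex[OF ef(1)] by blast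
    obtain f0 i where f: "f0 \<in> arcs V" "i < L f0" "f = \<pi> f0 ! i" using arc_ex[OF ef(2)] by blast
    have "Suc j \<noteq> L e0"
    proof
      assume "Suc j = L e0"
      then have "head H e = \<phi> (head V e0)" using head_nth[OF e(1,2)] e(3) by simp
      then show False using ef(4) phiO[OF head_V[OF e(1)]] by simp
    qed
    moreover have "Suc i \<noteq> L f0"
    proof
      assume "Suc i = L f0"
      then have "head H f = \<phi> (head V f0)" using head_nth[OF f(1,2)] f(3) by simp
      then show False using ef(3,4) phiO[OF head_V[OF f(1)]] by simp
    qed
    ultimately show ?thesis
      using tail_inj[OF e(1) f(1), of "Suc j" "Suc i"] head_nth[OF e(1,2)] head_nth[OF f(1,2)] ef(3) e f by simp
  qed
  show "off ` M \<subseteq> {..<N}"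
    using V.M_sub off_N[of _ 0] L_pos[OF oaA] by (auto simp: subset_iff)
  have inj: "inj_on off M"
  proof (rule inj_onI)
    fix q q' assume "q \<in> M" "q' \<in> M" "off q = off q'"
    moreover then have "q < n" "q' < n" using V.M_sub by auto
    ultimately show "q = q'" using off_le[of q q'] off_le[of q' q] by simp
  qed
  show "card (off ` M) = 2 * k - 1" using card_image[OF inj] V.M_card by simp
  show "2 \<le> k" by (rule V.k_ge)
  show "card {q \<in> off ` M. civ (\<tau> (tail H f)) (\<tau> (head H f)) q} = k"
    if f: "f \<in> arcs H" "tail H f \<in> os' ` {..<N}" "f \<notin> oa' ` {..<N}" for f
  proof -
    obtain x where x: "x < N" "tail H f = os' x" using f(2) by auto
    obtain e where e: "e \<in> arcs V" "e \<notin> oa ` {..<n}" "f = \<pi> e ! 0" "tail V e = ov (\<tau>V (tail V e))"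
      "x = off (\<tau>V (tail V e))" using exitD[OF f(1,3) x(2,1)] .
    have t: "\<tau> (tail H f) = off (\<tau>V (tail V e))" using x e tau_os' by simp
    have h: "\<tau> (head H f) = off (\<tau>V (head V e))" using tau_head[OF e(1,2), of 0] L_pos[OF e(1)] e by simp
    have "civ (off a) (off b) (off q) \<longleftrightarrow> civ a b q" if "a < n" "b < n" "q < n" for a b q
      unfolding civ_def using off_le off_strict that by simp
    then have "{q \<in> off ` M. civ (\<tau> (tail H f)) (\<tau> (head H f)) q} =
      off ` {q \<in> M. civ (\<tau>V (tail V e)) (\<tau>V (head V e)) q}"
      unfolding t h using V.M_sub V.tau_less by (auto simp: subset_iff)
    moreover have "inj_on off {q \<in> M. civ (\<tau>V (tail V e)) (\<tau>V (head V e)) q}"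
      by (rule inj_on_subset[OF inj]) auto
    moreover have "tail V e \<in> ov ` {..<n}" using tail_V[OF e(1)] ov by simp
    ultimately show ?thesis using V.long_cov[OF e(1) _ e(2)] by (simp add: card_image)
  qed
  show "\<exists>m\<in>off ` M. x \<le> m \<and> m < y"
    if e: "e \<in> arcs H" "f \<in> arcs H" "e \<notin> oa' ` {..<N}" "f \<notin> oa' ` {..<N}"
      and xy: "tail H e = os' x" "head H f = os' y" "x < y" "y < N" for e f x y
  proof -
    have "x < N" using xy by simp
    obtain e0 where e0: "e0 \<in> arcs V" "e0 \<notin> oa ` {..<n}" "tail V e0 = ov (\<tau>V (tail V e0))"
      "x = off (\<tau>V (tail V e0))" using exitD[OF e(1,3) xy(1) \<open>x < N\<close>] by blast
    obtain f0 where f0: "f0 \<in> arcs V" "f0 \<notin> oa ` {..<n}" "head V f0 = ov (\<tau>V (head V f0))"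
      "y = off (\<tau>V (head V f0))" using entryD[OF e(2,4) xy(2,4)] .
    have "\<tau>V (tail V e0) < \<tau>V (head V f0)" using off_strict[OF V.tau_less] xy(3) e0(4) f0(4) by simp
    then obtain m where m: "m \<in> M" "\<tau>V (tail V e0) \<le> m" "m < \<tau>V (head V f0)"
      using V.entry_after_exit[OF e0(1) f0(1) e0(2) f0(2) e0(3) f0(3) _ V.tau_less] by blast
    then have "m < n" using V.M_sub by auto
    then show ?thesis using m off_le off_strict e0(4) f0(4) by blast
  qed
  show "\<exists>y\<le>x. (\<exists>f\<in>arcs H. f \<notin> oa' ` {..<N} \<and> head H f = os' y) \<and> \<not> (\<exists>m\<in>off ` M. y \<le> m \<and> m < x)"
    if e: "e \<in> arcs H" "e \<notin> oa' ` {..<N}" and x: "tail H e = os' x" "x < N" for e x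
  proof -
    obtain e0 where e0: "e0 \<in> arcs V" "e0 \<notin> oa ` {..<n}" "tail V e0 = ov (\<tau>V (tail V e0))"
      "x = off (\<tau>V (tail V e0))" using exitD[OF e x] by blast
    obtain y f where y: "y \<le> \<tau>V (tail V e0)" "f \<in> arcs V" "f \<notin> oa ` {..<n}" "head V f = ov y"
      "\<not> (\<exists>m\<in>M. y \<le> m \<and> m < \<tau>V (tail V e0))"
      using V.entry_before_exit[OF e0(1,2,3) V.tau_less] by blast
    have yn: "y < n" using y(1) V.tau_less[of "tail V e0"] by simp
    let ?f = "\<pi> f ! (L f - 1)"
    have Lf: "L f - 1 < L f" "Suc (L f - 1) = L f" using L_pos[OF y(2)] by auto
    have "?f \<in> arcs H" "?f \<notin> oa' ` {..<N}" using arc_in[OF y(2) Lf(1)] oa'_iff[OF y(2) Lf(1)] y(3) by auto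
    moreover have "head H ?f = os' (off y)" using head_nth[OF y(2) Lf(1)] Lf(2) y(4) os'_off[OF yn] by simp
    moreover have "off y \<le> x" using off_mono[OF y(1)] e0(4) by simp
    moreover have "\<not> (\<exists>m\<in>off ` M. off y \<le> m \<and> m < x)"
    proof
      assume "\<exists>m\<in>off ` M. off y \<le> m \<and> m < x"
      then obtain m where m: "m \<in> M" "off y \<le> off m" "off m < x" by auto
      then have "m < n" using V.M_sub by auto
      then have "y \<le> m" "m < \<tau>V (tail V e0)" using m off_le off_strict e0(4) by auto
      then show False using y(5) m(1) by blast
    qed
    ultimately show ?thesis by blast
  qed
  show "\<exists>x\<le>m. (\<exists>e\<in>arcs H. e \<notin> oa' ` {..<N} \<and> tail H e = os' x) \<and> \<not> (\<exists>m'\<in>off ` M. x \<le> m' \<and> m' < m)"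
    if m: "m \<in> off ` M" for m
  proof -
    obtain m0 where m0: "m0 \<in> M" "m = off m0" using m by auto
    obtain x e where x: "x \<le> m0" "e \<in> arcs V" "e \<notin> oa ` {..<n}" "tail V e = ov x"
      "\<not> (\<exists>m'\<in>M. x \<le> m' \<and> m' < m0)" using V.exit_before_mark[OF m0(1)] by blast
    have m0n: "m0 < n" using m0 V.M_sub by auto
    then have xn: "x < n" using x(1) by simp
    let ?f = "\<pi> e ! 0"
    have "?f \<in> arcs H" "?f \<notin> oa' ` {..<N}" using arc_in[OF x(2) L_pos] oa'_iff[OF x(2) L_pos] x(2,3) by auto
    moreover have "tail H ?f = os' (off x)" using tail_0[OF x(2)] x(4) os'_off[OF xn] by simp
    moreover have "off x \<le> m" using off_mono[OF x(1)] m0 by simp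
    moreover have "\<not> (\<exists>m'\<in>off ` M. off x \<le> m' \<and> m' < m)"
    proof
      assume "\<exists>m'\<in>off ` M. off x \<le> m' \<and> m' < m"
      then obtain m' where m': "m' \<in> M" "off x \<le> off m'" "off m' < m" by auto
      then have "m' < n" using V.M_sub by auto
      then have "x \<le> m'" "m' < m0" using m' off_le off_strict m0(2) by auto
      then show False using x(5) m'(1) by blast
    qed
    ultimately show ?thesis by blast
  qed
  show "\<exists>m\<in>off ` M. y \<le> m" if f: "f \<in> arcs H" "f \<notin> oa' ` {..<N}" "head H f = os' y" "y < N" for f y
  proof -
    obtain e where e: "e \<in> arcs V" "e \<notin> oa ` {..<n}" "head V e = ov (\<tau>V (head V e))"
      "y = off (\<tau>V (head V e))" using entryD[OF f] .
    obtain m where "m \<in> M" "\<tau>V (head V e) \<le> m" using V.mark_after_entry[OF e(1,2,3) V.tau_less] by blast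
    then show ?thesis using off_mono e(4) by blast
  qed
  show "\<exists>m\<in>off ` M. x \<le> m" if f: "f \<in> arcs H" "f \<notin> oa' ` {..<N}" "tail H f = os' x" "x < N" for f x
  proof -
    obtain e where e: "e \<in> arcs V" "e \<notin> oa ` {..<n}" "tail V e = ov (\<tau>V (tail V e))"
      "x = off (\<tau>V (tail V e))" using exitD[OF f] by blast
    obtain m where "m \<in> M" "\<tau>V (tail V e) \<le> m" using V.mark_after_exit[OF e(1,2,3) V.tau_less] by blast
    then show ?thesis using off_mono e(4) by blast
  qed
qed

end

lemma subdivided_vault_chorded:
  assumes "vault V" "subdivision_of H V"
  shows "\<exists>N os oa \<tau> rk M k. chorded (tail H) (head H) (arcs H) N os oa \<tau> rk M k"
proof -
  obtain n ov oa \<tau>V M k where ch: "chorded (tail V) (head V) (arcs V) n ov oa \<tau>V (\<lambda>_. 0) M k"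
    and ov: "ov ` {..<n} = verts V"
    using vault_chorded[OF assms(1)] by blast
  obtain \<phi> \<pi> where *: "wf_digraph H" "wf_digraph V" "inj_on \<phi> (verts V)"
    "\<forall>e\<in>arcs V. pre_digraph.awalk H (\<phi> (tail V e)) (\<pi> e) (\<phi> (head V e)) \<and> \<pi> e \<noteq> [] \<and>
          distinct (inner_verts H (\<pi> e)) \<and> set (inner_verts H (\<pi> e)) \<inter> \<phi> ` verts V = {}"
    "\<forall>e \<in> arcs V. \<forall>f \<in> arcs V. e \<noteq> f \<longrightarrow> set (\<pi> e) \<inter> set (\<pi> f) = {} \<and>
          set (inner_verts H (\<pi> e)) \<inter> set (inner_verts H (\<pi> f)) = {}"
    "arcs H = (\<Union>e \<in> arcs V. set (\<pi> e))"
    using assms(2) unfolding subdivision_of_def by (elim conjE exE) (rule that; assumption)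
  interpret subdivided V n ov oa \<tau>V M k H \<phi> \<pi>
  proof (rule subdivided.intro[OF ch], rule subdivided_axioms.intro)
    show "ov ` {..<n} = verts V" by (rule ov)
    show "wf_digraph H" "wf_digraph V" "inj_on \<phi> (verts V)" "arcs H = (\<Union>e \<in> arcs V. set (\<pi> e))" by (fact *)+
    show "pre_digraph.awalk H (\<phi> (tail V e)) (\<pi> e) (\<phi> (head V e)) \<and> \<pi> e \<noteq> [] \<and>
          distinct (inner_verts H (\<pi> e)) \<and> set (inner_verts H (\<pi> e)) \<inter> \<phi> ` verts V = {}" if "e \<in> arcs V" for e
      using *(4) that by blast
    show "set (\<pi> e) \<inter> set (\<pi> f) = {} \<and> set (inner_verts H (\<pi> e)) \<inter> set (inner_verts H (\<pi> f)) = {}"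
      if "e \<in> arcs V" "f \<in> arcs V" "e \<noteq> f" for e f using *(5) that by blast
  qed
  show ?thesis using chorded_subdivision by blast
qed

section \<open>Shortest paths\<close>

type_synonym rec = "nat \<times> nat \<times> nat"

abbreviation rid :: "rec \<Rightarrow> nat" where "rid a \<equiv> fst a"
abbreviation rtl :: "rec \<Rightarrow> nat" where "rtl a \<equiv> fst (snd a)"
abbreviation rhd :: "rec \<Rightarrow> nat" where "rhd a \<equiv> snd (snd a)"

lemma walk_lists: "walk t h A u W v \<Longrightarrow> u # map h W = map t W @ [v]"
  by (induction W arbitrary: u) auto

definition cost :: "nat list \<Rightarrow> rec list \<Rightarrow> nat" where
  "cost Z p = length (filter (\<lambda>a. rhd a \<in> set Z) p)"

lemma cost_simps [simp]: "cost Z [] = 0" "cost Z (a # p) = of_bool (rhd a \<in> set Z) + cost Z p"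
  "cost Z (p @ q) = cost Z p + cost Z q" "cost Z (rev p) = cost Z p" "cost [] p = 0"
  by (auto simp: cost_def rev_filter[symmetric])

text \<open>Bellman-Ford: a table maps vertices to reversed walks; newer entries come first.\<close>

definition upd :: "nat list \<Rightarrow> rec \<Rightarrow> (nat \<times> rec list) list \<Rightarrow> (nat \<times> rec list) list" where
  "upd Z a T = (case map_of T (rtl a) of None \<Rightarrow> T | Some p \<Rightarrow>
     (case map_of T (rhd a) of None \<Rightarrow> (rhd a, a # p) # T
      | Some q \<Rightarrow> if cost Z (a # p) < cost Z q then (rhd a, a # p) # T else T))"

definition relax :: "nat list \<Rightarrow> rec list \<Rightarrow> (nat \<times> rec list) list \<Rightarrow> (nat \<times> rec list) list" where
  "relax Z A T = fold (upd Z) A T"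

definition rounds :: "nat list \<Rightarrow> nat list \<Rightarrow> rec list \<Rightarrow> (nat \<times> rec list) list \<Rightarrow> (nat \<times> rec list) list" where
  "rounds L Z A T = fold (\<lambda>_. relax Z A) L T"

definition bf :: "nat \<Rightarrow> rec list \<Rightarrow> nat list \<Rightarrow> nat list \<Rightarrow> (nat \<times> rec list) list" where
  "bf u A Z L = rounds L Z A [(u, [])]"

lemma upd_walk:
  assumes "\<And>v p. (v, p) \<in> set T \<Longrightarrow> walk rtl rhd S u (rev p) v" "a \<in> S" "(v, p) \<in> set (upd Z a T)"
  shows "walk rtl rhd S u (rev p) v"
  using assms by (auto simp: upd_def walk_append dest!: map_of_SomeD split: option.splits if_splits)

lemma relax_walk:
  assumes "set A \<subseteq> S" "\<And>v p. (v, p) \<in> set T \<Longrightarrow> walk rtl rhd S u (rev p) v" "(v, p) \<in> set (relax Z A T)"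
  shows "walk rtl rhd S u (rev p) v"
  using assms unfolding relax_def
proof (induction A arbitrary: T v p)
  case (Cons a A)
  show ?case
    by (rule Cons.IH[of "upd Z a T"]) (use Cons.prems upd_walk[of T S u a] in auto)
qed simp

lemma rounds_walk:
  assumes "\<And>v p. (v, p) \<in> set T \<Longrightarrow> walk rtl rhd (set A) u (rev p) v" "(v, p) \<in> set (rounds L Z A T)"
  shows "walk rtl rhd (set A) u (rev p) v"
  using assms unfolding rounds_def
proof (induction L arbitrary: T v p)
  case (Cons x L)
  show ?case
    by (rule Cons.IH[of "relax Z A T"]) (use Cons.prems relax_walk[of A "set A" T u] in auto)
qed simp

lemma bf_walk: "map_of (bf u A Z L) v = Some p \<Longrightarrow> walk rtl rhd (set A) u (rev p) v"
  unfolding bf_def by (rule rounds_walk[of "[(u, [])]"]) (auto dest: map_of_SomeD)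

definition improves :: "nat list \<Rightarrow> (nat \<times> rec list) list \<Rightarrow> (nat \<times> rec list) list \<Rightarrow> bool" where
  "improves Z T T' \<longleftrightarrow> (\<forall>v q. map_of T v = Some q \<longrightarrow> (\<exists>q'. map_of T' v = Some q' \<and> cost Z q' \<le> cost Z q))"

lemma improves_refl: "improves Z T T" and improves_trans: "improves Z T T' \<Longrightarrow> improves Z T' T'' \<Longrightarrow> improves Z T T''"
  unfolding improves_def by (auto, meson le_trans)

lemma improves_upd: "improves Z T (upd Z a T)"
  by (auto simp: improves_def upd_def split: option.splits)

lemma improves_relax: "improves Z T (relax Z A T)"
  unfolding relax_def by (induction A arbitrary: T) (auto intro: improves_refl improves_trans[OF improves_upd])

lemma upd_arc: "map_of T (rtl a) = Some p \<Longrightarrow>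
  \<exists>q. map_of (upd Z a T) (rhd a) = Some q \<and> cost Z q \<le> cost Z (a # p)"
  by (auto simp: upd_def split: option.splits)

text \<open>A pass over \<open>A\<close> considers \<open>a\<close> at some point; the entry for its
  tail can only have improved before, and the entry for its head can only improve
  afterwards.\<close>

lemma relax_arc:
  assumes "map_of T (rtl a) = Some p" "a \<in> set A"
  shows "\<exists>q. map_of (relax Z A T) (rhd a) = Some q \<and> cost Z q \<le> cost Z (a # p)"
proof -
  obtain A1 A2 where A: "A = A1 @ a # A2" using split_list assms(2) by metis
  let ?T1 = "relax Z A1 T"
  obtain p' where p': "map_of ?T1 (rtl a) = Some p'" "cost Z p' \<le> cost Z p"
    using improves_relax[of Z T A1] assms(1) unfolding improves_def by blast
  obtain q where q: "map_of (upd Z a ?T1) (rhd a) = Some q" "cost Z q \<le> cost Z (a # p')"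
    using upd_arc[OF p'(1)] by blast
  obtain q' where "map_of (relax Z A2 (upd Z a ?T1)) (rhd a) = Some q'" "cost Z q' \<le> cost Z q"
    using improves_relax[of Z "upd Z a ?T1" A2] q(1) unfolding improves_def by blast
  moreover have "relax Z A T = relax Z A2 (upd Z a ?T1)" by (simp add: A relax_def)
  ultimately show ?thesis using q p' by auto
qed

text \<open>Each round accounts for one more arc at the end of the walk. The list \<open>L\<close>
  serves as the counter of rounds.\<close>

lemma rounds_complete:
  assumes "walk rtl rhd (set A) u W v" "length W \<le> length L"
  shows "\<exists>q. map_of (rounds L Z A [(u, [])]) v = Some q \<and> cost Z q \<le> cost Z W"
  using assms
proof (induction L arbitrary: W v rule: rev_induct)
  case Nil
  then show ?case by (simp add: rounds_def)
next
  case (snoc x L)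
  let ?T = "rounds L Z A [(u, [])]"
  have r: "rounds (L @ [x]) Z A [(u, [])] = relax Z A ?T" by (simp add: rounds_def)
  show ?case
  proof (cases W rule: rev_cases)
    case Nil
    then obtain q where "map_of ?T v = Some q" "cost Z q \<le> cost Z W" using snoc.IH[OF snoc.prems(1)] by auto
    then show ?thesis using improves_relax[of Z ?T A] unfolding r improves_def by (meson le_trans)
  next
    case (snoc W' a)
    then have w: "walk rtl rhd (set A) u W' (rtl a)" "a \<in> set A" "rhd a = v"
      using snoc.prems by (auto simp: walk_append)
    obtain q where q: "map_of ?T (rtl a) = Some q" "cost Z q \<le> cost Z W'"
      using snoc.IH[OF w(1)] snoc snoc.prems by auto
    show ?thesis using relax_arc[OF q(1) w(2), of Z] q(2) w(3) unfolding r snoc by fastforce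
  qed
qed

text \<open>A walk longer than the number of available heads repeats a head, and the part between
  can be cut out. What remains is a subsequence, so no count of arcs with a given property
  increases, in particular not the cost.\<close>

lemma shorten_walk:
  assumes "walk t h S u W v" "finite V" "h ` S \<subseteq> V"
  shows "\<exists>W'. walk t h S u W' v \<and> length W' \<le> card V \<and>
    (\<forall>P. length (filter P W') \<le> length (filter P W))"
  using assms(1)
proof (induction W rule: length_induct)
  case (1 W)
  show ?case
  proof (cases "length W \<le> card V")
    case True
    then show ?thesis using 1 by blast
  next
    case False
    have "set (map h W) \<subseteq> V" using walk_set[OF 1(2)] assms(3) by auto
    then have "card (set (map h W)) \<le> card V" using assms(2) card_mono by blast
    then have "\<not> distinct (map h W)" using False distinct_card[of "map h W"] by auto
    then obtain xs y ys zs where d: "map h W = xs @ [y] @ ys @ [y] @ zs" using not_distinct_decomp by blast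
    obtain X R where R: "W = X @ R" "map h R = y # ys @ [y] @ zs"
      using d by (auto simp: map_eq_append_conv)
    obtain a R' where R': "R = a # R'" "h a = y" "map h R' = ys @ [y] @ zs" using R(2) by (cases R) auto
    obtain Y R2 where R2: "R' = Y @ R2" "map h R2 = y # zs"
      using R'(3) by (auto simp: map_eq_append_conv)
    obtain b Zs where "R2 = b # Zs" "h b = y" using R2(2) by (cases R2) auto
    then have W: "W = X @ [a] @ Y @ [b] @ Zs" "h a = h b" using R R' R2 by auto
    let ?W = "X @ [a] @ Zs"
    have w: "walk t h S u ?W v" using 1(2) W by (auto simp: walk_append)
    have "length ?W < length W" using W by simp
    then obtain W' where "walk t h S u W' v" "length W' \<le> card V"
      "\<forall>P. length (filter P W') \<le> length (filter P ?W)" using 1(1) w by blast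
    moreover have "length (filter P ?W) \<le> length (filter P W)" for P using W by simp
    ultimately show ?thesis by (meson le_trans)
  qed
qed

lemma bf_complete:
  assumes "walk rtl rhd (set A) u W v" "rhd ` set A \<subseteq> set L"
  shows "\<exists>q. map_of (bf u A Z L) v = Some q \<and> cost Z q \<le> cost Z W"
proof -
  obtain W' where W': "walk rtl rhd (set A) u W' v" "length W' \<le> card (set L)"
    "\<forall>P. length (filter P W') \<le> length (filter P W)"
    using shorten_walk[OF assms(1) _ assms(2)] by auto
  then have "length W' \<le> length L" using card_length[of L] by simp
  then obtain q where "map_of (bf u A Z L) v = Some q" "cost Z q \<le> cost Z W'"
    using rounds_complete[OF W'(1), of L] unfolding bf_def by blast
  moreover have "cost Z W' \<le> cost Z W" using W'(3) by (simp add: cost_def)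
  ultimately show ?thesis by auto
qed

text \<open>Without costs, entries are never overwritten, so all recorded walks are paths.\<close>

definition simple_table :: "(nat \<times> rec list) list \<Rightarrow> bool" where
  "simple_table T \<longleftrightarrow> (\<forall>(v, p)\<in>set T. distinct (v # map rtl p) \<and> rtl ` set p \<subseteq> fst ` set T)"

lemma simple_upd: "simple_table T \<Longrightarrow> simple_table (upd [] a T)"
proof -
  assume T: "simple_table T"
  show ?thesis
  proof (cases "\<exists>p. map_of T (rtl a) = Some p \<and> map_of T (rhd a) = None")
    case True
    then obtain p where p: "map_of T (rtl a) = Some p" "map_of T (rhd a) = None" by auto
    then have u: "upd [] a T = (rhd a, a # p) # T" by (simp add: upd_def)
    \<comment> \<open>A new entry is made only for a vertex without one, while all tails on recorded
      walks have entries; hence the extended walk repeats no vertex.\<close>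
    have n: "rhd a \<notin> fst ` set T" using p(2) by (simp add: map_of_eq_None_iff)
    have i: "(rtl a, p) \<in> set T" using p(1) by (rule map_of_SomeD)
    have "case (rtl a, p) of (v, p) \<Rightarrow> distinct (v # map rtl p) \<and> rtl ` set p \<subseteq> fst ` set T"
      using T i unfolding simple_table_def by (rule bspec)
    then have d: "distinct (rtl a # map rtl p)" "rtl ` set p \<subseteq> fst ` set T" by simp_all
    have ra: "rtl a \<in> fst ` set T" using i by force
    have "rtl a \<noteq> rhd a" using n ra by metis
    moreover have "rhd a \<notin> rtl ` set p" using d(2) n by blast
    ultimately have 1: "distinct (rhd a # map rtl (a # p))" using d(1) by simp
    have 2: "rtl ` set (a # p) \<subseteq> fst ` set T" using d(2) ra by simp
    show ?thesis unfolding u simple_table_def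
    proof
      fix x assume "x \<in> set ((rhd a, a # p) # T)"
      then consider "x = (rhd a, a # p)" | "x \<in> set T" by auto
      then show "case x of (v, q) \<Rightarrow> distinct (v # map rtl q) \<and> rtl ` set q \<subseteq> fst ` set ((rhd a, a # p) # T)"
      proof cases
        case 1
        then show ?thesis using \<open>distinct (rhd a # map rtl (a # p))\<close> 2 by (simp add: subset_insertI2)
      next
        case 2
        obtain v q where x: "x = (v, q)" by (cases x)
        have "case x of (v, p) \<Rightarrow> distinct (v # map rtl p) \<and> rtl ` set p \<subseteq> fst ` set T"
          using T 2 unfolding simple_table_def by (rule bspec)
        then show ?thesis using x by (simp add: subset_insertI2)
      qed
    qed
  next
    case False
    then have "upd [] a T = T" by (auto simp: upd_def split: option.splits)
    then show ?thesis using T by simp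
  qed
qed

lemma simple_relax: "simple_table T \<Longrightarrow> simple_table (relax [] A T)"
  unfolding relax_def by (induction A arbitrary: T) (auto intro: simple_upd)

lemma simple_rounds: "simple_table T \<Longrightarrow> simple_table (rounds L [] A T)"
  unfolding rounds_def by (induction L arbitrary: T) (auto intro: simple_relax)

lemma bf_simple: "map_of (bf u A [] L) v = Some p \<Longrightarrow> distinct (v # map rtl p)"
proof -
  assume m: "map_of (bf u A [] L) v = Some p"
  have "simple_table (bf u A [] L)" unfolding bf_def
    by (rule simple_rounds) (simp add: simple_table_def)
  then show ?thesis using map_of_SomeD[OF m] unfolding simple_table_def by fastforce
qed

section \<open>Finding cycles\<close>

definition flip :: "rec \<Rightarrow> rec" where "flip a = (rid a, rhd a, rtl a)"

text \<open>With \<open>s\<close> set, the reversed copies make directed walks into walks of the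
  underlying multigraph. Deletion is by identifier, so both copies of \<open>e\<close> go but
  parallel arcs stay.\<close>

definition other_arcs :: "nat \<Rightarrow> rec list \<Rightarrow> bool \<Rightarrow> rec list" where
  "other_arcs e A s = concat (map (\<lambda>a. if rid a = e then [] else if s then [a, flip a] else [a]) A)"

text \<open>For each arc it looks for a path from its head back to its tail that does not use the
  arc; the arc closes this path up to a cycle.\<close>

fun findcyc :: "rec list \<Rightarrow> bool \<Rightarrow> nat list \<Rightarrow> rec list \<Rightarrow> nat list option" where
  "findcyc A s L [] = None"
| "findcyc A s L (a # as) =
    (case map_of (bf (rhd a) (other_arcs (rid a) A s) [] L) (rtl a) of
       Some p \<Rightarrow> Some (map rid (rev p) @ [rid a]) | None \<Rightarrow> findcyc A s L as)"

lemma other_arcs_set: "set (other_arcs e A s) = {a \<in> set A. rid a \<noteq> e} \<union> (if s then flip ` {a \<in> set A. rid a \<noteq> e} else {})"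
  by (auto simp: other_arcs_def split: if_splits)

lemma findcyc_sound:
  "findcyc A s L as = Some c \<Longrightarrow> \<exists>a\<in>set as. \<exists>W.
     walk rtl rhd (set (other_arcs (rid a) A s)) (rhd a) W (rtl a) \<and> distinct (map rtl W @ [rtl a]) \<and>
     c = map rid W @ [rid a]"
proof (induction as)
  case (Cons a as)
  show ?case
  proof (cases "map_of (bf (rhd a) (other_arcs (rid a) A s) [] L) (rtl a)")
    case None then show ?thesis using Cons by auto
  next
    case (Some p)
    then have "walk rtl rhd (set (other_arcs (rid a) A s)) (rhd a) (rev p) (rtl a)" "distinct (rtl a # map rtl p)"
      using bf_walk bf_simple by blast+
    moreover have "c = map rid (rev p) @ [rid a]" using Cons.prems Some by simp
    ultimately show ?thesis by (intro bexI[of _ a] exI[of _ "rev p"]) (auto simp: rev_map[symmetric])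
  qed
qed simp

lemma findcyc_complete:
  assumes "a \<in> set as" "walk rtl rhd (set (other_arcs (rid a) A s)) (rhd a) W (rtl a)"
    "rtl ` set A \<subseteq> set L" "rhd ` set A \<subseteq> set L"
  shows "findcyc A s L as \<noteq> None"
  using assms(1)
proof (induction as)
  case (Cons x as)
  show ?case
  proof (cases "x = a")
    case True
    have "rhd ` set (other_arcs (rid a) A s) \<subseteq> set L" using assms(3,4) by (auto simp: other_arcs_set flip_def)
    from bf_complete[OF assms(2) this, of "[]"] show ?thesis using True by (auto split: option.splits)
  next
    case False
    then show ?thesis using Cons by (auto split: option.splits)
  qed
qed simp

section \<open>Soundness and completeness of the cycle search\<close>

definition recs :: "(nat, nat) pre_digraph \<Rightarrow> nat set \<Rightarrow> rec set" where
  "recs G F = (\<lambda>e. (e, tail G e, head G e)) ` F"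

lemma recs_iff: "a \<in> recs G F \<longleftrightarrow> rid a \<in> F \<and> rtl a = tail G (rid a) \<and> rhd a = head G (rid a)"
proof -
  obtain e u v where "a = (e, u, v)" by (metis prod_cases3)
  then show ?thesis unfolding recs_def by auto
qed

lemma walk_recs:
  "walk rtl rhd (recs G F) u W v \<Longrightarrow> walk (tail G) (head G) F u (map rid W) v \<and> map rhd W = map (head G) (map rid W)
    \<and> map rtl W = map (tail G) (map rid W)"
proof (induction W arbitrary: u)
  case (Cons a W)
  have a: "rid a \<in> F" "rtl a = tail G (rid a)" "rhd a = head G (rid a)" "rtl a = u"
    "walk rtl rhd (recs G F) (rhd a) W v"
    using Cons.prems unfolding walk.simps recs_iff by blast+
  show ?case using Cons.IH[OF a(5)] a(1-4) by (simp only: walk.simps list.map)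
qed simp

lemma recs_walk:
  "walk (tail G) (head G) F u W v \<Longrightarrow> walk rtl rhd (recs G F) u (map (\<lambda>e. (e, tail G e, head G e)) W) v"
proof (induction W arbitrary: u)
  case (Cons e W)
  then show ?case by (simp add: recs_iff)
qed simp

lemma finddicycle_sound:
  assumes G: "wf_digraph G" and A: "set A = recs G F" "F \<subseteq> arcs G"
    and c: "findcyc A False L A = Some c"
  shows "pre_digraph.cycle G c \<and> set c \<subseteq> F"
proof -
  interpret wf_digraph G by (rule G)
  obtain a W where a: "a \<in> set A" "walk rtl rhd (set (other_arcs (rid a) A False)) (rhd a) W (rtl a)"
    "distinct (map rtl W @ [rtl a])" "c = map rid W @ [rid a]"
    using findcyc_sound[OF c] by blast
  have "set (other_arcs (rid a) A False) \<subseteq> set A" by (auto simp: other_arcs_set)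
  then have w: "walk rtl rhd (recs G F) (rhd a) (W @ [a]) (rhd a)"
    using walk_mono[OF a(2)] a(1) A(1) by (auto simp: walk_append)
  note w' = walk_recs[OF w]
  have cw: "walk (tail G) (head G) F (rhd a) c (rhd a)"
    using conjunct1[OF w'] unfolding a(4) by (simp only: map_append list.map)
  have wc: "walk (tail G) (head G) F u c v \<Longrightarrow> cas u c v" for u c v
    by (induction c arbitrary: u) auto
  have cF: "set c \<subseteq> F" using walk_set[OF cw] .
  have "rhd a \<in> verts G" using a(1) A by (auto simp: recs_def)
  then have aw: "awalk (rhd a) c (rhd a)" using wc[OF cw] cF A(2) by (auto simp: awalk_def)
  have "rhd a # map rhd W = map rtl W @ [rtl a]" using walk_lists[OF a(2)] .
  then have "distinct (rhd a # map rhd W)" using a(3) by simp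
  then have "distinct (map rhd (W @ [a]))" by auto
  moreover have "map rhd (W @ [a]) = map (head G) c" using w' a(4) by simp
  moreover have "c \<noteq> []" using a(4) by simp
  then have "awalk_verts (rhd a) c = tail G (hd c) # map (head G) c"
    using awalk_verts_conv'[OF wc[OF cw]] by (simp only: if_False)
  ultimately have "distinct (tl (awalk_verts (rhd a) c))" by (simp only: list.sel)
  then show ?thesis using aw a(4) cF by (auto simp: cycle_def)
qed

lemma findug_sound:
  assumes A: "set A = recs G F" "F \<subseteq> arcs G"
    and c: "findcyc A True L A = Some c"
  shows "ug_cycle G c \<and> set c \<subseteq> F"
proof -
  obtain a W where a: "a \<in> set A" "walk rtl rhd (set (other_arcs (rid a) A True)) (rhd a) W (rtl a)"
    "distinct (map rtl W @ [rtl a])" "c = map rid W @ [rid a]"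
    using findcyc_sound[OF c] by blast
  define xs where "xs = map rtl W @ [rtl a]"
  have eq: "rhd a # map rhd W = xs" using walk_lists[OF a(2)] by (simp add: xs_def)
  have mem: "rid w \<noteq> rid a \<and> rid w \<in> F \<and> {tail G (rid w), head G (rid w)} = {rtl w, rhd w}" if "w \<in> set W" for w
    using that walk_set[OF a(2)] A(1) by (auto simp: other_arcs_set recs_def flip_def)
  have ra: "rid a \<in> F" "tail G (rid a) = rtl a" "head G (rid a) = rhd a" using a(1) A(1) by (auto simp: recs_def)
  have len: "length xs = Suc (length W)" "length c = Suc (length W)" by (auto simp: xs_def a(4))
  have dx: "distinct xs" using a(3) by (simp add: xs_def)
  have ends: "{tail G (rid (W ! i)), head G (rid (W ! i))} = {xs ! i, xs ! Suc i}" if "i < length W" for i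
  proof -
    have "rtl (W ! i) = xs ! i" using that by (simp add: xs_def nth_append)
    moreover have "rhd (W ! i) = xs ! Suc i" using that eq by (metis nth_Cons_Suc nth_map)
    ultimately show ?thesis using mem[of "W ! i"] that by simp
  qed
  \<comment> \<open>An arc and its reversed copy could both occur on \<open>W\<close>, but then two
    different pairs of consecutive vertices of \<open>xs\<close> would be equal as sets, and
    \<open>xs\<close> is distinct.\<close>
  have "distinct (map rid W)"
  proof (rule ccontr)
    assume "\<not> ?thesis"
    then obtain i j where ij: "i < length W" "j < length W" "i \<noteq> j" "rid (W ! i) = rid (W ! j)"
      by (auto simp: distinct_conv_nth)
    then have "{xs ! i, xs ! Suc i} = {xs ! j, xs ! Suc j}" using ends by metis
    then have "(xs ! i = xs ! j) \<or> (xs ! i = xs ! Suc j \<and> xs ! Suc i = xs ! j)"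
      by (auto simp: doubleton_eq_iff)
    then show False using ij nth_eq_iff_index_eq[OF dx] len by auto
  qed
  moreover have "rid a \<notin> rid ` set W" using mem by (metis imageE)
  ultimately have dc: "distinct c" by (simp add: a(4))
  have cF: "set c \<subseteq> F" using mem ra by (auto simp: a(4))
  have "{tail G (c ! i), head G (c ! i)} = {xs ! i, xs ! (Suc i mod length c)}" if i: "i < length c" for i
  proof (cases "i < length W")
    case True
    then have "c ! i = rid (W ! i)" "Suc i mod length c = Suc i" using len by (auto simp: a(4) nth_append)
    then show ?thesis using ends[OF True] by simp
  next
    case False
    then have e: "i = length W" using i len by simp
    then have "c ! i = rid a" "Suc i mod length c = 0" "xs ! i = rtl a" using len by (auto simp: a(4) xs_def nth_append)
    moreover have "xs ! 0 = rhd a" using eq by (metis nth_Cons_0)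
    ultimately show ?thesis using ra by simp
  qed
  then show ?thesis using dc cF A(2) len dx a(4) unfolding ug_cycle_def by (auto intro!: exI[of _ xs])
qed

text \<open>Any closed walk through \<open>e\<close> will do: what follows the last occurrence of
  \<open>e\<close> is a walk from the head of \<open>e\<close> to its tail that avoids
  \<open>e\<close>.\<close>

lemma finddicycle_complete:
  assumes "walk rtl rhd (set A) (rhd e) W (rtl e)" "e \<in> set A" and d: "distinct (map rid A)"
    and L: "rtl ` set A \<subseteq> set L" "rhd ` set A \<subseteq> set L"
  shows "findcyc A False L A \<noteq> None"
proof -
  have "\<exists>W'. walk rtl rhd (set A) (rhd e) W' (rtl e) \<and> e \<notin> set W'"
  proof (cases "e \<in> set W")
    case True
    then obtain W1 W2 where "W = W1 @ e # W2" "e \<notin> set W2" by (metis split_list_last)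
    then show ?thesis using assms(1) by (auto simp: walk_append)
  qed (use assms in blast)
  then obtain W' where W': "walk rtl rhd (set A) (rhd e) W' (rtl e)" "e \<notin> set W'" by auto
  have "set W' \<subseteq> set (other_arcs (rid e) A False)"
  proof
    fix w assume w: "w \<in> set W'"
    then have "w \<in> set A" "w \<noteq> e" using walk_set[OF W'(1)] W'(2) by auto
    moreover then have "rid w \<noteq> rid e" using d assms(2) by (auto simp: distinct_map inj_on_def)
    ultimately show "w \<in> set (other_arcs (rid e) A False)" by (simp add: other_arcs_set)
  qed
  then show ?thesis using findcyc_complete[OF assms(2) walk_restrict[OF W'(1)] L] by blast
qed

lemma findug_complete:
  assumes A: "set A = recs G F" and g: "g \<in> F" "(head G g, tail G g) \<in> (ugr (tail G) (head G) (F - {g}))\<^sup>*"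
    and L: "rtl ` set A \<subseteq> set L" "rhd ` set A \<subseteq> set L"
  shows "findcyc A True L A \<noteq> None"
proof -
  let ?a = "(g, tail G g, head G g)"
  have "\<exists>W. walk rtl rhd (set (other_arcs g A True)) (head G g) W v"
    if "(head G g, v) \<in> (ugr (tail G) (head G) (F - {g}))\<^sup>*" for v
    using that
  proof (induction rule: rtrancl_induct)
    case base
    then show ?case by (intro exI[of _ "[]"]) simp
  next
    case (step u v)
    then obtain W where W: "walk rtl rhd (set (other_arcs g A True)) (head G g) W u" by blast
    obtain e where e: "e \<in> F" "e \<noteq> g" "{tail G e, head G e} = {u, v}" using step(2) by (auto simp: ugr_def)
    let ?e = "(e, tail G e, head G e)"
    have "?e \<in> set (other_arcs g A True)" "flip ?e \<in> set (other_arcs g A True)"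
      unfolding other_arcs_set A recs_def using e(1,2) by auto
    moreover have "(tail G e = u \<and> head G e = v) \<or> (head G e = u \<and> tail G e = v)"
      using e(3) by (auto simp: doubleton_eq_iff)
    ultimately have "walk rtl rhd (set (other_arcs g A True)) (head G g) (W @ [?e]) v \<or>
        walk rtl rhd (set (other_arcs g A True)) (head G g) (W @ [flip ?e]) v"
      using W by (auto simp: walk_append flip_def)
    then show ?case by blast
  qed
  then obtain W where "walk rtl rhd (set (other_arcs (rid ?a) A True)) (rhd ?a) W (rtl ?a)" using g(2) by auto
  moreover have "?a \<in> set A" using g(1) A by (auto simp: recs_def)
  ultimately show ?thesis using findcyc_complete[OF _ _ L] by blast
qed

section \<open>The algorithm\<close>

text \<open>Non-loops whose head reaches their tail; they are the arcs of strong components with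
  more than one vertex.\<close>

definition strong_arcs :: "rec list \<Rightarrow> nat list \<Rightarrow> rec list \<Rightarrow> rec list" where
  "strong_arcs A L as = filter (\<lambda>a. rtl a \<noteq> rhd a \<and> map_of (bf (rhd a) A [] L) (rtl a) \<noteq> None) as"

definition outs :: "nat \<Rightarrow> rec list \<Rightarrow> rec list" where "outs v A = filter (\<lambda>a. rtl a = v) A"
definition ins :: "nat \<Rightarrow> rec list \<Rightarrow> rec list" where "ins v A = filter (\<lambda>a. rhd a = v) A"

text \<open>The list only bounds the number of moves; the run stops earlier at a vertex whose
  outdegree is not one.\<close>

fun follow :: "nat list \<Rightarrow> nat \<Rightarrow> rec list \<Rightarrow> nat" where
  "follow [] v A = v"
| "follow (_ # L) v A = (case outs v A of [a] \<Rightarrow> follow L (rhd a) A | _ \<Rightarrow> v)"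

fun zs :: "nat list \<Rightarrow> rec list \<Rightarrow> rec list \<Rightarrow> nat list" where
  "zs L A [] = []"
| "zs L A (a # as) =
    (case ins (rhd a) A of _ # _ # _ \<Rightarrow> follow L (rhd a) A # zs L A as | _ \<Rightarrow> zs L A as)"

text \<open>If one of the walks does not exist, the empty list makes the candidate fail, as no
  dicycle lies inside it.\<close>

definition candidate_set :: "rec \<Rightarrow> rec \<Rightarrow> rec list \<Rightarrow> nat list \<Rightarrow> nat list \<Rightarrow> nat list" where
  "candidate_set e f A L Z =
    (case map_of (bf (rhd e) A Z L) (rtl f) of None \<Rightarrow> [] | Some p \<Rightarrow>
       (case map_of (bf (rhd f) A Z L) (rtl e) of None \<Rightarrow> [] | Some q \<Rightarrow>
          map rhd p @ map rhd q @ [rhd e, rhd f]))"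

definition inside :: "rec list \<Rightarrow> nat list \<Rightarrow> rec list" where
  "inside A X = filter (\<lambda>a. rtl a \<in> set X \<and> rhd a \<in> set X) A"
definition outside :: "rec list \<Rightarrow> nat list \<Rightarrow> rec list" where
  "outside A X = filter (\<lambda>a. rtl a \<notin> set X \<and> rhd a \<notin> set X) A"

definition comb :: "'x option \<Rightarrow> 'y option \<Rightarrow> ('x \<times> 'y) option" where
  "comb x y = (case x of None \<Rightarrow> None | Some b \<Rightarrow> (case y of None \<Rightarrow> None | Some c \<Rightarrow> Some (b, c)))"

definition check :: "rec list \<Rightarrow> nat list \<Rightarrow> nat list \<Rightarrow> (nat list \<times> nat list) option" where
  "check A X L = comb (findcyc (inside A X) False L (inside A X)) (findcyc (outside A X) True L (outside A X))"

fun search2 :: "rec \<Rightarrow> rec list \<Rightarrow> rec list \<Rightarrow> nat list \<Rightarrow> nat list \<Rightarrow> rec list \<Rightarrow> (nat list \<times> nat list) option" where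
  "search2 e SA A L Z [] = None"
| "search2 e SA A L Z (f # fs) =
    (case check A (candidate_set e f SA L Z) L of Some r \<Rightarrow> Some r | None \<Rightarrow> search2 e SA A L Z fs)"

fun search1 :: "rec list \<Rightarrow> rec list \<Rightarrow> nat list \<Rightarrow> nat list \<Rightarrow> rec list \<Rightarrow> (nat list \<times> nat list) option" where
  "search1 SA A L Z [] = None"
| "search1 SA A L Z (e # es) =
    (case search2 e SA A L Z SA of Some r \<Rightarrow> Some r | None \<Rightarrow> search1 SA A L Z es)"

definition solve :: "rec list \<Rightarrow> nat list \<Rightarrow> (nat list \<times> nat list) option" where
  "solve A L = (let SA = strong_arcs A L A in search1 SA A L (zs L SA SA) SA)"

lemma search2_sound: "search2 e SA A L Z fs = Some r \<Longrightarrow> \<exists>X. check A X L = Some r"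
  by (induction fs) (auto split: option.splits)

lemma search1_sound: "search1 SA A L Z es = Some r \<Longrightarrow> \<exists>X. check A X L = Some r"
  by (induction es) (auto split: option.splits dest: search2_sound)

lemma search2_None: "search2 e SA A L Z fs = None \<Longrightarrow> f \<in> set fs \<Longrightarrow> check A (candidate_set e f SA L Z) L = None"
  by (induction fs) (auto split: option.splits)

lemma search1_None: "search1 SA A L Z es = None \<Longrightarrow> e \<in> set es \<Longrightarrow> f \<in> set SA \<Longrightarrow>
  check A (candidate_set e f SA L Z) L = None"
  by (induction es) (auto split: option.splits dest: search2_None)

text \<open>The dicycle has all its vertices in \<open>X\<close> and the other cycle has none there,
  so they are disjoint whatever \<open>X\<close> is.\<close>

lemma check_sound:
  assumes G: "wf_digraph G" and A: "set A = recs G (arcs G)" and r: "check A X L = Some (B, C)"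
  shows "disjoint_cycles G B C"
proof -
  let ?I = "{e \<in> arcs G. tail G e \<in> set X \<and> head G e \<in> set X}"
  let ?U = "{e \<in> arcs G. tail G e \<notin> set X \<and> head G e \<notin> set X}"
  have I: "set (inside A X) = recs G ?I" and U: "set (outside A X) = recs G ?U"
    unfolding inside_def outside_def set_filter A by (auto simp: recs_def)
  have f: "findcyc (inside A X) False L (inside A X) = Some B" "findcyc (outside A X) True L (outside A X) = Some C"
    using r by (auto simp: check_def comb_def split: option.splits)
  have B: "pre_digraph.cycle G B" "set B \<subseteq> ?I" using finddicycle_sound[OF G I _ f(1)] by auto
  have C: "ug_cycle G C" "set C \<subseteq> ?U" using findug_sound[OF U _ f(2)] by auto
  have "ends_of G B \<subseteq> set X" "ends_of G C \<inter> set X = {}" using B(2) C(2) by (auto simp: ends_of_def)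
  then show ?thesis using B(1) C(1) by (auto simp: disjoint_cycles_def)
qed

lemma cas_walk: "pre_digraph.cas G u W v \<and> set W \<subseteq> F \<longleftrightarrow> walk (tail G) (head G) F u W v"
  by (induction W arbitrary: u) (auto simp: pre_digraph.cas.simps)

lemma reachable_walk:
  assumes "wf_digraph G" "u \<in> verts G"
  shows "u \<rightarrow>\<^sup>*\<^bsub>G\<^esub> v \<longleftrightarrow> (\<exists>W. walk (tail G) (head G) (arcs G) u W v)"
proof -
  interpret wf_digraph G by fact
  show ?thesis unfolding reachable_awalk awalk_def using cas_walk[of G u _ v "arcs G"] assms(2) by blast
qed

section \<open>Reading the weights off the degrees\<close>

context chorded
begin

text \<open>A chord passes marks and a loop passes nothing; \<open>O\<close> has at least three
  vertices; off \<open>O\<close> the rank would decrease along the loop.\<close>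

lemma no_loop:
  assumes "e \<in> A" shows "t e \<noteq> h e"
  using assms
proof (cases rule: arc_cases)
  case 1
  then show ?thesis using marks_long[of e] k_ge by (auto simp: marks_def)
next
  case (2 q)
  have "Suc q mod N \<noteq> q" using 2(1) N_ge by (cases "Suc q = N") auto
  moreover have "Suc q mod N < N" using N_pos by simp
  ultimately have "os (Suc q mod N) \<noteq> os q" using tau_os 2(1) by metis
  then show ?thesis using oa_arc 2 by simp
next
  case 3
  then show ?thesis using off_rk[OF assms] by auto
qed

end

text \<open>The set \<open>Zs\<close> of first exits is what the algorithm computes from in- and outdegrees.\<close>

locale chorded_digraph = chorded "tail G" "head G" AS N os oa \<tau> rk M k
  for G :: "(nat, nat) pre_digraph" and AS N os oa \<tau> rk M k +
  fixes SA :: "rec list" and L :: "nat list"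
  assumes SA: "set SA = recs G AS" "distinct SA"
    and L: "tail G ` AS \<subseteq> set L"
begin

lemma distinct_single: "distinct ys \<Longrightarrow> set ys = {x} \<Longrightarrow> ys = [x]"
proof -
  assume y: "distinct ys" "set ys = {x}"
  then have "length ys = 1" using distinct_card[OF y(1)] by simp
  then obtain z where "ys = [z]" by (cases ys) auto
  then show ?thesis using y(2) by simp
qed

lemma L_len: "N \<le> length L"
proof -
  have "OV \<subseteq> set L" using L oa_arc by force
  then have "card OV \<le> card (set L)" by (intro card_mono) auto
  moreover have "card OV = N" using card_image[OF os_inj] by simp
  ultimately show ?thesis using card_length[of L] by linarith
qed

text \<open>Up to the first exit the arc of \<open>O\<close> is the only outgoing arc. At the exit a
  chord leaves as well, which stops the run.\<close>

lemma follow_run: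
  assumes "y \<le> x" "x < N" "exit_at x" "\<And>z. y \<le> z \<Longrightarrow> z < x \<Longrightarrow> \<not> exit_at z" "x - y \<le> length K"
  shows "follow K (os y) SA = os x"
  using assms
proof (induction K arbitrary: y)
  case Nil
  then show ?case by simp
next
  case (Cons z K)
  let ?r = "\<lambda>e. (e, tail G e, head G e)"
  have out: "set (outs (os y) SA) = ?r ` {e \<in> AS. tail G e = os y}" for y
    unfolding outs_def set_filter SA by (auto simp: recs_def)
  show ?case
  proof (cases "y = x")
    case True
    obtain e where e: "e \<in> AS" "e \<notin> OA" "tail G e = os x" using Cons.prems(3) by (auto simp: exit_at_def)
    have "?r e \<in> set (outs (os x) SA)" "?r (oa x) \<in> set (outs (os x) SA)"
      using e oa_arc[OF Cons.prems(2)] out by auto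
    moreover have "e \<noteq> oa x" using e Cons.prems(2) by auto
    ultimately have "\<not> (\<exists>a. outs (os x) SA = [a])" by auto
    then show ?thesis using True by (auto split: list.splits)
  next
    case False
    then have y: "y < x" "y < N" "\<not> exit_at y" using Cons.prems by auto
    have eqy: "{e \<in> AS. tail G e = os y} = {oa y}"
    proof
      show "{e \<in> AS. tail G e = os y} \<subseteq> {oa y}"
      proof
        fix e assume "e \<in> {e \<in> AS. tail G e = os y}"
        then have e: "e \<in> AS" "tail G e = os y" by auto
        then have "e \<in> OA" using y by (auto simp: exit_at_def)
        then obtain q where q: "q < N" "e = oa q" by auto
        then have "os q = os y" using e oa_arc by simp
        then have "q = y" using inj_onD[OF os_inj] q y by blast
        then show "e \<in> {oa y}" using q by simp
      qed
      show "{oa y} \<subseteq> {e \<in> AS. tail G e = os y}" using oa_arc[OF y(2)] by simp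
    qed
    have "set (outs (os y) SA) = {?r (oa y)}" unfolding out eqy by simp
    then have o: "outs (os y) SA = [?r (oa y)]" by (rule distinct_single[rotated]) (simp add: outs_def SA(2))
    have s: "Suc y mod N = Suc y" using y Cons.prems(2) by simp
    have "follow K (os (Suc y)) SA = os x"
      by (rule Cons.IH) (use Cons.prems y in auto)
    then show ?thesis using o oa_arc[OF y(2)] s by simp
  qed
qed

lemma zs_set: "set (zs L A as) = (\<lambda>a. follow L (rhd a) A) ` {a \<in> set as. length (ins (rhd a) A) \<ge> 2}"
proof (induction as)
  case (Cons a as)
  show ?case
  proof (cases "length (ins (rhd a) A) \<ge> 2")
    case True
    then obtain b c xs where "ins (rhd a) A = b # c # xs"
      by (cases "ins (rhd a) A"; cases "tl (ins (rhd a) A)") auto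
    then have "set (zs L A (a # as)) = insert (follow L (rhd a) A) (set (zs L A as))" by simp
    moreover have "{x \<in> set (a # as). length (ins (rhd x) A) \<ge> 2} =
        insert a {x \<in> set as. length (ins (rhd x) A) \<ge> 2}" using True by auto
    ultimately show ?thesis unfolding Cons.IH by simp
  next
    case False
    then have "set (zs L A (a # as)) = set (zs L A as)"
      by (cases "ins (rhd a) A"; cases "tl (ins (rhd a) A)") auto
    moreover have "{x \<in> set (a # as). length (ins (rhd x) A) \<ge> 2} =
        {x \<in> set as. length (ins (rhd x) A) \<ge> 2}" using False by auto
    ultimately show ?thesis unfolding Cons.IH by simp
  qed
qed simp

text \<open>Entries are the vertices of indegree at least two. A first exit has an entry before it
  in its segment and no exit between, so the run from this entry ends there. Conversely the run from
  an entry ends at the next exit; it lies in the same segment and is the first one there, as no exit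
  of the segment precedes an entry.\<close>

lemma zs_Zs: "set (zs L SA SA) = Zs"
proof -
  let ?r = "\<lambda>e. (e, tail G e, head G e)"
  have inset: "set (ins v SA) = ?r ` {e \<in> AS. head G e = v}" for v
    unfolding ins_def set_filter SA by (auto simp: recs_def)
  have ind: "distinct (ins v SA)" for v using SA(2) by (simp add: ins_def)
  \<comment> \<open>Vertices inside chords have one incoming arc, and \<open>O\<close> brings one
    arc to each of its vertices, so a second incoming arc means the end of a chord.\<close>
  have entry: "length (ins v SA) \<ge> 2 \<longleftrightarrow> (\<exists>y<N. v = os y \<and> (\<exists>f\<in>AS. f \<notin> OA \<and> head G f = os y))" for v
  proof
    assume "length (ins v SA) \<ge> 2"
    then have "card (set (ins v SA)) \<ge> 2" using ind distinct_card by metis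
    then have "\<not> card (set (ins v SA)) \<le> Suc 0" by simp
    then have "\<exists>a\<in>set (ins v SA). \<exists>b\<in>set (ins v SA). a \<noteq> b"
      unfolding card_le_Suc0_iff_eq[OF finite_set] by simp
    then obtain a b where ab: "a \<in> set (ins v SA)" "b \<in> set (ins v SA)" "a \<noteq> b" by blast
    then obtain e f where ef: "e \<in> AS" "f \<in> AS" "e \<noteq> f" "head G e = v" "head G f = v" unfolding inset by auto
    then have "v \<in> OV" using off_in[of e f] by auto
    then obtain y where y: "y < N" "v = os y" by auto
    have "\<not> (e \<in> OA \<and> f \<in> OA)"
    proof
      assume "e \<in> OA \<and> f \<in> OA"
      then obtain q q' where q: "q < N" "e = oa q" "q' < N" "f = oa q'" by auto
      have ml: "Suc q mod N < N" "Suc q' mod N < N" using N_pos by auto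
      have "os (Suc q mod N) = os (Suc q' mod N)" using ef q oa_arc by simp
      then have "Suc q mod N = Suc q' mod N" using inj_onD[OF os_inj] ml by blast
      then have "q = q'" using q by (cases "Suc q = N"; cases "Suc q' = N") auto
      then show False using q ef by simp
    qed
    then obtain f' where "f' \<in> AS" "f' \<notin> OA" "head G f' = os y" using ef y(2) by metis
    then show "\<exists>y<N. v = os y \<and> (\<exists>f\<in>AS. f \<notin> OA \<and> head G f = os y)"
      using y by (intro exI[of _ y] conjI bexI[of _ f']) auto
  next
    assume "\<exists>y<N. v = os y \<and> (\<exists>f\<in>AS. f \<notin> OA \<and> head G f = os y)"
    then obtain y f where y: "y < N" "v = os y" "f \<in> AS" "f \<notin> OA" "head G f = os y" by auto
    \<comment> \<open>The position before \<open>y\<close> on \<open>O\<close>, whose arc is the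
      second arc into \<open>os y\<close> besides \<open>f\<close>.\<close>
    define q where "q = (if y = 0 then N - 1 else y - 1)"
    have q: "q < N" "Suc q mod N = y" using y(1) by (auto simp: q_def)
    then have "head G (oa q) = os y" "oa q \<in> AS" "oa q \<noteq> f" using oa_arc[OF q(1)] y by auto
    then have "{?r f, ?r (oa q)} \<subseteq> set (ins v SA)" "card {?r f, ?r (oa q)} = 2" unfolding inset using y by auto
    then have "2 \<le> card (set (ins v SA))" by (metis List.finite_set card_mono)
    then show "length (ins v SA) \<ge> 2" using card_length[of "ins v SA"] by linarith
  qed
  have "Zs \<subseteq> set (zs L SA SA)"
  proof
    fix v assume "v \<in> Zs"
    then obtain x where x: "v = os x" "exit_at x" "\<not> (\<exists>x0<x. exit_at x0 \<and> \<not> (\<exists>m\<in>M. x0 \<le> m \<and> m < x))"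
      unfolding Zs_def by auto
    then obtain e where e: "e \<in> AS" "e \<notin> OA" "tail G e = os x" "x < N" by (auto simp: exit_at_def)
    obtain y f where y: "y \<le> x" "f \<in> AS" "f \<notin> OA" "head G f = os y" "\<not> (\<exists>m\<in>M. y \<le> m \<and> m < x)"
      using entry_before_exit[OF e] by blast
    have "\<not> exit_at z" if "y \<le> z" "z < x" for z
    proof
      assume "exit_at z"
      then obtain m where "m \<in> M" "z \<le> m" "m < x" using x(3) \<open>z < x\<close> by blast
      then show False using y(5) \<open>y \<le> z\<close> by (meson le_trans)
    qed
    then have "follow L (os y) SA = os x" using follow_run[OF y(1) e(4) x(2)] L_len e(4) by simp
    moreover have "?r f \<in> set SA" using y SA by (auto simp: recs_def)
    moreover have "length (ins (rhd (?r f)) SA) \<ge> 2" unfolding entry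
      using y e(4) by (intro exI[of _ y] conjI bexI[of _ f]) auto
    ultimately show "v \<in> set (zs L SA SA)" unfolding zs_set using x(1) y(4)
      by (intro image_eqI[of _ _ "?r f"]) simp_all
  qed
  moreover have "set (zs L SA SA) \<subseteq> Zs"
  proof
    fix v assume "v \<in> set (zs L SA SA)"
    then obtain a where a: "a \<in> set SA" "length (ins (rhd a) SA) \<ge> 2" "v = follow L (rhd a) SA" unfolding zs_set by auto
    obtain y f where y: "y < N" "rhd a = os y" "f \<in> AS" "f \<notin> OA" "head G f = os y"
      using a(2) unfolding entry by (elim exE conjE bexE)
    have noex: "\<exists>m\<in>M. x \<le> m \<and> m < y" if xe: "exit_at x" and xy: "x < y" for x
    proof -
      obtain e where "e \<in> AS" "e \<notin> OA" "tail G e = os x" using xe by (auto simp: exit_at_def)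
      from entry_after_exit[OF this(1) y(3) this(2) y(4) this(3) y(5) xy y(1)] show ?thesis .
    qed
    \<comment> \<open>The mark that ends the segment of \<open>y\<close>. There is an exit before it
      in its segment, and this exit is not before \<open>y\<close>, since exits strictly before an
      entry are separated from it by a mark.\<close>
    define m where "m = (LEAST m. m \<in> M \<and> y \<le> m)"
    have "\<exists>m. m \<in> M \<and> y \<le> m" using mark_after_entry[OF y(3,4,5,1)] by auto
    then have m: "m \<in> M" "y \<le> m" unfolding m_def by (metis (mono_tags, lifting) LeastI_ex)+
    have mleast: "m \<le> m'" if "m' \<in> M" "y \<le> m'" for m'
      unfolding m_def using that by (intro Least_le) simp
    obtain x0 where x0: "x0 \<le> m" "exit_at x0" "\<not> (\<exists>m'\<in>M. x0 \<le> m' \<and> m' < m)"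
    proof -
      obtain x0 where "x0 \<le> m" "\<exists>e\<in>AS. e \<notin> OA \<and> tail G e = os x0" "\<not> (\<exists>m'\<in>M. x0 \<le> m' \<and> m' < m)"
        using exit_before_mark[OF m(1)] by blast
      moreover have "m < N" using m(1) M_sub by auto
      ultimately show ?thesis using that by (auto simp: exit_at_def)
    qed
    have "y \<le> x0"
    proof (rule ccontr)
      assume "\<not> y \<le> x0"
      then obtain m' where "m' \<in> M" "x0 \<le> m'" "m' < y" using noex[OF x0(2)] by auto
      then show False using x0(3) m(2) by (meson less_le_trans)
    qed
    define x where "x = (LEAST x. exit_at x \<and> y \<le> x)"
    have "exit_at x \<and> y \<le> x" unfolding x_def
      by (rule LeastI[of "\<lambda>x. exit_at x \<and> y \<le> x" x0]) (use x0(2) \<open>y \<le> x0\<close> in simp)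
    then have x: "exit_at x" "y \<le> x" by simp_all
    have xleast: "x \<le> x'" if "exit_at x'" "y \<le> x'" for x'
      unfolding x_def using that by (intro Least_le) simp
    have xN: "x < N" using x(1) by (simp add: exit_at_def)
    have "\<not> exit_at z" if "y \<le> z" "z < x" for z using xleast[of z] that by auto
    then have "follow L (os y) SA = os x" using follow_run[OF x(2) xN x(1)] L_len xN by simp
    moreover have "\<exists>m\<in>M. x1 \<le> m \<and> m < x" if x1: "x1 < x" "exit_at x1" for x1
    proof -
      have "x1 < y" using xleast[OF x1(2)] x1(1) by (meson not_le)
      then show ?thesis using noex[OF x1(2)] x(2) by (meson less_le_trans)
    qed
    ultimately show "v \<in> Zs" using a(3) y(2) x(1) unfolding Zs_def by auto
  qed
  ultimately show ?thesis by blast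
qed


text \<open>The costs used in the search count the heads in \<open>Zs\<close>, so optimality among
  records is minimality of \<open>wt\<close>.\<close>

lemma minwalk_bf:
  assumes "map_of (bf u SA (zs L SA SA) L) v = Some p" and L': "head G ` AS \<subseteq> set L"
  shows "minwalk u (map rid (rev p)) v \<and> head G ` set (map rid (rev p)) = rhd ` set p"
proof -
  let ?Z = "zs L SA SA"
  have w: "walk rtl rhd (recs G AS) u (rev p) v" using bf_walk[OF assms(1)] SA by simp
  note w' = walk_recs[OF w]
  have wtc: "wt (map rid V) = cost ?Z V" if "map rhd V = map (head G) (map rid V)" for V
  proof -
    have "\<forall>a\<in>set V. rhd a = head G (rid a)" using that by simp
    then have "filter ((\<lambda>e. head G e \<in> Zs) \<circ> rid) V = filter (\<lambda>a. rhd a \<in> Zs) V"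
      by (intro filter_cong) auto
    then show ?thesis unfolding wt_def cost_def zs_Zs filter_map by simp
  qed
  have "minwalk u (map rid (rev p)) v" unfolding minwalk_def
  proof (intro conjI allI impI)
    show "walk (tail G) (head G) AS u (map rid (rev p)) v" using w' by blast
    fix W' assume W': "walk (tail G) (head G) AS u W' v"
    let ?W = "map (\<lambda>e. (e, tail G e, head G e)) W'"
    have W2: "walk rtl rhd (set SA) u ?W v" using recs_walk[OF W'] SA by simp
    have LL: "rhd ` set SA \<subseteq> set L" using L' SA by (auto simp: recs_def)
    obtain q where "map_of (bf u SA ?Z L) v = Some q" "cost ?Z q \<le> cost ?Z ?W"
      using bf_complete[OF W2 LL, of ?Z] by (elim exE conjE)
    then have "cost ?Z p \<le> cost ?Z ?W" using assms(1) by simp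
    moreover have "wt (map rid (rev p)) = cost ?Z p" using wtc[of "rev p"] w' by simp
    moreover have "wt W' = cost ?Z ?W" using wtc[of ?W] by (simp add: comp_def)
    ultimately show "wt (map rid (rev p)) \<le> wt W'" by simp
  qed
  moreover have "head G ` set (map rid (rev p)) = rhd ` set p"
  proof -
    have "set (map rhd (rev p)) = set (map (head G) (map rid (rev p)))" using w' by metis
    then show ?thesis by (simp add: image_image)
  qed
  ultimately show ?thesis by simp
qed

end

text \<open>The ends of a non-loop whose head reaches its tail are two vertices of one strong
  component, which must be \<open>S\<close>. Conversely \<open>S\<close> has no loops by assumption
  and connects the ends of its arcs.\<close>

lemma strong_component_arcs:
  assumes G: "fin_digraph G" and S: "nontrivial_sccs G = {S}" and nl: "\<forall>e\<in>arcs S. tail S e \<noteq> head S e"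
  shows "arcs S = {e \<in> arcs G. tail G e \<noteq> head G e \<and> (\<exists>W. walk (tail G) (head G) (arcs G) (head G e) W (tail G e))}"
    and "tail S = tail G" "head S = head G"
    and "u \<in> verts S \<Longrightarrow> v \<in> verts S \<Longrightarrow> \<exists>W. walk (tail G) (head G) (arcs S) u W v"
    and "e \<in> arcs G \<Longrightarrow> tail G e \<in> verts S \<Longrightarrow> head G e \<in> verts S \<Longrightarrow> e \<in> arcs S"
proof -
  interpret fin_digraph G by fact
  have Ss: "S \<in> sccs" "card (verts S) > 1" using S by (auto simp: nontrivial_sccs_def)
  have ind: "induced_subgraph S G" and sc: "strongly_connected S" using Ss(1) by auto
  have sub: "subgraph S G" using ind by auto
  show th: "tail S = tail G" "head S = head G"
    using sub unfolding subgraph_def compatible_def by auto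
  have wfS: "wf_digraph S" using sub unfolding subgraph_def by auto
  have SG: "arcs S \<subseteq> arcs G" using sub unfolding subgraph_def by auto
  show induced: "e \<in> arcs G \<Longrightarrow> tail G e \<in> verts S \<Longrightarrow> head G e \<in> verts S \<Longrightarrow> e \<in> arcs S" for e
    using ind unfolding induced_subgraph_def by auto
  show conn: "\<exists>W. walk (tail G) (head G) (arcs S) u W v" if "u \<in> verts S" "v \<in> verts S" for u v
  proof -
    have "u \<rightarrow>\<^sup>*\<^bsub>S\<^esub> v" using sc that by (auto simp: strongly_connected_def)
    then show ?thesis using reachable_walk[OF wfS that(1)] th by simp
  qed
  show "arcs S = {e \<in> arcs G. tail G e \<noteq> head G e \<and> (\<exists>W. walk (tail G) (head G) (arcs G) (head G e) W (tail G e))}"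
  proof (intro equalityI subsetI)
    fix e assume e: "e \<in> arcs S"
    then have "head G e \<in> verts S" "tail G e \<in> verts S"
      using wf_digraph.tail_in_verts[OF wfS e] wf_digraph.head_in_verts[OF wfS e] th by auto
    then obtain W where "walk (tail G) (head G) (arcs S) (head G e) W (tail G e)" using conn by blast
    then have "walk (tail G) (head G) (arcs G) (head G e) W (tail G e)" using SG by (rule walk_mono)
    then show "e \<in> {e \<in> arcs G. tail G e \<noteq> head G e \<and> (\<exists>W. walk (tail G) (head G) (arcs G) (head G e) W (tail G e))}"
      using bspec[OF nl e] th e SG by auto
  next
    fix e assume "e \<in> {e \<in> arcs G. tail G e \<noteq> head G e \<and> (\<exists>W. walk (tail G) (head G) (arcs G) (head G e) W (tail G e))}"
    then have e: "e \<in> arcs G" "tail G e \<noteq> head G e" "\<exists>W. walk (tail G) (head G) (arcs G) (head G e) W (tail G e)" by auto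
    have v: "tail G e \<in> verts G" "head G e \<in> verts G" using e by auto
    have r: "tail G e \<rightarrow>\<^sup>*\<^bsub>G\<^esub> head G e" "head G e \<rightarrow>\<^sup>*\<^bsub>G\<^esub> tail G e"
      using reachable_walk[OF wf_digraph_axioms v(2)] e(3) in_arcs_imp_in_arcs_ends[OF e(1)] by auto
    let ?X = "scc_of (tail G e)"
    have X: "tail G e \<in> ?X" "head G e \<in> ?X" using r v by (auto simp: scc_of_def)
    have "?X \<in> sccs_verts" using v(1) by (rule scc_of_in_sccs_verts)
    then have "G \<restriction> ?X \<in> sccs" by (rule in_verts_sccsD_sccs)
    moreover have "verts (G \<restriction> ?X) = ?X" by simp
    moreover have "card ?X > 1"
    proof -
      have "?X \<subseteq> verts G" using \<open>?X \<in> sccs_verts\<close> sccs_verts_subsets by auto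
      then have "finite ?X" using finite_verts finite_subset by blast
      then have "card {tail G e, head G e} \<le> card ?X" using X by (intro card_mono) auto
      then show ?thesis using e(2) by simp
    qed
    ultimately have "G \<restriction> ?X \<in> nontrivial_sccs G" by (simp add: nontrivial_sccs_def)
    then have "S = G \<restriction> ?X" using S by simp
    then show "e \<in> arcs S" using e(1) X by (simp add: induce_subgraph_def)
  qed
qed


context chorded_digraph
begin

text \<open>The two walks and the arcs \<open>e\<close> and \<open>f\<close> form a closed walk
  inside the candidate set, so the search for a dicycle there cannot fail. This also covers
  \<open>e = f\<close>, where the closed walk uses the arc twice.\<close>

lemma candidate:
  assumes A: "set A = recs G (arcs G)" "distinct (map rid A)" "AS \<subseteq> arcs G"
    and L': "tail G ` arcs G \<subseteq> set L" "head G ` arcs G \<subseteq> set L"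
    and ef: "e \<in> AS" "f \<in> AS"
    and conn: "\<exists>W. walk (tail G) (head G) AS (head G e) W (tail G f)"
      "\<exists>W. walk (tail G) (head G) AS (head G f) W (tail G e)"
    and X: "X = candidate_set (e, tail G e, head G e) (f, tail G f, head G f) SA L (zs L SA SA)"
  shows "(\<exists>W W'. minwalk (head G e) W (tail G f) \<and> minwalk (head G f) W' (tail G e) \<and> set X = cand e f W W')
    \<and> findcyc (inside A X) False L (inside A X) \<noteq> None"
proof -
  let ?r = "\<lambda>e. (e, tail G e, head G e)"
  let ?Z = "zs L SA SA"
  have L2: "head G ` AS \<subseteq> set L" using L'(2) A(3) by auto
  have LL: "rhd ` set SA \<subseteq> set L" using L2 SA by (auto simp: recs_def)
  have some: "\<exists>p. map_of (bf u SA ?Z L) v = Some p" if w: "\<exists>W. walk (tail G) (head G) AS u W v" for u v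
  proof -
    obtain W where "walk (tail G) (head G) AS u W v" using w by auto
    then have "walk rtl rhd (set SA) u (map ?r W) v" using recs_walk SA by simp
    from bf_complete[OF this LL, of ?Z] show ?thesis by auto
  qed
  obtain p where p: "map_of (bf (head G e) SA ?Z L) (tail G f) = Some p" using some[OF conn(1)] by auto
  obtain q where q: "map_of (bf (head G f) SA ?Z L) (tail G e) = Some q" using some[OF conn(2)] by auto
  define W1 where "W1 = map rid (rev p)"
  define W2 where "W2 = map rid (rev q)"
  have m1: "minwalk (head G e) W1 (tail G f)" "head G ` set W1 = rhd ` set p"
    using minwalk_bf[OF p L2] by (auto simp: W1_def)
  have m2: "minwalk (head G f) W2 (tail G e)" "head G ` set W2 = rhd ` set q"
    using minwalk_bf[OF q L2] by (auto simp: W2_def)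
  have XX: "set X = cand e f W1 W2"
    using p q m1(2) m2(2) unfolding X candidate_set_def cand_def pverts_def by auto
  have w1: "walk (tail G) (head G) AS (head G e) W1 (tail G f)"
    and w2: "walk (tail G) (head G) AS (head G f) W2 (tail G e)"
    using m1 m2 by (auto simp: minwalk_def)
  let ?I = "{e \<in> arcs G. tail G e \<in> set X \<and> head G e \<in> set X}"
  have in1: "set W \<subseteq> ?I \<and> v \<in> set X"
    if "walk (tail G) (head G) AS u W v" "insert u (head G ` set W) \<subseteq> set X" for u W v
  proof -
    have "insert v (tail G ` set W) \<subseteq> set X" using walk_heads[OF that(1)] that(2) by simp
    moreover have "set W \<subseteq> arcs G" using walk_set[OF that(1)] A(3) by auto
    ultimately show ?thesis using that(2) by auto
  qed
  have i1: "set W1 \<subseteq> ?I" "tail G f \<in> set X" using in1[OF w1] XX by (auto simp: cand_def pverts_def)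
  have i2: "set W2 \<subseteq> ?I" "tail G e \<in> set X" using in1[OF w2] XX by (auto simp: cand_def pverts_def)
  have hX: "head G e \<in> set X" "head G f \<in> set X" using XX by (auto simp: cand_def pverts_def)
  have efI: "e \<in> ?I" "f \<in> ?I" using i1(2) i2(2) hX ef A(3) by auto
  have w: "walk (tail G) (head G) ?I (head G e) (W1 @ f # W2) (tail G e)"
    unfolding walk_append walk.simps
    using walk_restrict[OF w1 i1(1)] walk_restrict[OF w2 i2(1)] efI by blast
  have I: "set (inside A X) = recs G ?I"
    unfolding inside_def set_filter A by (auto simp: recs_def)
  have "walk rtl rhd (set (inside A X)) (rhd (?r e)) (map ?r (W1 @ f # W2)) (rtl (?r e))"
    using recs_walk[OF w] unfolding I by simp
  moreover have "?r e \<in> set (inside A X)" unfolding I using efI by (auto simp: recs_def)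
  moreover have "distinct (map rid (inside A X))" using A(2) unfolding inside_def by (rule distinct_map_filter)
  moreover have "rtl ` set (inside A X) \<subseteq> set L" "rhd ` set (inside A X) \<subseteq> set L"
    unfolding I using L' by (auto simp: recs_def)
  ultimately have "findcyc (inside A X) False L (inside A X) \<noteq> None" by (rule finddicycle_complete)
  then show ?thesis using m1 m2 XX by blast
qed

end

lemma ug_free:
  assumes A: "set A = recs G (arcs G)"
    and L: "tail G ` arcs G \<subseteq> set L" "head G ` arcs G \<subseteq> set L"
    and g: "g \<in> arcs G" "tail G g \<notin> set X" "head G g \<notin> set X"
      "(head G g, tail G g) \<in> (ugr (tail G) (head G) ({a \<in> arcs G. tail G a \<notin> set X \<and> head G a \<notin> set X} - {g}))\<^sup>*"
  shows "findcyc (outside A X) True L (outside A X) \<noteq> None"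
proof -
  let ?U = "{e \<in> arcs G. tail G e \<notin> set X \<and> head G e \<notin> set X}"
  have U: "set (outside A X) = recs G ?U"
    unfolding outside_def set_filter A by (auto simp: recs_def)
  show ?thesis
  proof (rule findug_complete[OF U _ g(4)])
    show "g \<in> ?U" using g by simp
    show "rtl ` set (outside A X) \<subseteq> set L" "rhd ` set (outside A X) \<subseteq> set L"
      unfolding U using L by (auto simp: recs_def)
  qed
qed

text \<open>A positive answer is correct by \<open>check_sound\<close>. If the answer is negative,
  all candidates fail although each contains a dicycle, so no candidate leaves a cycle outside;
  \<open>candidate_exists\<close> contradicts this.\<close>

theorem solve_correct:
  assumes G: "fin_digraph G" and U: "unique_scc_subdivides_vault G" and l: "listing G vs es"
  defines "A \<equiv> map (\<lambda>e. (e, tail G e, head G e)) es"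
  shows "solve A vs = Some (B, C) \<Longrightarrow> disjoint_cycles G B C"
    and "solve A vs = None \<Longrightarrow> \<not> disjoint_cycles G B C"
proof -
  interpret fin_digraph G by fact
  have l': "distinct vs" "set vs = verts G" "distinct es" "set es = arcs G" using l by (auto simp: listing_def)
  have A: "set A = recs G (arcs G)" by (simp add: A_def recs_def l')
  have dA: "distinct (map rid A)" "distinct A"
    using l'(3) by (simp_all add: A_def comp_def distinct_map inj_on_def)
  have Lt: "tail G ` arcs G \<subseteq> set vs" and Lh: "head G ` arcs G \<subseteq> set vs" using l' by auto
  show "disjoint_cycles G B C" if sol: "solve A vs = Some (B, C)"
  proof -
    obtain X where "check A X vs = Some (B, C)"
      using search1_sound[OF sol[unfolded solve_def Let_def]] by (elim exE)
    then show ?thesis by (rule check_sound[OF wf_digraph_axioms A])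
  qed
  show "\<not> disjoint_cycles G B C" if none: "solve A vs = None"
  proof
    assume "disjoint_cycles G B C"
    then have BC: "pre_digraph.cycle G B" "ug_cycle G C" "ends_of G B \<inter> ends_of G C = {}"
      by (auto simp: disjoint_cycles_def)
    obtain S V where S: "nontrivial_sccs G = {S}" and V: "vault (V :: (nat, nat) pre_digraph)" "subdivision_of S V"
      using U unfolding unique_scc_subdivides_vault_def by blast
    obtain N os oa \<tau> rk M k where ch: "chorded (tail S) (head S) (arcs S) N os oa \<tau> rk M k"
      using subdivided_vault_chorded[OF V] by blast
    have "\<forall>e\<in>arcs S. tail S e \<noteq> head S e" using chorded.no_loop[OF ch] by blast
    note sc = strong_component_arcs[OF G S this]
    have ch': "chorded (tail G) (head G) (arcs S) N os oa \<tau> rk M k" using ch sc(2,3) by simp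
    have eS: "e \<in> arcs S \<longleftrightarrow> e \<in> arcs G \<and> tail G e \<noteq> head G e \<and>
        (\<exists>W. walk (tail G) (head G) (arcs G) (head G e) W (tail G e))" for e
      unfolding sc(1) mem_Collect_eq ..
    define SA where "SA = strong_arcs A vs A"
    have SA: "set SA = recs G (arcs S)"
    proof -
      have "map_of (bf (rhd a) A [] vs) (rtl a) \<noteq> None \<longleftrightarrow>
          (\<exists>W. walk (tail G) (head G) (arcs G) (rhd a) W (rtl a))" for a
      proof
        assume "map_of (bf (rhd a) A [] vs) (rtl a) \<noteq> None"
        then obtain p where "walk rtl rhd (recs G (arcs G)) (rhd a) (rev p) (rtl a)" using bf_walk[of "rhd a" A "[]" vs "rtl a"] A by auto
        then show "\<exists>W. walk (tail G) (head G) (arcs G) (rhd a) W (rtl a)" using walk_recs by blast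
      next
        assume "\<exists>W. walk (tail G) (head G) (arcs G) (rhd a) W (rtl a)"
        then obtain W' where "walk (tail G) (head G) (arcs G) (rhd a) W' (rtl a)" by (elim exE)
        then have W: "walk rtl rhd (set A) (rhd a) (map (\<lambda>e. (e, tail G e, head G e)) W') (rtl a)"
          unfolding A by (rule recs_walk)
        have "rhd ` set A \<subseteq> set vs" using A Lh by (auto simp: recs_def)
        then show "map_of (bf (rhd a) A [] vs) (rtl a) \<noteq> None" using bf_complete[OF W, of vs "[]"] by auto
      qed
      then have 1: "set SA = {a \<in> recs G (arcs G). rtl a \<noteq> rhd a \<and>
          (\<exists>W. walk (tail G) (head G) (arcs G) (rhd a) W (rtl a))}"
        unfolding SA_def strong_arcs_def by (simp add: A)
      show ?thesis
      proof (rule set_eqI)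
        show "a \<in> set SA \<longleftrightarrow> a \<in> recs G (arcs S)" for a
          unfolding 1 mem_Collect_eq recs_iff eS by (rule iffI; elim conjE; simp)
      qed
    qed
    have dSA: "distinct SA" using dA by (simp add: SA_def strong_arcs_def)
    have sub: "arcs S \<subseteq> arcs G" using sc(1) by blast
    interpret chorded_digraph G "arcs S" N os oa \<tau> rk M k SA vs
      by (rule chorded_digraph.intro[OF ch'], rule chorded_digraph_axioms.intro) (use SA dSA sub Lt in auto)
    have wfS: "wf_digraph S" using ch V(2) by (simp add: subdivision_of_def)
    have hv: "head G e \<in> verts S" and tv: "tail G e \<in> verts S" if "e \<in> arcs S" for e
      using wf_digraph.tail_in_verts[OF wfS that] wf_digraph.head_in_verts[OF wfS that] sc(2,3) by auto
    let ?r = "\<lambda>e. (e, tail G e, head G e)"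
    define X where "X e f = candidate_set (?r e) (?r f) SA vs (zs vs SA SA)" for e f
    have cnd: "(\<exists>W W'. minwalk (head G e) W (tail G f) \<and> minwalk (head G f) W' (tail G e) \<and> set (X e f) = cand e f W W')"
      "findcyc (inside A (X e f)) False vs (inside A (X e f)) \<noteq> None" if "e \<in> arcs S" "f \<in> arcs S" for e f
      using candidate[OF A dA(1) sub Lt Lh that sc(4)[OF hv[OF that(1)] tv[OF that(2)]] sc(4)[OF hv[OF that(2)] tv[OF that(1)]] X_def]
      by auto
    have no: "check A (X e f) vs = None" if "e \<in> arcs S" "f \<in> arcs S" for e f
    proof -
      have "?r e \<in> set SA" "?r f \<in> set SA" using that SA by (auto simp: recs_def)
      moreover have "search1 SA A vs (zs vs SA SA) SA = None" using none unfolding solve_def Let_def SA_def .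
      ultimately show ?thesis unfolding X_def by (intro search1_None)
    qed
    then have noug: "findcyc (outside A (X e f)) True vs (outside A (X e f)) = None" if "e \<in> arcs S" "f \<in> arcs S" for e f
      using no[OF that] cnd(2)[OF that] unfolding check_def comb_def by (auto split: option.splits)
    have free: "free (arcs G) Y = {a \<in> arcs G. tail G a \<notin> Y \<and> head G a \<notin> Y}" for Y
      by (simp add: free_def)
    show False
    proof (cases "\<exists>g\<in>arcs G. tail G g = head G g")
      case True
      then obtain g where g: "g \<in> arcs G" "tail G g = head G g" by auto
      \<comment> \<open>A loop cannot lie at a vertex of \<open>S\<close>, so it is itself a cycle
        disjoint from every candidate; the pair consisting of \<open>oa 0\<close> twice is as good
        as any.\<close>
      have o: "oa 0 \<in> arcs S" using oa_arc N_pos by simp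
      obtain W W' where W: "minwalk (head G (oa 0)) W (tail G (oa 0))" "minwalk (head G (oa 0)) W' (tail G (oa 0))"
        "set (X (oa 0) (oa 0)) = cand (oa 0) (oa 0) W W'" using cnd(1)[OF o o] by blast
      have "set W \<subseteq> arcs S" using walk_set[OF conjunct1[OF W(1)[unfolded minwalk_def]]] .
      moreover have "set W' \<subseteq> arcs S" using walk_set[OF conjunct1[OF W(2)[unfolded minwalk_def]]] .
      ultimately have XS: "set (X (oa 0) (oa 0)) \<subseteq> verts S" unfolding W(3) cand_def pverts_def using hv o by auto
      have "tail G g \<notin> verts S"
      proof
        assume "tail G g \<in> verts S"
        then have "g \<in> arcs S" using sc(5)[OF g(1)] g(2) by simp
        then show False using no_loop g(2) by simp
      qed
      then have "tail G g \<notin> set (X (oa 0) (oa 0))" using XS by blast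
      then have "findcyc (outside A (X (oa 0) (oa 0))) True vs (outside A (X (oa 0) (oa 0))) \<noteq> None"
        using ug_free[OF A Lt Lh g(1), of "X (oa 0) (oa 0)"] g(2) by simp
      then show False using noug[OF o o] by simp
    next
      case nl: False
      obtain u where aw: "awalk u B u" "distinct B" "B \<noteq> []" using BC(1) unfolding cycle_conv by blast
      have wB: "walk (tail G) (head G) (arcs G) u B u"
        using aw(1) cas_walk[of G u B u "arcs G"] unfolding awalk_def by blast
      \<comment> \<open>Without loops, each arc of \<open>B\<close> is a non-loop whose head reaches
        its tail along \<open>B\<close>, so it belongs to the only nontrivial strong
        component.\<close>
      have "set B \<subseteq> arcs S"
      proof
        fix e assume e: "e \<in> set B"
        then obtain B1 B2 where B12: "walk (tail G) (head G) (arcs G) u B1 (tail G e)"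
          "walk (tail G) (head G) (arcs G) (head G e) B2 u" using walk_split[OF wB] by blast
        then have "walk (tail G) (head G) (arcs G) (head G e) (B2 @ B1) (tail G e)" by (auto simp: walk_append)
        moreover have "e \<in> arcs G" using walk_set[OF wB] e by blast
        moreover have "tail G e \<noteq> head G e" using nl \<open>e \<in> arcs G\<close> by blast
        ultimately show "e \<in> arcs S" unfolding eS by (intro conjI exI)
      qed
      then have wS: "walk (tail G) (head G) (arcs S) u B u" using walk_restrict[OF wB] by blast
      obtain xs where C: "C \<noteq> []" "distinct C" "set C \<subseteq> arcs G" "length xs = length C" "distinct xs"
        "\<forall>i<length C. {tail G (C ! i), head G (C ! i)} = {xs ! i, xs ! (Suc i mod length C)}"
        using BC(2) unfolding ug_cycle_def by blast
      have "set xs \<subseteq> ends_of G C"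
      proof
        fix x assume "x \<in> set xs"
        then obtain i where i: "i < length C" "x = xs ! i" using C(4) by (metis in_set_conv_nth)
        then have "x \<in> {tail G (C ! i), head G (C ! i)}" using C(6) by simp
        then show "x \<in> ends_of G C" using i(1) by (auto simp: ends_of_def)
      qed
      then have disj: "tail G ` set B \<inter> set xs = {}" using BC(3) by (auto simp: ends_of_def)
      obtain e f where ef: "e \<in> arcs S" "f \<in> arcs S"
        and *: "\<forall>W W'. minwalk (head G e) W (tail G f) \<longrightarrow> minwalk (head G f) W' (tail G e) \<longrightarrow>
          (\<exists>g\<in>free (arcs G) (cand e f W W'). (head G g, tail G g) \<in>
            (ugr (tail G) (head G) (free (arcs G) (cand e f W W') - {g}))\<^sup>*)"
        using candidate_exists[OF sub wS aw(3,2) C(1,2,5,4,3,6) disj] by blast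
      obtain W W' where W: "minwalk (head G e) W (tail G f)" "minwalk (head G f) W' (tail G e)"
        "set (X e f) = cand e f W W'" using cnd(1)[OF ef] by blast
      obtain g where g: "g \<in> free (arcs G) (set (X e f))"
        "(head G g, tail G g) \<in> (ugr (tail G) (head G) (free (arcs G) (set (X e f)) - {g}))\<^sup>*"
        using * W by metis
      have "findcyc (outside A (X e f)) True vs (outside A (X e f)) \<noteq> None"
        using ug_free[OF A Lt Lh, of g "X e f"] g unfolding free by auto
      then show False using noug[OF ef] by simp
    qed
  qed
qed

section \<open>The program\<close>

text \<open>Numbers are represented in unary, as lists. As there is no local binding, a case distinction on
  a computed value passes it to an auxiliary function as its last argument or arguments.\<close>

abbreviation "Nl \<equiv> Quote (Atom 0)"
abbreviation "aId a \<equiv> Fst a"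
abbreviation "aTl a \<equiv> Fst (Snd a)"
abbreviation "aHd a \<equiv> Snd (Snd a)"

definition "solve_body = Call 32 [Var 0, Var 1, Call 10 [Var 1, Var 1, Var 0]]"
definition "mem_body = Cond (IsAtom (Var 1)) Nl (Cond (EqAtom (Fst (Var 1)) (Var 0)) (Quote (Atom 1)) (Call 1 [Var 0, Snd (Var 1)]))"
definition "lookup_body = Cond (IsAtom (Var 1)) Nl (Cond (EqAtom (Fst (Fst (Var 1))) (Var 0)) (Fst (Var 1)) (Call 2 [Var 0, Snd (Var 1)]))"
definition "cost_body = Cond (IsAtom (Var 0)) Nl (Cond (Call 1 [aHd (Fst (Var 0)), Var 1])
  (MkCell Nl (Call 3 [Snd (Var 0), Var 1])) (Call 3 [Snd (Var 0), Var 1]))"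
definition "less_body = Cond (IsAtom (Var 1)) Nl (Cond (IsAtom (Var 0)) (Quote (Atom 1)) (Call 4 [Snd (Var 0), Snd (Var 1)]))"
definition "upd_body = Call 6 [Var 0, Var 1, Var 2, Call 2 [aTl (Var 0), Var 1], Call 2 [aHd (Var 0), Var 1]]"
definition "upd_cases_body = (let new = MkCell (MkCell (aHd (Var 0)) (MkCell (Var 0) (Snd (Var 3)))) (Var 1) in
  Cond (Var 3) (Cond (Var 4)
    (Cond (Call 4 [Call 3 [MkCell (Var 0) (Snd (Var 3)), Var 2], Call 3 [Snd (Var 4), Var 2]]) new (Var 1))
    new) (Var 1))"
definition "relax_body = Cond (IsAtom (Var 0)) (Var 1) (Call 7 [Snd (Var 0), Call 5 [Fst (Var 0), Var 1, Var 2], Var 2])"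
definition "rounds_body = Cond (IsAtom (Var 0)) (Var 2) (Call 8 [Snd (Var 0), Var 1, Call 7 [Var 1, Var 2, Var 3], Var 3])"
definition "bf_body = Call 8 [Var 3, Var 1, MkCell (MkCell (Var 0) Nl) Nl, Var 2]"
definition "strong_arcs_body = Cond (IsAtom (Var 0)) Nl
  (Cond (EqAtom (aTl (Fst (Var 0))) (aHd (Fst (Var 0)))) (Call 10 [Snd (Var 0), Var 1, Var 2])
    (Cond (Call 2 [aTl (Fst (Var 0)), Call 9 [aHd (Fst (Var 0)), Var 1, Nl, Var 2]])
      (MkCell (Fst (Var 0)) (Call 10 [Snd (Var 0), Var 1, Var 2])) (Call 10 [Snd (Var 0), Var 1, Var 2])))"
definition "outs_body = Cond (IsAtom (Var 1)) Nl (Cond (EqAtom (aTl (Fst (Var 1))) (Var 0))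
  (MkCell (Fst (Var 1)) (Call 11 [Var 0, Snd (Var 1)])) (Call 11 [Var 0, Snd (Var 1)]))"
definition "ins_body = Cond (IsAtom (Var 1)) Nl (Cond (EqAtom (aHd (Fst (Var 1))) (Var 0))
  (MkCell (Fst (Var 1)) (Call 12 [Var 0, Snd (Var 1)])) (Call 12 [Var 0, Snd (Var 1)]))"
definition "follow_body = Cond (IsAtom (Var 0)) (Var 1) (Call 14 [Snd (Var 0), Var 1, Var 2, Call 11 [Var 1, Var 2]])"
definition "follow_cases_body = Cond (IsAtom (Var 3)) (Var 1)
  (Cond (IsAtom (Snd (Var 3))) (Call 13 [Var 0, aHd (Fst (Var 3)), Var 2]) (Var 1))"
definition "zs_body = Cond (IsAtom (Var 2)) Nl (Call 16 [Var 0, Var 1, Var 2, Call 12 [aHd (Fst (Var 2)), Var 1]])"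
definition "zs_cases_body = Cond (IsAtom (Var 3)) (Call 15 [Var 0, Var 1, Snd (Var 2)])
  (Cond (IsAtom (Snd (Var 3))) (Call 15 [Var 0, Var 1, Snd (Var 2)])
    (MkCell (Call 13 [Var 0, aHd (Fst (Var 2)), Var 1]) (Call 15 [Var 0, Var 1, Snd (Var 2)])))"
definition "heads_body = Cond (IsAtom (Var 0)) (Var 1) (MkCell (aHd (Fst (Var 0))) (Call 17 [Snd (Var 0), Var 1]))"
definition "inside_body = Cond (IsAtom (Var 0)) Nl (Cond (Call 1 [aTl (Fst (Var 0)), Var 1])
  (Cond (Call 1 [aHd (Fst (Var 0)), Var 1]) (MkCell (Fst (Var 0)) (Call 18 [Snd (Var 0), Var 1]))
    (Call 18 [Snd (Var 0), Var 1])) (Call 18 [Snd (Var 0), Var 1]))"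
definition "outside_body = Cond (IsAtom (Var 0)) Nl (Cond (Call 1 [aTl (Fst (Var 0)), Var 1])
  (Call 19 [Snd (Var 0), Var 1]) (Cond (Call 1 [aHd (Fst (Var 0)), Var 1]) (Call 19 [Snd (Var 0), Var 1])
    (MkCell (Fst (Var 0)) (Call 19 [Snd (Var 0), Var 1]))))"
definition "other_arcs_body = (let rec = Call 20 [Var 0, Snd (Var 1), Var 2] in
  Cond (IsAtom (Var 1)) Nl (Cond (EqAtom (aId (Fst (Var 1))) (Var 0)) rec
    (MkCell (Fst (Var 1)) (Cond (Var 2)
      (MkCell (MkCell (aId (Fst (Var 1))) (MkCell (aHd (Fst (Var 1))) (aTl (Fst (Var 1))))) rec) rec))))"
text \<open>The accumulator reverses the list, which undoes the reversed order of the walks in the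
  tables.\<close>

definition "ids_body = Cond (IsAtom (Var 0)) (Var 1) (Call 21 [Snd (Var 0), MkCell (aId (Fst (Var 0))) (Var 1)])"
definition "findcyc_body = Cond (IsAtom (Var 3)) Nl (Call 23 [Var 0, Var 1, Var 2, Var 3,
  Call 2 [aTl (Fst (Var 3)), Call 9 [aHd (Fst (Var 3)), Call 20 [aId (Fst (Var 3)), Var 0, Var 1], Nl, Var 2]]])"
definition "findcyc_cases_body = Cond (Var 4) (Call 21 [Snd (Var 4), MkCell (aId (Fst (Var 3))) Nl])
  (Call 22 [Var 0, Var 1, Var 2, Snd (Var 3)])"
definition "comb_body = Cond (Var 0) (Cond (Var 1) (MkCell (Var 0) (Var 1)) Nl) Nl"
definition "check_body = Call 24 [Call 22 [Call 18 [Var 0, Var 1], Nl, Var 2, Call 18 [Var 0, Var 1]],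
  Call 22 [Call 19 [Var 0, Var 1], Quote (Atom 1), Var 2, Call 19 [Var 0, Var 1]]]"
definition "candidate_set_body = Call 27 [Var 0, Var 1, Call 2 [aTl (Var 1), Call 9 [aHd (Var 0), Var 2, Var 4, Var 3]],
  Call 2 [aTl (Var 0), Call 9 [aHd (Var 1), Var 2, Var 4, Var 3]]]"
definition "candidate_set_cases_body = Cond (Var 2) (Cond (Var 3)
  (Call 17 [Snd (Var 2), Call 17 [Snd (Var 3), MkCell (aHd (Var 0)) (MkCell (aHd (Var 1)) Nl)]]) Nl) Nl"
definition "search2_body = Cond (IsAtom (Var 5)) Nl (Call 29 [Var 0, Var 1, Var 2, Var 3, Var 4, Var 5,
  Call 25 [Var 2, Call 26 [Var 0, Fst (Var 5), Var 1, Var 3, Var 4], Var 3]])"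
definition "search2_cases_body = Cond (Var 6) (Var 6) (Call 28 [Var 0, Var 1, Var 2, Var 3, Var 4, Snd (Var 5)])"
definition "search1_body = Cond (IsAtom (Var 4)) Nl (Call 31 [Var 0, Var 1, Var 2, Var 3, Var 4,
  Call 28 [Fst (Var 4), Var 0, Var 1, Var 2, Var 3, Var 0]])"
definition "search1_cases_body = Cond (Var 5) (Var 5) (Call 30 [Var 0, Var 1, Var 2, Var 3, Snd (Var 4)])"
definition "solve_strong_body = Call 30 [Var 2, Var 1, Var 0, Call 15 [Var 0, Var 2, Var 2], Var 2]"

definition prog :: program where
  "prog = [solve_body, mem_body, lookup_body, cost_body, less_body, upd_body, upd_cases_body, relax_body, rounds_body, bf_body, strong_arcs_body,
     outs_body, ins_body, follow_body, follow_cases_body, zs_body, zs_cases_body, heads_body, inside_body, outside_body, other_arcs_body,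
     ids_body, findcyc_body, findcyc_cases_body, comb_body, check_body, candidate_set_body, candidate_set_cases_body, search2_body, search2_cases_body, search1_body, search1_cases_body, solve_strong_body]"

lemma prog_nth:
  "prog ! 0 = solve_body" "prog ! 1 = mem_body" "prog ! 2 = lookup_body" "prog ! 3 = cost_body" "prog ! 4 = less_body" "prog ! 5 = upd_body"
  "prog ! 6 = upd_cases_body" "prog ! 7 = relax_body" "prog ! 8 = rounds_body" "prog ! 9 = bf_body" "prog ! 10 = strong_arcs_body"
  "prog ! 11 = outs_body" "prog ! 12 = ins_body" "prog ! 13 = follow_body" "prog ! 14 = follow_cases_body" "prog ! 15 = zs_body"
  "prog ! 16 = zs_cases_body" "prog ! 17 = heads_body" "prog ! 18 = inside_body" "prog ! 19 = outside_body" "prog ! 20 = other_arcs_body"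
  "prog ! 21 = ids_body" "prog ! 22 = findcyc_body" "prog ! 23 = findcyc_cases_body" "prog ! 24 = comb_body" "prog ! 25 = check_body"
  "prog ! 26 = candidate_set_body" "prog ! 27 = candidate_set_cases_body" "prog ! 28 = search2_body" "prog ! 29 = search2_cases_body" "prog ! 30 = search1_body"
  "prog ! 31 = search1_cases_body" "prog ! 32 = solve_strong_body"
  by (simp_all add: prog_def)

lemma prog_len: "length prog = 33"
  by (simp add: prog_def)

subsection \<open>Evaluation as a function\<close>

text \<open>By determinism the evaluation relation is a partial function; in this form a program
  body is evaluated symbolically by rewriting.\<close>

definition ev :: "sexp list \<Rightarrow> lexp \<Rightarrow> (sexp \<times> nat) option" where
  "ev \<rho> e = (if \<exists>v t. eval prog \<rho> e v t then Some (SOME (v, t). eval prog \<rho> e v t) else None)"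

definition evl :: "sexp list \<Rightarrow> lexp list \<Rightarrow> (sexp list \<times> nat) option" where
  "evl \<rho> es = (if \<exists>v t. evals prog \<rho> es v t then Some (SOME (v, t). evals prog \<rho> es v t) else None)"

lemma ev_Some: "ev \<rho> e = Some (v, t) \<longleftrightarrow> eval prog \<rho> e v t"
proof (cases "\<exists>v t. eval prog \<rho> e v t")
  case True
  then obtain v' t' where v': "eval prog \<rho> e v' t'" by blast
  note det = eval_evals_deterministic(1)[OF v']
  have "ev \<rho> e = Some (SOME (v, t). eval prog \<rho> e v t)"
    unfolding ev_def by (rule if_P[OF True])
  moreover have "(SOME (v, t). eval prog \<rho> e v t) = (v', t')"
  proof (rule some_equality)
    show "case (v', t') of (v, t) \<Rightarrow> eval prog \<rho> e v t" using v' by simp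
    fix x assume "case x of (v, t) \<Rightarrow> eval prog \<rho> e v t"
    then have "eval prog \<rho> e (fst x) (snd x)" by (simp add: case_prod_beta)
    from det[OF this] show "x = (v', t')" by (metis prod.collapse)
  qed
  ultimately have eq: "ev \<rho> e = Some (v', t')" by (simp only:)
  show ?thesis
  proof
    assume "ev \<rho> e = Some (v, t)"
    then show "eval prog \<rho> e v t" using eq v' by (simp only: option.inject prod.inject)
  next
    assume "eval prog \<rho> e v t"
    then show "ev \<rho> e = Some (v, t)" using det eq by (metis (no_types))
  qed
next
  case False
  then have "ev \<rho> e = None" unfolding ev_def by (rule if_not_P)
  then show ?thesis using False by (simp only: option.distinct) blast
qed

lemma evl_Some: "evl \<rho> e = Some (v, t) \<longleftrightarrow> evals prog \<rho> e v t"
proof (cases "\<exists>v t. evals prog \<rho> e v t")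
  case True
  then obtain v' t' where v': "evals prog \<rho> e v' t'" by blast
  note det = eval_evals_deterministic(2)[OF v']
  have "evl \<rho> e = Some (SOME (v, t). evals prog \<rho> e v t)"
    unfolding evl_def by (rule if_P[OF True])
  moreover have "(SOME (v, t). evals prog \<rho> e v t) = (v', t')"
  proof (rule some_equality)
    show "case (v', t') of (v, t) \<Rightarrow> evals prog \<rho> e v t" using v' by simp
    fix x assume "case x of (v, t) \<Rightarrow> evals prog \<rho> e v t"
    then have "evals prog \<rho> e (fst x) (snd x)" by (simp add: case_prod_beta)
    from det[OF this] show "x = (v', t')" by (metis prod.collapse)
  qed
  ultimately have eq: "evl \<rho> e = Some (v', t')" by (simp only:)
  show ?thesis
  proof
    assume "evl \<rho> e = Some (v, t)"
    then show "evals prog \<rho> e v t" using eq v' by (simp only: option.inject prod.inject)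
  next
    assume "evals prog \<rho> e v t"
    then show "evl \<rho> e = Some (v, t)" using det eq by (metis (no_types))
  qed
next
  case False
  then have "evl \<rho> e = None" unfolding evl_def by (rule if_not_P)
  then show ?thesis using False by (simp only: option.distinct) blast
qed

definition call :: "nat \<Rightarrow> sexp list \<Rightarrow> (sexp \<times> nat) option" where
  "call n vs = ev vs (prog ! n)"

lemma ev_Var: "n < length \<rho> \<Longrightarrow> ev \<rho> (Var n) = Some (\<rho> ! n, 1)"
  unfolding ev_Some by (rule eval_Var)
lemma ev_Quote: "ev \<rho> (Quote v) = Some (v, 1)"
  unfolding ev_Some by (rule eval_Quote)
lemma ev_MkCell: "ev \<rho> e = Some (v, s) \<Longrightarrow> ev \<rho> f = Some (w, t) \<Longrightarrow> ev \<rho> (MkCell e f) = Some (Cell v w, s + t + 1)"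
  unfolding ev_Some by (rule eval_MkCell)
lemma ev_Fst: "ev \<rho> e = Some (Cell v w, t) \<Longrightarrow> ev \<rho> (Fst e) = Some (v, t + 1)"
  unfolding ev_Some by (rule eval_Fst)
lemma ev_Snd: "ev \<rho> e = Some (Cell v w, t) \<Longrightarrow> ev \<rho> (Snd e) = Some (w, t + 1)"
  unfolding ev_Some by (rule eval_Snd)
lemma ev_IsAtom0: "ev \<rho> e = Some (Cell v w, t) \<Longrightarrow> ev \<rho> (IsAtom e) = Some (Atom 0, t + 1)"
  unfolding ev_Some using eval_IsAtom[of prog \<rho> e "Cell v w" t] by (simp add: truth_def)
lemma ev_IsAtom1: "ev \<rho> e = Some (Atom m, t) \<Longrightarrow> ev \<rho> (IsAtom e) = Some (Atom 1, t + 1)"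
  unfolding ev_Some using eval_IsAtom[of prog \<rho> e "Atom m" t] by (simp add: truth_def)
lemma ev_EqAtom: "ev \<rho> e = Some (Atom m, s) \<Longrightarrow> ev \<rho> f = Some (Atom n, t) \<Longrightarrow>
    ev \<rho> (EqAtom e f) = Some (truth (m = n), s + t + 1)"
  unfolding ev_Some by (rule eval_EqAtom)
lemma ev_Cond1: "ev \<rho> e = Some (u, s) \<Longrightarrow> u \<noteq> Atom 0 \<Longrightarrow> ev \<rho> f = Some (v, t) \<Longrightarrow>
    ev \<rho> (Cond e f g) = Some (v, s + t + 1)"
  unfolding ev_Some by (rule eval_Cond_true)
lemma ev_Cond0: "ev \<rho> e = Some (Atom 0, s) \<Longrightarrow> ev \<rho> g = Some (v, t) \<Longrightarrow>
    ev \<rho> (Cond e f g) = Some (v, s + t + 1)"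
  unfolding ev_Some by (rule eval_Cond_false)
lemma ev_Call: "evl \<rho> es = Some (vs, s) \<Longrightarrow> n < 33 \<Longrightarrow> call n vs = Some (v, t) \<Longrightarrow>
    ev \<rho> (Call n es) = Some (v, s + t + 1)"
  unfolding call_def ev_Some evl_Some by (rule eval_Call) (simp_all add: prog_len)
lemma evl_Nil: "evl \<rho> [] = Some ([], 1)"
  unfolding evl_Some by (rule evals_Nil)
lemma evl_Cons: "ev \<rho> e = Some (v, s) \<Longrightarrow> evl \<rho> es = Some (vs, t) \<Longrightarrow> evl \<rho> (e # es) = Some (v # vs, s + t + 1)"
  unfolding evl_Some ev_Some by (rule evals_Cons)

lemmas ev_simps = ev_Var ev_Quote ev_MkCell ev_Fst ev_Snd ev_IsAtom0 ev_IsAtom1 ev_EqAtom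
  ev_Cond1 ev_Cond0 ev_Call evl_Nil evl_Cons

text \<open>A bound on the time instead of its exact value, so that branches of different cost have
  a common estimate.\<close>

definition gives :: "nat \<Rightarrow> sexp list \<Rightarrow> sexp \<Rightarrow> nat \<Rightarrow> bool" where
  "gives n vs v T \<longleftrightarrow> (\<exists>t\<le>T. call n vs = Some (v, t))"

lemma gives_mono: "gives n vs v T \<Longrightarrow> T \<le> T' \<Longrightarrow> gives n vs v T'"
  unfolding gives_def by (meson le_trans)

section \<open>Encoding of the data\<close>

definition enc_rec :: "rec \<Rightarrow> sexp" where
  "enc_rec a = Cell (Atom (rid a)) (Cell (Atom (rtl a)) (Atom (rhd a)))"
definition eN :: "nat list \<Rightarrow> sexp" where "eN xs = list_sexp (map Atom xs)"
definition eR :: "rec list \<Rightarrow> sexp" where "eR xs = list_sexp (map enc_rec xs)"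
definition eE :: "nat \<times> rec list \<Rightarrow> sexp" where "eE x = Cell (Atom (fst x)) (eR (snd x))"
definition eT :: "(nat \<times> rec list) list \<Rightarrow> sexp" where "eT xs = list_sexp (map eE xs)"
definition eU :: "nat \<Rightarrow> sexp" where "eU n = list_sexp (replicate n (Atom 0))"
text \<open>The key is returned along with the walk: an empty walk alone would be encoded as atom 0
  and be mistaken for a missing entry.\<close>

definition eL :: "nat \<Rightarrow> rec list option \<Rightarrow> sexp" where
  "eL v x = (case x of None \<Rightarrow> Atom 0 | Some p \<Rightarrow> Cell (Atom v) (eR p))"

lemma enc_simps:
  "eN [] = Atom 0" "eN (x # xs) = Cell (Atom x) (eN xs)"
  "eR [] = Atom 0" "eR (a # A) = Cell (enc_rec a) (eR A)"
  "eT [] = Atom 0" "eT (y # T) = Cell (eE y) (eT T)"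
  "eU 0 = Atom 0" "eU (Suc n) = Cell (Atom 0) (eU n)" "eU (1 + n) = Cell (Atom 0) (eU n)"
  "eL v None = Atom 0" "eL v (Some p) = Cell (Atom v) (eR p)"
  by (simp_all add: eN_def eR_def eT_def eU_def eL_def)

lemmas run = ev_simps enc_simps enc_rec_def eE_def

lemmas bodies = solve_body_def mem_body_def lookup_body_def cost_body_def less_body_def upd_body_def upd_cases_body_def relax_body_def rounds_body_def
  bf_body_def strong_arcs_body_def outs_body_def ins_body_def follow_body_def follow_cases_body_def zs_body_def zs_cases_body_def heads_body_def inside_body_def
  outside_body_def other_arcs_body_def ids_body_def findcyc_body_def findcyc_cases_body_def comb_body_def check_body_def candidate_set_body_def candidate_set_cases_body_def search2_body_def
  search2_cases_body_def search1_body_def search1_cases_body_def solve_strong_body_def Let_def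

lemmas start = gives_def call_def prog_nth bodies

lemma givesE: "gives n vs v T \<Longrightarrow> (\<And>t. t \<le> T \<Longrightarrow> call n vs = Some (v, t) \<Longrightarrow> thesis) \<Longrightarrow> thesis"
  unfolding gives_def by blast

declare One_nat_def [simp del]

text \<open>One pass over a list of length \<open>k\<close>. Here and below the numerical constants
  are generous bounds for the work in a single call; only the polynomial growth matters.\<close>

definition time_scan :: "nat \<Rightarrow> nat" where "time_scan k = 60 * (k + 1)"

section \<open>Values and running times of the functions\<close>

lemma mem_gives: "gives 1 [Atom v, eN L] (truth (v \<in> set L)) (time_scan (length L))"
proof (induction L)
  case Nil
  show ?case unfolding start by (simp add: run truth_def time_scan_def)
next
  case (Cons x L)
  from Cons.IH show ?case
  proof (rule givesE)
    fix t assume t: "t \<le> time_scan (length L)" "call 1 [Atom v, eN L] = Some (truth (v \<in> set L), t)"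
    show ?thesis unfolding start using t by (cases "x = v") (simp_all add: run truth_def time_scan_def)
  qed
qed

lemma lookup_gives: "gives 2 [Atom v, eT T] (eL v (map_of T v)) (time_scan (length T))"
proof (induction T)
  case Nil
  show ?case unfolding start by (simp add: run truth_def time_scan_def)
next
  case (Cons x T)
  from Cons.IH show ?case
  proof (rule givesE)
    fix t assume t: "t \<le> time_scan (length T)" "call 2 [Atom v, eT T] = Some (eL v (map_of T v), t)"
    show ?thesis unfolding start using t
      by (cases x; cases "fst x = v") (simp_all add: run truth_def time_scan_def)
  qed
qed

lemma cost_gives: "gives 3 [eR p, eN Z] (eU (cost Z p)) ((length p + 1) * (time_scan (length Z) + 60))"
proof (induction p)
  case Nil
  show ?case unfolding start by (simp add: run truth_def)
next
  case (Cons a p)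
  from Cons.IH show ?case
  proof (rule givesE)
    fix t assume t: "t \<le> (length p + 1) * (time_scan (length Z) + 60)" "call 3 [eR p, eN Z] = Some (eU (cost Z p), t)"
    from mem_gives[of "rhd a" Z] show ?thesis
    proof (rule givesE)
      fix s assume s: "s \<le> time_scan (length Z)" "call 1 [Atom (rhd a), eN Z] = Some (truth (rhd a \<in> set Z), s)"
      show ?thesis unfolding start using t s
        by (cases "rhd a \<in> set Z") (simp_all add: run truth_def)
    qed
  qed
qed

lemma less_gives: "gives 4 [eU m, eU n] (truth (m < n)) (time_scan n)"
proof (induction n arbitrary: m)
  case 0
  show ?case unfolding start by (simp add: run truth_def time_scan_def)
next
  case (Suc n)
  show ?case
  proof (cases m)
    case 0
    then show ?thesis unfolding start by (simp add: run truth_def time_scan_def)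
  next
    case (Suc m')
    from Suc.IH[of m'] show ?thesis
    proof (rule givesE)
      fix t assume t: "t \<le> time_scan n" "call 4 [eU m', eU n] = Some (truth (m' < n), t)"
      show ?thesis unfolding start Suc using t by (simp add: run time_scan_def)
    qed
  qed
qed

lemma time_scan_mono: "k \<le> k' \<Longrightarrow> time_scan k \<le> time_scan k'"
  by (simp add: time_scan_def)

lemma loop_mono: "n \<le> K \<Longrightarrow> c \<le> c' \<Longrightarrow> (n + 1) * c \<le> (K + 1) * (c'::nat)"
  by (intro mult_le_mono) auto

definition time_cost :: "nat \<Rightarrow> nat" where "time_cost K = (K + 1 + 1) * (time_scan K + 60)"

lemma cost_gives': "length p \<le> K + 1 \<Longrightarrow> length Z \<le> K \<Longrightarrow> gives 3 [eR p, eN Z] (eU (cost Z p)) (time_cost K)"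
  unfolding time_cost_def by (rule gives_mono[OF cost_gives loop_mono]) (auto intro: time_scan_mono)

text \<open>Each new entry extends a recorded walk by one arc and enlarges the table by one, so
  recorded walks are never longer than the table. This bounds the time for computing costs.\<close>

definition okT :: "(nat \<times> rec list) list \<Rightarrow> bool" where
  "okT T \<longleftrightarrow> (\<forall>x\<in>set T. length (snd x) \<le> length T)"

lemma okT_lookup: "okT T \<Longrightarrow> map_of T v = Some p \<Longrightarrow> length p \<le> length T"
  unfolding okT_def by (metis map_of_SomeD snd_conv)

lemma upd_cases: "upd Z a T = T \<or> (\<exists>p. map_of T (rtl a) = Some p \<and> upd Z a T = (rhd a, a # p) # T)"
  by (auto simp: upd_def split: option.splits)

lemma okT_upd: "okT T \<Longrightarrow> okT (upd Z a T)"
  using upd_cases[of Z a T] okT_lookup[of T "rtl a"] unfolding okT_def by fastforce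

lemma len_upd: "length (upd Z a T) \<le> length T + 1"
  using upd_cases[of Z a T] by auto

lemma relax_simps: "relax Z [] T = T" "relax Z (a # A) T = relax Z A (upd Z a T)"
  by (simp_all add: relax_def)

lemma rounds_simps: "rounds [] Z A T = T" "rounds (x # L) Z A T = rounds L Z A (relax Z A T)"
  by (simp_all add: rounds_def)

lemma okT_relax: "okT T \<Longrightarrow> okT (relax Z A T)"
  by (induction A arbitrary: T) (simp_all add: relax_simps okT_upd)

lemma len_relax: "length (relax Z A T) \<le> length T + length A"
proof (induction A arbitrary: T)
  case (Cons a A)
  show ?case using Cons[of "upd Z a T"] len_upd[of Z a T] by (simp add: relax_simps)
qed (simp add: relax_simps)

lemma okT_rounds: "okT T \<Longrightarrow> okT (rounds L Z A T)"
  by (induction L arbitrary: T) (simp_all add: rounds_simps okT_relax)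

lemma len_rounds: "length (rounds L Z A T) \<le> length T + length L * length A"
proof (induction L arbitrary: T)
  case (Cons x L)
  show ?case using Cons[of "relax Z A T"] len_relax[of Z A T] by (simp add: rounds_simps)
qed (simp add: rounds_simps)

definition "time_upd K = 2 * time_cost K + 3 * time_scan K + 300"

lemma upd_gives:
  assumes "length T \<le> K" "length Z \<le> K" "okT T"
  shows "gives 5 [enc_rec a, eT T, eN Z] (eT (upd Z a T)) (time_upd K)"
proof -
  let ?l = "eL (rtl a) (map_of T (rtl a))" and ?l' = "eL (rhd a) (map_of T (rhd a))"
  have "gives 6 [enc_rec a, eT T, eN Z, ?l, ?l'] (eT (upd Z a T)) (2 * time_cost K + time_scan K + 200)"
  proof (cases "map_of T (rtl a)")
    case None
    then show ?thesis unfolding start by (simp add: run upd_def)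
  next
    case p: (Some p)
    show ?thesis
    proof (cases "map_of T (rhd a)")
      case None
      then show ?thesis unfolding start using p by (simp add: run upd_def)
    next
      case q: (Some q)
      have "length p \<le> K" "length q \<le> K" using okT_lookup[OF assms(3)] p q assms(1) le_trans by blast+
      then have *: "length (a # p) \<le> K + 1" "length q \<le> K + 1" by auto
      obtain s1 where s1: "s1 \<le> time_cost K" "call 3 [eR (a # p), eN Z] = Some (eU (cost Z (a # p)), s1)"
        using cost_gives'[OF *(1) assms(2)] by (rule givesE)
      obtain s2 where s2: "s2 \<le> time_cost K" "call 3 [eR q, eN Z] = Some (eU (cost Z q), s2)"
        using cost_gives'[OF *(2) assms(2)] by (rule givesE)
      have "cost Z q \<le> K" using \<open>length q \<le> K\<close> by (metis cost_def le_trans length_filter_le)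
      then have "gives 4 [eU (cost Z (a # p)), eU (cost Z q)] (truth (cost Z (a # p) < cost Z q)) (time_scan K)"
        by (rule gives_mono[OF less_gives time_scan_mono])
      then obtain s3 where s3: "s3 \<le> time_scan K"
        "call 4 [eU (cost Z (a # p)), eU (cost Z q)] = Some (truth (cost Z (a # p) < cost Z q), s3)"
        by (rule givesE)
      show ?thesis
      proof (cases "cost Z (a # p) < cost Z q")
        case True
        then have "upd Z a T = (rhd a, a # p) # T" using p q by (simp add: upd_def)
        then show ?thesis unfolding start using p q s1 s2 s3 True
          by (simp add: run truth_def del: cost_simps)
      next
        case False
        then have "upd Z a T = T" using p q by (simp add: upd_def del: cost_simps)
        then show ?thesis unfolding start using p q s1 s2 s3 False
          by (simp add: run truth_def del: cost_simps)
      qed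
    qed
  qed
  then obtain s where s: "s \<le> 2 * time_cost K + time_scan K + 200"
    "call 6 [enc_rec a, eT T, eN Z, ?l, ?l'] = Some (eT (upd Z a T), s)" by (rule givesE)
  have lk: "gives 2 [Atom v, eT T] (eL v (map_of T v)) (time_scan K)" for v
    by (rule gives_mono[OF lookup_gives time_scan_mono[OF assms(1)]])
  obtain s1 where s1: "s1 \<le> time_scan K" "call 2 [Atom (rtl a), eT T] = Some (?l, s1)" using lk by (rule givesE)
  obtain s2 where s2: "s2 \<le> time_scan K" "call 2 [Atom (rhd a), eT T] = Some (?l', s2)" using lk by (rule givesE)
  show ?thesis unfolding start using s s1 s2 by (simp add: run time_upd_def)
qed

definition "time_relax K = (K + 1) * (time_upd K + 60)"

lemma relax_gives:
  assumes "length T + length A \<le> K" "length Z \<le> K" "okT T"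
  shows "gives 7 [eR A, eT T, eN Z] (eT (relax Z A T)) (time_relax K)"
proof -
  have "gives 7 [eR A, eT T, eN Z] (eT (relax Z A T)) ((length A + 1) * (time_upd K + 60))"
    using assms
  proof (induction A arbitrary: T)
    case Nil
    show ?case unfolding start by (simp add: run relax_simps)
  next
    case (Cons a A)
    have "length T \<le> K" using Cons.prems(1) by simp
    from upd_gives[OF this Cons.prems(2,3)]
    obtain s where s: "s \<le> time_upd K" "call 5 [enc_rec a, eT T, eN Z] = Some (eT (upd Z a T), s)" by (rule givesE)
    have "length (upd Z a T) + length A \<le> K" using Cons.prems(1) len_upd[of Z a T] by simp
    from Cons.IH[OF this Cons.prems(2) okT_upd[OF Cons.prems(3)]]
    obtain s' where s': "s' \<le> (length A + 1) * (time_upd K + 60)"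
      "call 7 [eR A, eT (upd Z a T), eN Z] = Some (eT (relax Z A (upd Z a T)), s')" by (rule givesE)
    show ?case unfolding start using s s' by (simp add: run relax_simps)
  qed
  then show ?thesis unfolding time_relax_def by (rule gives_mono[OF _ loop_mono]) (use assms in auto)
qed

definition "time_bf K = (K + 1) * (time_relax K + 60) + 100"

text \<open>The table starts with one entry and each of the \<open>length L * length A\<close>
  relaxations adds at most one, so \<open>K\<close> bounds its size, and by \<open>okT\<close> the
  recorded walks, throughout.\<close>

lemma bf_gives:
  assumes "1 + length L * length A \<le> K" "length L \<le> K" "length Z \<le> K"
  shows "gives 9 [Atom u, eR A, eN Z, eN L] (eT (bf u A Z L)) (time_bf K)"
proof -
  have "gives 8 [eN L, eR A, eT T, eN Z] (eT (rounds L Z A T)) ((length L + 1) * (time_relax K + 60))"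
    if "length T + length L * length A \<le> K" "okT T" for T
    using that
  proof (induction L arbitrary: T)
    case Nil
    show ?case unfolding start by (simp add: run rounds_simps)
  next
    case (Cons x L)
    have "length T + length A \<le> K" using Cons.prems(1) by simp
    from relax_gives[OF this assms(3) Cons.prems(2)]
    obtain s where s: "s \<le> time_relax K" "call 7 [eR A, eT T, eN Z] = Some (eT (relax Z A T), s)" by (rule givesE)
    have "length (relax Z A T) + length L * length A \<le> K" using Cons.prems(1) len_relax[of Z A T] by simp
    from Cons.IH[OF this okT_relax[OF Cons.prems(2)]]
    obtain s' where s': "s' \<le> (length L + 1) * (time_relax K + 60)"
      "call 8 [eN L, eR A, eT (relax Z A T), eN Z] = Some (eT (rounds L Z A (relax Z A T)), s')" by (rule givesE)
    show ?case unfolding start using s s' by (simp add: run rounds_simps)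
  qed
  from this[of "[(u, [])]"] assms(1)
  have "gives 8 [eN L, eR A, eT [(u, [])], eN Z] (eT (bf u A Z L)) ((length L + 1) * (time_relax K + 60))"
    by (simp add: bf_def okT_def)
  then have "gives 8 [eN L, eR A, eT [(u, [])], eN Z] (eT (bf u A Z L)) ((K + 1) * (time_relax K + 60))"
    by (rule gives_mono[OF _ loop_mono[OF assms(2)]]) simp
  then obtain s where s: "s \<le> (K + 1) * (time_relax K + 60)"
    "call 8 [eN L, eR A, eT [(u, [])], eN Z] = Some (eT (bf u A Z L), s)" by (rule givesE)
  show ?thesis unfolding start using s by (simp add: run time_bf_def)
qed

lemma bf_sizes:
  assumes "1 + length L * length A \<le> K"
  shows "length (bf u A Z L) \<le> K" "map_of (bf u A Z L) v = Some p \<Longrightarrow> length p \<le> K"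
proof -
  show l: "length (bf u A Z L) \<le> K" using assms len_rounds[of L Z A "[(u, [])]"] by (simp add: bf_def)
  have "okT (bf u A Z L)" unfolding bf_def by (rule okT_rounds) (simp add: okT_def)
  then show "map_of (bf u A Z L) v = Some p \<Longrightarrow> length p \<le> K" using okT_lookup l le_trans by blast
qed

lemma bf_lookup:
  assumes "1 + length L * length A \<le> K" "length L \<le> K" "length Z \<le> K"
  obtains s s' where "s \<le> time_bf K" "call 9 [Atom u, eR A, eN Z, eN L] = Some (eT (bf u A Z L), s)"
    "s' \<le> time_scan K" "call 2 [Atom v, eT (bf u A Z L)] = Some (eL v (map_of (bf u A Z L) v), s')"
proof -
  obtain s where s: "s \<le> time_bf K" "call 9 [Atom u, eR A, eN Z, eN L] = Some (eT (bf u A Z L), s)"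
    using bf_gives[OF assms] by (rule givesE)
  have "gives 2 [Atom v, eT (bf u A Z L)] (eL v (map_of (bf u A Z L) v)) (time_scan K)"
    by (rule gives_mono[OF lookup_gives time_scan_mono[OF bf_sizes(1)[OF assms(1)]]])
  then obtain s' where "s' \<le> time_scan K" "call 2 [Atom v, eT (bf u A Z L)] = Some (eL v (map_of (bf u A Z L) v), s')"
    by (rule givesE)
  with s show ?thesis using that by blast
qed

definition "time_strong_arcs K = (K + 1) * (time_bf K + time_scan K + 200)"

lemma strong_arcs_gives:
  assumes A: "1 + length L * length A \<le> K" "length L \<le> K" and "length as \<le> K"
  shows "gives 10 [eR as, eR A, eN L] (eR (strong_arcs A L as)) (time_strong_arcs K)"
proof -
  have "gives 10 [eR as, eR A, eN L] (eR (strong_arcs A L as)) ((length as + 1) * (time_bf K + time_scan K + 200))"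
  proof (induction as)
    case Nil
    show ?case unfolding start by (simp add: run strong_arcs_def)
  next
    case (Cons a as)
    obtain r where r: "r \<le> (length as + 1) * (time_bf K + time_scan K + 200)"
      "call 10 [eR as, eR A, eN L] = Some (eR (strong_arcs A L as), r)" using Cons.IH by (rule givesE)
    obtain s s' where s: "s \<le> time_bf K" "call 9 [Atom (rhd a), eR A, eN [], eN L] = Some (eT (bf (rhd a) A [] L), s)"
      "s' \<le> time_scan K" "call 2 [Atom (rtl a), eT (bf (rhd a) A [] L)] =
        Some (eL (rtl a) (map_of (bf (rhd a) A [] L) (rtl a)), s')"
      using bf_lookup[OF A, of "[]" "rhd a" "rtl a"] by auto
    show ?case
    proof (cases "map_of (bf (rhd a) A [] L) (rtl a)")
      case None
      then show ?thesis unfolding start using r s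
        by (cases "rtl a = rhd a") (simp_all add: run strong_arcs_def truth_def)
    next
      case (Some p)
      then show ?thesis unfolding start using r s
        by (cases "rtl a = rhd a") (simp_all add: run strong_arcs_def truth_def)
    qed
  qed
  then show ?thesis unfolding time_strong_arcs_def by (rule gives_mono[OF _ loop_mono[OF assms(3)]]) simp
qed

lemma outs_gives: "gives 11 [Atom v, eR A] (eR (outs v A)) (time_scan (length A))"
proof (induction A)
  case Nil
  show ?case unfolding start by (simp add: run outs_def time_scan_def)
next
  case (Cons a A)
  obtain r where r: "r \<le> time_scan (length A)" "call 11 [Atom v, eR A] = Some (eR (outs v A), r)"
    using Cons.IH by (rule givesE)
  show ?case unfolding start using r
    by (cases "rtl a = v") (simp_all add: run outs_def truth_def time_scan_def)
qed

lemma ins_gives: "gives 12 [Atom v, eR A] (eR (ins v A)) (time_scan (length A))"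
proof (induction A)
  case Nil
  show ?case unfolding start by (simp add: run ins_def time_scan_def)
next
  case (Cons a A)
  obtain r where r: "r \<le> time_scan (length A)" "call 12 [Atom v, eR A] = Some (eR (ins v A), r)"
    using Cons.IH by (rule givesE)
  show ?case unfolding start using r
    by (cases "rhd a = v") (simp_all add: run ins_def truth_def time_scan_def)
qed

definition "time_follow K = (K + 1) * (time_scan K + 300)"

lemma follow_gives:
  assumes "length L \<le> K" "length A \<le> K"
  shows "gives 13 [eN L, Atom v, eR A] (Atom (follow L v A)) (time_follow K)"
proof -
  have "gives 13 [eN L, Atom v, eR A] (Atom (follow L v A)) ((length L + 1) * (time_scan (length A) + 300))"
  proof (induction L arbitrary: v)
    case Nil
    show ?case unfolding start by (simp add: run)
  next
    case (Cons x L)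
    obtain s where s: "s \<le> time_scan (length A)" "call 11 [Atom v, eR A] = Some (eR (outs v A), s)"
      using outs_gives by (rule givesE)
    have "gives 14 [eN L, Atom v, eR A, eR (outs v A)] (Atom (follow (x # L) v A))
        ((length L + 1) * (time_scan (length A) + 300) + 100)"
    proof (cases "outs v A")
      case Nil
      then show ?thesis unfolding start by (simp add: run)
    next
      case (Cons a as)
      show ?thesis
      proof (cases as)
        case Nil
        obtain r where r: "r \<le> (length L + 1) * (time_scan (length A) + 300)"
          "call 13 [eN L, Atom (rhd a), eR A] = Some (Atom (follow L (rhd a) A), r)"
          using Cons.IH[of "rhd a"] by (rule givesE)
        show ?thesis unfolding start using r Cons Nil by (simp add: run)
      next
        case (Cons b bs)
        then show ?thesis unfolding start using \<open>outs v A = a # as\<close> by (simp add: run)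
      qed
    qed
    then obtain r where r: "r \<le> (length L + 1) * (time_scan (length A) + 300) + 100"
      "call 14 [eN L, Atom v, eR A, eR (outs v A)] = Some (Atom (follow (x # L) v A), r)" by (rule givesE)
    show ?case unfolding start using s r by (simp add: run del: follow.simps)
  qed
  then show ?thesis unfolding time_follow_def
    by (rule gives_mono[OF _ loop_mono[OF assms(1)]]) (simp add: time_scan_mono[OF assms(2)])
qed

definition "time_zs K = (K + 1) * (time_follow K + time_scan K + 300)"

lemma zs_gives:
  assumes "length L \<le> K" "length A \<le> K" "length as \<le> K"
  shows "gives 15 [eN L, eR A, eR as] (eN (zs L A as)) (time_zs K)"
proof -
  have "gives 15 [eN L, eR A, eR as] (eN (zs L A as)) ((length as + 1) * (time_follow K + time_scan K + 300))"
  proof (induction as)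
    case Nil
    show ?case unfolding start by (simp add: run)
  next
    case (Cons a as)
    obtain r where r: "r \<le> (length as + 1) * (time_follow K + time_scan K + 300)"
      "call 15 [eN L, eR A, eR as] = Some (eN (zs L A as), r)" using Cons.IH by (rule givesE)
    have "gives 12 [Atom (rhd a), eR A] (eR (ins (rhd a) A)) (time_scan K)"
      by (rule gives_mono[OF ins_gives time_scan_mono[OF assms(2)]])
    then obtain s where s: "s \<le> time_scan K" "call 12 [Atom (rhd a), eR A] = Some (eR (ins (rhd a) A), s)"
      by (rule givesE)
    obtain u where u: "u \<le> time_follow K" "call 13 [eN L, Atom (rhd a), eR A] = Some (Atom (follow L (rhd a) A), u)"
      using follow_gives[OF assms(1,2)] by (rule givesE)
    have "gives 16 [eN L, eR A, eR (a # as), eR (ins (rhd a) A)] (eN (zs L A (a # as)))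
        ((length as + 1) * (time_follow K + time_scan K + 300) + time_follow K + 100)"
    proof (cases "ins (rhd a) A")
      case Nil
      then show ?thesis unfolding start using r by (simp add: run)
    next
      case (Cons b bs)
      then show ?thesis unfolding start using r u by (cases bs) (simp_all add: run)
    qed
    then obtain r' where r': "r' \<le> (length as + 1) * (time_follow K + time_scan K + 300) + time_follow K + 100"
      "call 16 [eN L, eR A, eR (a # as), eR (ins (rhd a) A)] = Some (eN (zs L A (a # as)), r')" by (rule givesE)
    show ?case unfolding start using s r' by (simp add: run del: zs.simps)
  qed
  then show ?thesis unfolding time_zs_def by (rule gives_mono[OF _ loop_mono[OF assms(3)]]) simp
qed

lemma heads_gives: "gives 17 [eR p, eN acc] (eN (map rhd p @ acc)) (time_scan (length p))"
proof (induction p)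
  case Nil
  show ?case unfolding start by (simp add: run time_scan_def)
next
  case (Cons a p)
  obtain r where r: "r \<le> time_scan (length p)" "call 17 [eR p, eN acc] = Some (eN (map rhd p @ acc), r)"
    using Cons.IH by (rule givesE)
  show ?case unfolding start using r by (simp add: run time_scan_def)
qed

text \<open>A candidate set lists the heads of two walks of at most \<open>K\<close> arcs and two
  further heads, whence \<open>2 * K + 2\<close>.\<close>

definition "time_restrict K = (K + 1) * (2 * time_scan (2 * K + 2) + 200)"

lemma
  assumes "length X \<le> 2 * K + 2" "length A \<le> K"
  shows inside_gives: "gives 18 [eR A, eN X] (eR (inside A X)) (time_restrict K)"
    and outside_gives: "gives 19 [eR A, eN X] (eR (outside A X)) (time_restrict K)"
proof -
  have mem: "gives 1 [Atom v, eN X] (truth (v \<in> set X)) (time_scan (2 * K + 2))" for v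
    by (rule gives_mono[OF mem_gives time_scan_mono[OF assms(1)]])
  have "gives 18 [eR A, eN X] (eR (inside A X)) ((length A + 1) * (2 * time_scan (2 * K + 2) + 200))"
  proof (induction A)
    case Nil
    show ?case unfolding start by (simp add: run inside_def)
  next
    case (Cons a A)
    obtain r where r: "r \<le> (length A + 1) * (2 * time_scan (2 * K + 2) + 200)"
      "call 18 [eR A, eN X] = Some (eR (inside A X), r)" using Cons.IH by (rule givesE)
    obtain s where s: "s \<le> time_scan (2 * K + 2)" "call 1 [Atom (rtl a), eN X] = Some (truth (rtl a \<in> set X), s)"
      using mem by (rule givesE)
    obtain s' where s': "s' \<le> time_scan (2 * K + 2)" "call 1 [Atom (rhd a), eN X] = Some (truth (rhd a \<in> set X), s')"
      using mem by (rule givesE)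
    show ?case unfolding start using r s s'
      by (cases "rtl a \<in> set X"; cases "rhd a \<in> set X") (simp_all add: run inside_def truth_def)
  qed
  then show "gives 18 [eR A, eN X] (eR (inside A X)) (time_restrict K)"
    unfolding time_restrict_def by (rule gives_mono[OF _ loop_mono[OF assms(2)]]) simp
  have "gives 19 [eR A, eN X] (eR (outside A X)) ((length A + 1) * (2 * time_scan (2 * K + 2) + 200))"
  proof (induction A)
    case Nil
    show ?case unfolding start by (simp add: run outside_def)
  next
    case (Cons a A)
    obtain r where r: "r \<le> (length A + 1) * (2 * time_scan (2 * K + 2) + 200)"
      "call 19 [eR A, eN X] = Some (eR (outside A X), r)" using Cons.IH by (rule givesE)
    obtain s where s: "s \<le> time_scan (2 * K + 2)" "call 1 [Atom (rtl a), eN X] = Some (truth (rtl a \<in> set X), s)"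
      using mem by (rule givesE)
    obtain s' where s': "s' \<le> time_scan (2 * K + 2)" "call 1 [Atom (rhd a), eN X] = Some (truth (rhd a \<in> set X), s')"
      using mem by (rule givesE)
    show ?case unfolding start using r s s'
      by (cases "rtl a \<in> set X"; cases "rhd a \<in> set X") (simp_all add: run outside_def truth_def)
  qed
  then show "gives 19 [eR A, eN X] (eR (outside A X)) (time_restrict K)"
    unfolding time_restrict_def by (rule gives_mono[OF _ loop_mono[OF assms(2)]]) simp
qed

definition "time_other_arcs K = (K + 1) * (200::nat)"

lemma other_arcs_gives:
  assumes "length A \<le> K"
  shows "gives 20 [Atom e, eR A, truth s] (eR (other_arcs e A s)) (time_other_arcs K)"
proof -
  have "gives 20 [Atom e, eR A, truth s] (eR (other_arcs e A s)) ((length A + 1) * 200)"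
  proof (induction A)
    case Nil
    show ?case unfolding start by (simp add: run other_arcs_def)
  next
    case (Cons a A)
    obtain r where r: "r \<le> (length A + 1) * 200" "call 20 [Atom e, eR A, truth s] = Some (eR (other_arcs e A s), r)"
      using Cons.IH by (rule givesE)
    show ?case unfolding start using r
      by (cases "rid a = e"; cases s) (simp_all add: run other_arcs_def truth_def flip_def)
  qed
  then show ?thesis unfolding time_other_arcs_def by (rule gives_mono[OF _ loop_mono[OF assms]]) simp
qed

lemma len_other_arcs: "length (other_arcs e A s) \<le> 2 * length A"
  by (induction A) (auto simp: other_arcs_def)

lemma ids_gives: "gives 21 [eR p, eN acc] (eN (map rid (rev p) @ acc)) (time_scan (length p))"
proof (induction p arbitrary: acc)
  case Nil
  show ?case unfolding start by (simp add: run time_scan_def)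
next
  case (Cons a p)
  obtain r where r: "r \<le> time_scan (length p)" "call 21 [eR p, eN (rid a # acc)] = Some (eN (map rid (rev p) @ rid a # acc), r)"
    using Cons.IH by (rule givesE)
  show ?case unfolding start using r by (simp add: run time_scan_def)
qed

definition eC :: "nat list option \<Rightarrow> sexp" where "eC x = (case x of None \<Rightarrow> Atom 0 | Some c \<Rightarrow> eN c)"

definition "time_findcyc K = (K + 1) * (time_other_arcs K + time_bf K + 2 * time_scan K + 400)"

text \<open>The factor 2 allows for the reversed copies added by \<open>other_arcs\<close>.\<close>

lemma findcyc_gives:
  assumes A: "1 + length L * (2 * length A) \<le> K" "length L \<le> K" "length A \<le> K" "length as \<le> K"
  shows "gives 22 [eR A, truth s, eN L, eR as] (eC (findcyc A s L as)) (time_findcyc K)"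
proof -
  let ?c = "time_other_arcs K + time_bf K + 2 * time_scan K + 400"
  have "gives 22 [eR A, truth s, eN L, eR as] (eC (findcyc A s L as)) ((length as + 1) * ?c)"
  proof (induction as)
    case Nil
    show ?case unfolding start by (simp add: run eC_def)
  next
    case (Cons a as)
    let ?P = "other_arcs (rid a) A s"
    let ?m = "map_of (bf (rhd a) ?P [] L) (rtl a)"
    obtain r where r: "r \<le> (length as + 1) * ?c"
      "call 22 [eR A, truth s, eN L, eR as] = Some (eC (findcyc A s L as), r)" using Cons.IH by (rule givesE)
    have P: "1 + length L * length ?P \<le> K"
      using A(1) mult_le_mono2[OF len_other_arcs[of "rid a" A s], of "length L"] by linarith
    obtain u where u: "u \<le> time_other_arcs K" "call 20 [Atom (rid a), eR A, truth s] = Some (eR ?P, u)"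
      using other_arcs_gives[OF A(3)] by (rule givesE)
    obtain w w' where w: "w \<le> time_bf K" "call 9 [Atom (rhd a), eR ?P, eN [], eN L] = Some (eT (bf (rhd a) ?P [] L), w)"
      "w' \<le> time_scan K" "call 2 [Atom (rtl a), eT (bf (rhd a) ?P [] L)] = Some (eL (rtl a) ?m, w')"
      using bf_lookup[OF P A(2), of "[]" "rhd a" "rtl a"] by auto
    have "gives 23 [eR A, truth s, eN L, eR (a # as), eL (rtl a) ?m] (eC (findcyc A s L (a # as)))
        ((length as + 1) * ?c + time_scan K + 100)"
    proof (cases ?m)
      case None
      then show ?thesis unfolding start using r by (simp add: run)
    next
      case (Some p)
      have "gives 21 [eR p, eN [rid a]] (eN (map rid (rev p) @ [rid a])) (time_scan K)"
        by (rule gives_mono[OF ids_gives time_scan_mono[OF bf_sizes(2)[OF P Some]]])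
      then obtain v where v: "v \<le> time_scan K" "call 21 [eR p, eN [rid a]] = Some (eN (map rid (rev p) @ [rid a]), v)"
        by (rule givesE)
      show ?thesis unfolding start using v Some by (simp add: run eC_def)
    qed
    then obtain r' where r': "r' \<le> (length as + 1) * ?c + time_scan K + 100"
      "call 23 [eR A, truth s, eN L, eR (a # as), eL (rtl a) ?m] = Some (eC (findcyc A s L (a # as)), r')"
      by (rule givesE)
    show ?case unfolding start using u w r' by (simp add: run del: findcyc.simps)
  qed
  then show ?thesis unfolding time_findcyc_def by (rule gives_mono[OF _ loop_mono[OF A(4)]]) simp
qed

definition eP :: "(nat list \<times> nat list) option \<Rightarrow> sexp" where
  "eP x = (case x of None \<Rightarrow> Atom 0 | Some (b, c) \<Rightarrow> Cell (eN b) (eN c))"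

definition "time_check K = 2 * time_findcyc K + 4 * time_restrict K + 300"

text \<open>The encoding \<open>eC\<close> sends both \<open>None\<close> and an empty list to atom
  0; as a cycle found is nonempty, the program can tell success from failure.\<close>

lemma findcyc_ne: "findcyc A s L as = Some c \<Longrightarrow> c \<noteq> []"
  using findcyc_sound by blast

lemma check_gives:
  assumes A: "1 + length L * (2 * length A) \<le> K" "length L \<le> K" "length A \<le> K" and X: "length X \<le> 2 * K + 2"
  shows "gives 25 [eR A, eN X, eN L] (eP (check A X L)) (time_check K)"
proof -
  let ?I = "inside A X" and ?O = "outside A X"
  let ?x = "findcyc ?I False L ?I" and ?y = "findcyc ?O True L ?O"
  have len: "length ?I \<le> length A" "length ?O \<le> length A" by (simp_all add: inside_def outside_def)
  have IK: "1 + length L * (2 * length ?I) \<le> K" "1 + length L * (2 * length ?O) \<le> K"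
    using A(1) mult_le_mono2[OF mult_le_mono2[OF len(1), of 2], of "length L"]
      mult_le_mono2[OF mult_le_mono2[OF len(2), of 2], of "length L"] by linarith+
  have lK: "length ?I \<le> K" "length ?O \<le> K" using len A(3) by auto
  obtain i where i: "i \<le> time_restrict K" "call 18 [eR A, eN X] = Some (eR ?I, i)"
    using inside_gives[OF X A(3)] by (rule givesE)
  obtain j where j: "j \<le> time_restrict K" "call 19 [eR A, eN X] = Some (eR ?O, j)"
    using outside_gives[OF X A(3)] by (rule givesE)
  obtain x where x: "x \<le> time_findcyc K" "call 22 [eR ?I, truth False, eN L, eR ?I] = Some (eC ?x, x)"
    using findcyc_gives[OF IK(1) A(2) lK(1) lK(1)] by (rule givesE)
  obtain y where y: "y \<le> time_findcyc K" "call 22 [eR ?O, truth True, eN L, eR ?O] = Some (eC ?y, y)"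
    using findcyc_gives[OF IK(2) A(2) lK(2) lK(2)] by (rule givesE)
  have ne: "eN c \<noteq> Atom 0" if "c \<noteq> []" for c using that by (cases c) (auto simp: enc_simps)
  have "gives 24 [eC ?x, eC ?y] (eP (check A X L)) 100"
  proof (cases ?x)
    case None
    then show ?thesis unfolding start by (simp add: run eC_def eP_def check_def comb_def)
  next
    case (Some b)
    note b = this
    show ?thesis
    proof (cases ?y)
      case None
      then show ?thesis unfolding start using b ne[OF findcyc_ne[OF b]]
        by (simp add: run eC_def eP_def check_def comb_def)
    next
      case (Some c)
      then show ?thesis unfolding start using b ne[OF findcyc_ne[OF b]] ne[OF findcyc_ne[OF Some]]
        by (simp add: run eC_def eP_def check_def comb_def)
    qed
  qed
  then obtain z where z: "z \<le> 100" "call 24 [eC ?x, eC ?y] = Some (eP (check A X L), z)" by (rule givesE)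
  show ?thesis unfolding start using i j x y z by (simp add: run time_check_def truth_def)
qed

definition "time_candidate_set K = 2 * time_bf K + 4 * time_scan K + 400"

lemma candidate_set_gives:
  assumes A: "1 + length L * length A \<le> K" "length L \<le> K" "length Z \<le> K"
  shows "gives 26 [enc_rec e, enc_rec f, eR A, eN L, eN Z] (eN (candidate_set e f A L Z)) (time_candidate_set K)"
proof -
  let ?p = "map_of (bf (rhd e) A Z L) (rtl f)" and ?q = "map_of (bf (rhd f) A Z L) (rtl e)"
  obtain w w' where w: "w \<le> time_bf K" "call 9 [Atom (rhd e), eR A, eN Z, eN L] = Some (eT (bf (rhd e) A Z L), w)"
      "w' \<le> time_scan K" "call 2 [Atom (rtl f), eT (bf (rhd e) A Z L)] = Some (eL (rtl f) ?p, w')"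
    using bf_lookup[OF A] .
  obtain v v' where v: "v \<le> time_bf K" "call 9 [Atom (rhd f), eR A, eN Z, eN L] = Some (eT (bf (rhd f) A Z L), v)"
      "v' \<le> time_scan K" "call 2 [Atom (rtl e), eT (bf (rhd f) A Z L)] = Some (eL (rtl e) ?q, v')"
    using bf_lookup[OF A] .
  have "gives 27 [enc_rec e, enc_rec f, eL (rtl f) ?p, eL (rtl e) ?q] (eN (candidate_set e f A L Z)) (2 * time_scan K + 100)"
  proof (cases ?p)
    case None
    then show ?thesis unfolding start by (simp add: run candidate_set_def)
  next
    case p: (Some p)
    show ?thesis
    proof (cases ?q)
      case None
      then show ?thesis unfolding start using p by (simp add: run candidate_set_def)
    next
      case q: (Some q)
      let ?B = "[rhd e, rhd f]"
      have "gives 17 [eR q, eN ?B] (eN (map rhd q @ ?B)) (time_scan K)"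
        by (rule gives_mono[OF heads_gives time_scan_mono[OF bf_sizes(2)[OF A(1) q]]])
      then obtain x where x: "x \<le> time_scan K" "call 17 [eR q, eN ?B] = Some (eN (map rhd q @ ?B), x)" by (rule givesE)
      have "gives 17 [eR p, eN (map rhd q @ ?B)] (eN (map rhd p @ map rhd q @ ?B)) (time_scan K)"
        by (rule gives_mono[OF heads_gives time_scan_mono[OF bf_sizes(2)[OF A(1) p]]])
      then obtain y where y: "y \<le> time_scan K"
        "call 17 [eR p, eN (map rhd q @ ?B)] = Some (eN (map rhd p @ map rhd q @ ?B), y)" by (rule givesE)
      show ?thesis unfolding start using p q x y by (simp add: run candidate_set_def)
    qed
  qed
  then obtain z where z: "z \<le> 2 * time_scan K + 100"
    "call 27 [enc_rec e, enc_rec f, eL (rtl f) ?p, eL (rtl e) ?q] = Some (eN (candidate_set e f A L Z), z)" by (rule givesE)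
  show ?thesis unfolding start using w v z by (simp add: run time_candidate_set_def)
qed

lemma len_candidate_set:
  assumes "1 + length L * length A \<le> K"
  shows "length (candidate_set e f A L Z) \<le> 2 * K + 2"
proof -
  note size = bf_sizes(2)[OF assms]
  show ?thesis
  proof (cases "map_of (bf (rhd e) A Z L) (rtl f)")
    case p: (Some p)
    show ?thesis
    proof (cases "map_of (bf (rhd f) A Z L) (rtl e)")
      case q: (Some q)
      show ?thesis using size[OF p] size[OF q] p q by (simp add: candidate_set_def)
    qed (simp add: candidate_set_def p)
  qed (simp add: candidate_set_def)
qed

definition "time_search2 K = (K + 1) * (time_check K + time_candidate_set K + 400)"

lemma search2_gives:
  assumes A: "1 + length L * (2 * length A) \<le> K" "length L \<le> K" "length A \<le> K" "length Z \<le> K"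
    and SA: "1 + length L * length SA \<le> K" and fs: "length fs \<le> K"
  shows "gives 28 [enc_rec e, eR SA, eR A, eN L, eN Z, eR fs] (eP (search2 e SA A L Z fs)) (time_search2 K)"
proof -
  let ?c = "time_check K + time_candidate_set K + 400"
  have "gives 28 [enc_rec e, eR SA, eR A, eN L, eN Z, eR fs] (eP (search2 e SA A L Z fs)) ((length fs + 1) * ?c)"
  proof (induction fs)
    case Nil
    show ?case unfolding start by (simp add: run eP_def)
  next
    case (Cons f fs)
    let ?X = "candidate_set e f SA L Z"
    obtain r where r: "r \<le> (length fs + 1) * ?c"
      "call 28 [enc_rec e, eR SA, eR A, eN L, eN Z, eR fs] = Some (eP (search2 e SA A L Z fs), r)"
      using Cons.IH by (rule givesE)
    obtain x where x: "x \<le> time_candidate_set K" "call 26 [enc_rec e, enc_rec f, eR SA, eN L, eN Z] = Some (eN ?X, x)"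
      using candidate_set_gives[OF SA A(2) A(4)] by (rule givesE)
    obtain y where y: "y \<le> time_check K" "call 25 [eR A, eN ?X, eN L] = Some (eP (check A ?X L), y)"
      using check_gives[OF A(1-3) len_candidate_set[OF SA]] by (rule givesE)
    have "gives 29 [enc_rec e, eR SA, eR A, eN L, eN Z, eR (f # fs), eP (check A ?X L)]
        (eP (search2 e SA A L Z (f # fs))) ((length fs + 1) * ?c + 100)"
    proof (cases "check A ?X L")
      case None
      then show ?thesis unfolding start using r by (simp add: run eP_def)
    next
      case (Some bc)
      then show ?thesis unfolding start by (cases bc) (simp add: run eP_def)
    qed
    then obtain z where z: "z \<le> (length fs + 1) * ?c + 100"
      "call 29 [enc_rec e, eR SA, eR A, eN L, eN Z, eR (f # fs), eP (check A ?X L)] =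
        Some (eP (search2 e SA A L Z (f # fs)), z)" by (rule givesE)
    show ?case unfolding start using x y z by (simp add: run del: search2.simps)
  qed
  then show ?thesis unfolding time_search2_def by (rule gives_mono[OF _ loop_mono[OF fs]]) simp
qed

definition "time_search1 K = (K + 1) * (time_search2 K + 400)"

lemma search1_gives:
  assumes A: "1 + length L * (2 * length A) \<le> K" "length L \<le> K" "length A \<le> K" "length Z \<le> K"
    and SA: "1 + length L * length SA \<le> K" "length SA \<le> K" and es: "length es \<le> K"
  shows "gives 30 [eR SA, eR A, eN L, eN Z, eR es] (eP (search1 SA A L Z es)) (time_search1 K)"
proof -
  let ?c = "time_search2 K + 400"
  have "gives 30 [eR SA, eR A, eN L, eN Z, eR es] (eP (search1 SA A L Z es)) ((length es + 1) * ?c)"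
  proof (induction es)
    case Nil
    show ?case unfolding start by (simp add: run eP_def)
  next
    case (Cons e es)
    obtain r where r: "r \<le> (length es + 1) * ?c"
      "call 30 [eR SA, eR A, eN L, eN Z, eR es] = Some (eP (search1 SA A L Z es), r)"
      using Cons.IH by (rule givesE)
    obtain x where x: "x \<le> time_search2 K"
      "call 28 [enc_rec e, eR SA, eR A, eN L, eN Z, eR SA] = Some (eP (search2 e SA A L Z SA), x)"
      using search2_gives[OF A SA] by (rule givesE)
    have "gives 31 [eR SA, eR A, eN L, eN Z, eR (e # es), eP (search2 e SA A L Z SA)]
        (eP (search1 SA A L Z (e # es))) ((length es + 1) * ?c + 100)"
    proof (cases "search2 e SA A L Z SA")
      case None
      then show ?thesis unfolding start using r by (simp add: run eP_def)
    next
      case (Some bc)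
      then show ?thesis unfolding start by (cases bc) (simp add: run eP_def)
    qed
    then obtain z where z: "z \<le> (length es + 1) * ?c + 100"
      "call 31 [eR SA, eR A, eN L, eN Z, eR (e # es), eP (search2 e SA A L Z SA)] =
        Some (eP (search1 SA A L Z (e # es)), z)" by (rule givesE)
    show ?case unfolding start using x z by (simp add: run del: search1.simps)
  qed
  then show ?thesis unfolding time_search1_def by (rule gives_mono[OF _ loop_mono[OF es]]) simp
qed

definition "time_solve K = time_strong_arcs K + time_zs K + time_search1 K + 300"

lemma len_zs: "length (zs L A as) \<le> length as"
  by (induction as) (auto split: list.splits)

lemma solve_gives:
  assumes A: "1 + length L * (2 * length A) \<le> K" "length L \<le> K" "length A \<le> K"
  shows "gives 0 [eN L, eR A] (eP (solve A L)) (time_solve K)"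
proof -
  define SA where "SA = strong_arcs A L A"
  define Z where "Z = zs L SA SA"
  have l: "length SA \<le> length A" "length Z \<le> length SA" using len_zs by (simp_all add: SA_def strong_arcs_def Z_def)
  have A1: "1 + length L * length A \<le> K" using A(1) by simp
  have SA1: "1 + length L * length SA \<le> K" using A1 mult_le_mono2[OF l(1), of "length L"] by linarith
  have lK: "length SA \<le> K" "length Z \<le> K" using l A(3) by auto
  obtain x where x: "x \<le> time_strong_arcs K" "call 10 [eR A, eR A, eN L] = Some (eR SA, x)"
    using strong_arcs_gives[OF A1 A(2,3)] unfolding SA_def by (rule givesE)
  obtain y where y: "y \<le> time_zs K" "call 15 [eN L, eR SA, eR SA] = Some (eN Z, y)"
    using zs_gives[OF A(2) lK(1) lK(1)] unfolding Z_def by (rule givesE)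
  obtain z where z: "z \<le> time_search1 K" "call 30 [eR SA, eR A, eN L, eN Z, eR SA] = Some (eP (search1 SA A L Z SA), z)"
    using search1_gives[OF A lK(2) SA1 lK(1) lK(1)] by (rule givesE)
  have "gives 32 [eN L, eR A, eR SA] (eP (solve A L)) (time_zs K + time_search1 K + 100)"
    unfolding start using y z by (simp add: run solve_def Let_def SA_def[symmetric] Z_def[symmetric])
  then obtain w where w: "w \<le> time_zs K + time_search1 K + 100" "call 32 [eN L, eR A, eR SA] = Some (eP (solve A L), w)"
    by (rule givesE)
  show ?thesis unfolding start using x w by (simp add: run time_solve_def)
qed

section \<open>Polynomial bounds and the conclusion\<close>

definition poly :: "(nat \<Rightarrow> nat) \<Rightarrow> bool" where
  "poly f \<longleftrightarrow> (\<exists>c k. \<forall>n. f n \<le> c * (n + 1) ^ k)"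

lemma poly_const: "poly (\<lambda>n. a)"
  unfolding poly_def by (rule exI[of _ a], rule exI[of _ 0]) simp

lemma poly_id: "poly (\<lambda>n. n)"
  unfolding poly_def by (rule exI[of _ 1], rule exI[of _ 1]) simp

lemma poly_add: assumes "poly f" "poly g" shows "poly (\<lambda>n. f n + g n)"
proof -
  obtain c k c' k' where f: "\<And>n. f n \<le> c * (n + 1) ^ k" and g: "\<And>n. g n \<le> c' * (n + 1) ^ k'"
    using assms unfolding poly_def by blast
  have "f n + g n \<le> (c + c') * (n + 1) ^ (k + k')" for n
  proof -
    have e: "(n + 1) ^ k \<le> (n + 1) ^ (k + k')" "(n + 1) ^ k' \<le> (n + 1) ^ (k + k')"
      by (rule power_increasing; simp)+
    show ?thesis using f[of n] g[of n] mult_le_mono2[OF e(1), of c] mult_le_mono2[OF e(2), of c']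
      unfolding add_mult_distrib by linarith
  qed
  then show ?thesis unfolding poly_def by blast
qed

lemma poly_mult: assumes "poly f" "poly g" shows "poly (\<lambda>n. f n * g n)"
proof -
  obtain c k c' k' where f: "\<And>n. f n \<le> c * (n + 1) ^ k" and g: "\<And>n. g n \<le> c' * (n + 1) ^ k'"
    using assms unfolding poly_def by blast
  have "f n * g n \<le> (c * c') * (n + 1) ^ (k + k')" for n
    using mult_le_mono[OF f[of n] g[of n]] by (simp add: power_add mult_ac)
  then show ?thesis unfolding poly_def by blast
qed

lemma poly_time_solve: "poly (\<lambda>n. time_solve (2 * (n + 1) * (n + 1)))"
  unfolding time_solve_def time_search1_def time_search2_def time_candidate_set_def time_check_def time_findcyc_def time_other_arcs_def time_restrict_def time_zs_def time_follow_def time_strong_arcs_def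
    time_bf_def time_relax_def time_upd_def time_cost_def time_scan_def
  by (intro poly_add poly_mult poly_const poly_id)

theorem theorem7:
  shows "\<exists>(P :: program) (c :: nat) (k :: nat).
    \<forall>(G :: (nat, nat) pre_digraph) (vs :: nat list) (es :: nat list).
      fin_digraph G \<and> unique_scc_subdivides_vault G \<and> listing G vs es \<longrightarrow>
      (\<exists>v t. runs P (digraph_input G vs es) v t \<and>
             t \<le> c * (length vs + length es + 1) ^ k \<and>
             correct_answer G v)"
proof -
  obtain c k where ck: "\<And>n. time_solve (2 * (n + 1) * (n + 1)) \<le> c * (n + 1) ^ k"
    using poly_time_solve unfolding poly_def by blast
  have "\<exists>v t. runs prog (digraph_input G vs es) v t \<and> t \<le> c * (length vs + length es + 1) ^ k \<and>
      correct_answer G v"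
    if G: "fin_digraph G" "unique_scc_subdivides_vault G" "listing G vs es" for G vs es
  proof -
    define A where "A = map (\<lambda>e. (e, tail G e, head G e)) es"
    define n where "n = length vs + length es"
    \<comment> \<open>Large enough for the size \<open>1 + 2 * length vs * length es\<close> of a
      table over the arcs and their reversed copies, and for both lists.\<close>
    define K where "K = 2 * (n + 1) * (n + 1)"
    have "length vs * length es \<le> n * n" unfolding n_def by (rule mult_le_mono) simp_all
    then have "1 + length vs * (2 * length A) \<le> K" "length vs \<le> K" "length A \<le> K"
      by (simp_all add: A_def K_def n_def algebra_simps)
    then have "gives 0 [eN vs, eR A] (eP (solve A vs)) (time_solve K)" by (rule solve_gives)
    then obtain t where t: "t \<le> time_solve K" "call 0 [eN vs, eR A] = Some (eP (solve A vs), t)" by (rule givesE)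
    have "digraph_input G vs es = [eN vs, eR A]"
      by (simp add: digraph_input_def eN_def eR_def A_def enc_rec_def comp_def)
    moreover have "eval prog [eN vs, eR A] (prog ! 0) (eP (solve A vs)) t"
      using t(2) unfolding call_def ev_Some .
    ultimately have "runs prog (digraph_input G vs es) (eP (solve A vs)) t"
      by (simp add: runs_def prog_def)
    moreover have "t \<le> c * (length vs + length es + 1) ^ k"
      using le_trans[OF t(1)[unfolded K_def] ck[of n]] by (simp add: n_def)
    moreover have "correct_answer G (eP (solve A vs))"
    proof (cases "solve A vs")
      case None
      then show ?thesis using solve_correct(2)[OF G, folded A_def]
        by (auto simp: correct_answer_def eP_def)
    next
      case (Some p)
      obtain B C where p: "p = (B, C)" by (cases p)
      have "disjoint_cycles G B C" using solve_correct(1)[OF G, folded A_def] Some p by blast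
      then show ?thesis using Some p by (auto simp: correct_answer_def eP_def eN_def)
    qed
    ultimately show ?thesis by blast
  qed
  then show ?thesis by blast
qed

end
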